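(* Assume that $(\mathcal E,\mathcal F)$ is irreducible or transient. Then $(\mathcal E,\mathcal C)$ is closable on $L_2(X,m)$, and its closure $(\mathcal E,\mathcal F^{(m)})$ is a symmetric local regular Dirichlet form.
   Context: $X$ is a locally compact separable metric space. A nonnegative Radon measure $\mu$ on $X$ is an admissible reference measure if $\mu(U)>0$ for every nonempty open $U\subset X$. Let $\mu$ be an admissible reference measure and $(\mathcal E,\mathcal F)$ a regular symmetric Dirichlet form on $L_2(X,\mu)$; $\mathcal E(f)=\mathcal E(f,f)$. $C_0(X)$ is the space of continuous compactly supported functions and $\mathcal C:=C_0(X)\cap\mathcal F$. Energy measures: for $g,h\in\mathcal C$, $\Gamma(g,h)$ is the unique finite signed Radon measure with $2\int_X f\,d\Gamma(g,h)=\mathcal E(fg,h)+\mathcal E(fh,g)-\mathcal E(gh,f)$ for all $f\in\mathcal C$; $\Gamma(g):=\Gamma(g,g)\ge0$. $m$ is an admissible reference measure such that for every $f\in\mathcal C$ the measure $\Gamma(f)$ is absolutely continuous with respect to $m$. $(\mathcal E,\mathcal F)$ is transient (relative to $L_2(X,\mu)$) if there is a bounded, $\mu$-integrable, $\mu$-a.e. positive function $\gamma$ on $X$ with $\int_X|u|\gamma\,d\mu\le\mathcal E(u)^{1/2}$ for all $u\in\mathcal F$. It is irreducible if every set $A$ invariant under the associated Markovian semigroup $(T_t)_{t>0}$ satisfies $\mu(A)=0$ or $\mu(X\setminus A)=0$. Local is meant in the usual sense of Dirichlet form theory: the form vanishes on pairs of functions in its domain with disjoint compact supports.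
   Formalization: Locality of the closure is claimed only when the original form (E,F) is local; without this it fails (two-point space, counting measure, E(f,g)=(f(0)-f(1))(g(0)-g(1))). Closability, the Dirichlet property and regularity are proved without this assumption. *)

theory Defs
  imports "HOL-Analysis.Analysis"
begin

section \<open>Reference measures and function spaces\<close>

definition radon_measure :: "'a::topological_space measure \<Rightarrow> bool" where
  "radon_measure M \<longleftrightarrow>
     sets M = sets borel \<and>
     (\<forall>K. compact K \<longrightarrow> emeasure M K < \<infinity>) \<and>
     (\<forall>A\<in>sets borel. emeasure M A = (SUP K\<in>{K. compact K \<and> K \<subseteq> A}. emeasure M K))"

definition admissible_reference_measure :: "'a::topological_space measure \<Rightarrow> bool" where
  "admissible_reference_measure M \<longleftrightarrow>
     radon_measure M \<and> (\<forall>U. open U \<and> U \<noteq> {} \<longrightarrow> emeasure M U > 0)"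

definition C0 :: "('a::topological_space \<Rightarrow> real) set" where
  "C0 = {f. continuous_on UNIV f \<and> compact (closure {x. f x \<noteq> 0})}"

text \<open>
  Elements of \<open>L\<^sub>2(X, M)\<close> are represented by measurable functions; identification of
  functions that agree almost everywhere is made explicit where it matters.
\<close>

definition L2 :: "'a measure \<Rightarrow> ('a \<Rightarrow> real) set" where
  "L2 M = {u \<in> borel_measurable M. integrable M (\<lambda>x. (u x)\<^sup>2)}"

definition l2_inner :: "'a measure \<Rightarrow> ('a \<Rightarrow> real) \<Rightarrow> ('a \<Rightarrow> real) \<Rightarrow> real" where
  "l2_inner M u v = (\<integral>x. u x * v x \<partial>M)"

definition l2_norm :: "'a measure \<Rightarrow> ('a \<Rightarrow> real) \<Rightarrow> real" where
  "l2_norm M u = sqrt (l2_inner M u u)"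


section \<open>Symmetric forms and Dirichlet forms\<close>

text \<open>
  A form is given by its domain \<open>D\<close> and a function \<open>E\<close> whose values matter on \<open>D\<close> only.
\<close>

type_synonym 'a form = "('a \<Rightarrow> real) \<Rightarrow> ('a \<Rightarrow> real) \<Rightarrow> real"

text \<open>
  The last two clauses of the following definition say that the domain is dense in
  \<open>L\<^sub>2(X, M)\<close>, and that domain and form live on almost-everywhere classes.
\<close>

definition symmetric_form :: "'a measure \<Rightarrow> 'a form \<Rightarrow> ('a \<Rightarrow> real) set \<Rightarrow> bool" where
  "symmetric_form M E D \<longleftrightarrow>
     D \<subseteq> L2 M \<and>
     (\<lambda>_. 0) \<in> D \<and>
     (\<forall>u\<in>D. \<forall>v\<in>D. \<forall>a b. (\<lambda>x. a * u x + b * v x) \<in> D) \<and>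
     (\<forall>u\<in>D. \<forall>v\<in>D. \<forall>w\<in>D. \<forall>a b. E (\<lambda>x. a * u x + b * v x) w = a * E u w + b * E v w) \<and>
     (\<forall>u\<in>D. \<forall>v\<in>D. E u v = E v u) \<and>
     (\<forall>u\<in>D. 0 \<le> E u u) \<and>
     (\<forall>u\<in>L2 M. \<forall>\<epsilon>>0. \<exists>v\<in>D. l2_norm M (\<lambda>x. u x - v x) < \<epsilon>) \<and>
     (\<forall>u\<in>D. \<forall>v\<in>borel_measurable M. (AE x in M. u x = v x) \<longrightarrow>
        v \<in> D \<and> (\<forall>w\<in>D. E u w = E v w))"

definition form_cauchy :: "'a form \<Rightarrow> (nat \<Rightarrow> 'a \<Rightarrow> real) \<Rightarrow> bool" where
  "form_cauchy E f \<longleftrightarrow>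
     (\<forall>\<epsilon>>0. \<exists>N. \<forall>i\<ge>N. \<forall>j\<ge>N. E (\<lambda>x. f i x - f j x) (\<lambda>x. f i x - f j x) < \<epsilon>)"

text \<open>\<open>E\<^sub>1(u, v) = E(u, v) + \<langle>u, v\<rangle>\<close>\<close>

definition form1 :: "'a measure \<Rightarrow> 'a form \<Rightarrow> 'a form" where
  "form1 M E u v = E u v + l2_inner M u v"

definition closed_form :: "'a measure \<Rightarrow> 'a form \<Rightarrow> ('a \<Rightarrow> real) set \<Rightarrow> bool" where
  "closed_form M E D \<longleftrightarrow>
     (\<forall>f. (\<forall>n. f n \<in> D) \<and> form_cauchy (form1 M E) f \<longrightarrow>
        (\<exists>u\<in>D. (\<lambda>n. form1 M E (\<lambda>x. f n x - u x) (\<lambda>x. f n x - u x)) \<longlonglongrightarrow> 0))"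

definition unit_contraction_operates :: "'a form \<Rightarrow> ('a \<Rightarrow> real) set \<Rightarrow> bool" where
  "unit_contraction_operates E D \<longleftrightarrow>
     (\<forall>u\<in>D. (\<lambda>x. min (max (u x) 0) 1) \<in> D \<and>
        E (\<lambda>x. min (max (u x) 0) 1) (\<lambda>x. min (max (u x) 0) 1) \<le> E u u)"

definition symmetric_dirichlet_form :: "'a measure \<Rightarrow> 'a form \<Rightarrow> ('a \<Rightarrow> real) set \<Rightarrow> bool" where
  "symmetric_dirichlet_form M E D \<longleftrightarrow>
     symmetric_form M E D \<and> closed_form M E D \<and> unit_contraction_operates E D"

definition regular_form ::
    "'a::topological_space measure \<Rightarrow> 'a form \<Rightarrow> ('a \<Rightarrow> real) set \<Rightarrow> bool" where
  "regular_form M E D \<longleftrightarrow>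
     (\<forall>u\<in>D. \<forall>\<epsilon>>0. \<exists>v\<in>C0 \<inter> D. form1 M E (\<lambda>x. u x - v x) (\<lambda>x. u x - v x) < \<epsilon>) \<and>
     (\<forall>f\<in>C0. \<forall>\<epsilon>>0. \<exists>v\<in>C0 \<inter> D. \<forall>x. \<bar>f x - v x\<bar> < \<epsilon>)"

text \<open>The support of the class of \<open>u\<close>, i.e. of the measure with density \<open>\<bar>u\<bar>\<close> w.r.t. \<open>M\<close>.\<close>

definition ess_support :: "'a::topological_space measure \<Rightarrow> ('a \<Rightarrow> real) \<Rightarrow> 'a set" where
  "ess_support M u = {x. \<forall>U. open U \<and> x \<in> U \<longrightarrow> \<not> (AE y in M. y \<in> U \<longrightarrow> u y = 0)}"

text \<open>
  Locality is a genuine extra property here. Energy measures also exist in the presence of a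
  jump part: on a two-point space with counting measure, \<open>E(f,g) = (f(0) - f(1)) (g(0) - g(1))\<close>
  is an irreducible regular Dirichlet form whose energy measures are
  \<open>\<Gamma>(f) = (f(0) - f(1))\<^sup>2/2\<close> at either point, yet it is not local. Changing the reference
  measure does not alter the form on its core, so it can preserve locality but not create it.
\<close>

definition local_form ::
    "'a::topological_space measure \<Rightarrow> 'a form \<Rightarrow> ('a \<Rightarrow> real) set \<Rightarrow> bool" where
  "local_form M E D \<longleftrightarrow>
     (\<forall>u\<in>D. \<forall>v\<in>D. compact (ess_support M u) \<and> compact (ess_support M v) \<and>
        ess_support M u \<inter> ess_support M v = {} \<longrightarrow> E u v = 0)"


section \<open>Closability and closure\<close>

definition closable :: "'a measure \<Rightarrow> 'a form \<Rightarrow> ('a \<Rightarrow> real) set \<Rightarrow> bool" where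
  "closable M E D \<longleftrightarrow>
     D \<subseteq> L2 M \<and>
     (\<forall>f. (\<forall>n. f n \<in> D) \<and> form_cauchy E f \<and> (\<lambda>n. l2_norm M (f n)) \<longlonglongrightarrow> 0 \<longrightarrow>
        (\<lambda>n. E (f n) (f n)) \<longlonglongrightarrow> 0)"

definition approximates ::
    "'a measure \<Rightarrow> 'a form \<Rightarrow> ('a \<Rightarrow> real) set \<Rightarrow> (nat \<Rightarrow> 'a \<Rightarrow> real) \<Rightarrow> ('a \<Rightarrow> real) \<Rightarrow> bool" where
  "approximates M E D f u \<longleftrightarrow>
     (\<forall>n. f n \<in> D) \<and> form_cauchy E f \<and> (\<lambda>n. l2_norm M (\<lambda>x. f n x - u x)) \<longlonglongrightarrow> 0"

definition closure_domain :: "'a measure \<Rightarrow> 'a form \<Rightarrow> ('a \<Rightarrow> real) set \<Rightarrow> ('a \<Rightarrow> real) set" where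
  "closure_domain M E D = {u \<in> L2 M. \<exists>f. approximates M E D f u}"

text \<open>
  For \<open>u\<close>, \<open>v\<close> in the domain of the closure this is the limit of \<open>E(f\<^sub>n, g\<^sub>n)\<close> along approximating
  sequences; closability is what makes it independent of their choice.
\<close>

definition closure_form :: "'a measure \<Rightarrow> 'a form \<Rightarrow> ('a \<Rightarrow> real) set \<Rightarrow> 'a form" where
  "closure_form M E D u v =
     (THE l. \<forall>f g. approximates M E D f u \<and> approximates M E D g v \<longrightarrow>
        (\<lambda>n. E (f n) (g n)) \<longlonglongrightarrow> l)"


section \<open>Energy measures\<close>

text \<open>
  The diagonal case \<open>g = h\<close> of the defining identity
  \<open>2 \<integral> f d\<Gamma>(g,h) = E(fg,h) + E(fh,g) - E(gh,f)\<close>, \<open>f \<in> C0 \<inter> F\<close>. As \<open>\<Gamma>(g) = \<Gamma>(g,g)\<close> is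
  nonnegative, it is an ordinary measure and no signed measures are needed.
\<close>

definition energy_measure ::
    "'a::topological_space form \<Rightarrow> ('a \<Rightarrow> real) set \<Rightarrow> ('a \<Rightarrow> real) \<Rightarrow> 'a measure" where
  "energy_measure E F g =
     (THE \<nu>. radon_measure \<nu> \<and> finite_measure \<nu> \<and>
        (\<forall>f\<in>C0 \<inter> F. 2 * (\<integral>x. f x \<partial>\<nu>) =
           E (\<lambda>x. f x * g x) g + E (\<lambda>x. f x * g x) g - E (\<lambda>x. g x * g x) f))"


section \<open>Transience and irreducibility\<close>

definition transient_form :: "'a measure \<Rightarrow> 'a form \<Rightarrow> ('a \<Rightarrow> real) set \<Rightarrow> bool" where
  "transient_form M E F \<longleftrightarrow>
     (\<exists>\<gamma>. integrable M \<gamma> \<and> (\<exists>B. \<forall>x. \<bar>\<gamma> x\<bar> \<le> B) \<and> (AE x in M. 0 < \<gamma> x) \<and>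
        (\<forall>u\<in>F. (\<integral>x. \<bar>u x\<bar> * \<gamma> x \<partial>M) \<le> sqrt (E u u)))"

text \<open>
  The semigroup associated with \<open>(E, F)\<close> is the strongly continuous semigroup of symmetric
  contractions on \<open>L\<^sub>2(X, M)\<close> whose generator \<open>L\<close> satisfies \<open>dom L \<subseteq> F\<close> and
  \<open>E(u,v) = - \<langle>L u, v\<rangle>\<close> for \<open>u \<in> dom L\<close>, \<open>v \<in> F\<close>. Since \<open>L\<close> is self-adjoint it is then the
  operator of the closed form, so \<open>T\<close> is unique up to modification on null sets (the Markov
  property is a consequence). In the last clause \<open>w\<close> is \<open>L u\<close>.
\<close>

definition associated_semigroup ::
    "'a measure \<Rightarrow> 'a form \<Rightarrow> ('a \<Rightarrow> real) set \<Rightarrow> (real \<Rightarrow> ('a \<Rightarrow> real) \<Rightarrow> 'a \<Rightarrow> real) \<Rightarrow> bool" where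
  "associated_semigroup M E F T \<longleftrightarrow>
     (\<forall>t>0. \<forall>u\<in>L2 M. T t u \<in> L2 M \<and> l2_norm M (T t u) \<le> l2_norm M u) \<and>
     (\<forall>t>0. \<forall>u\<in>L2 M. \<forall>v\<in>L2 M. \<forall>a b.
        AE x in M. T t (\<lambda>y. a * u y + b * v y) x = a * T t u x + b * T t v x) \<and>
     (\<forall>t>0. \<forall>u\<in>L2 M. \<forall>v\<in>L2 M. l2_inner M (T t u) v = l2_inner M u (T t v)) \<and>
     (\<forall>s>0. \<forall>t>0. \<forall>u\<in>L2 M. AE x in M. T (s + t) u x = T s (T t u) x) \<and>
     (\<forall>u\<in>L2 M. ((\<lambda>t. l2_norm M (\<lambda>x. T t u x - u x)) \<longlongrightarrow> 0) (at_right 0)) \<and>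
     (\<forall>u\<in>L2 M. \<forall>w\<in>L2 M.
        ((\<lambda>t. l2_norm M (\<lambda>x. (T t u x - u x) / t - w x)) \<longlongrightarrow> 0) (at_right 0) \<longrightarrow>
        u \<in> F \<and> (\<forall>v\<in>F. E u v = - l2_inner M w v))"

definition invariant_set :: "'a measure \<Rightarrow> 'a form \<Rightarrow> ('a \<Rightarrow> real) set \<Rightarrow> 'a set \<Rightarrow> bool" where
  "invariant_set M E F A \<longleftrightarrow>
     A \<in> sets M \<and>
     (\<forall>T. associated_semigroup M E F T \<longrightarrow>
        (\<forall>t>0. \<forall>u\<in>L2 M. AE x in M. T t (\<lambda>y. indicator A y * u y) x = indicator A x * T t u x))"

definition irreducible_form :: "'a measure \<Rightarrow> 'a form \<Rightarrow> ('a \<Rightarrow> real) set \<Rightarrow> bool" where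
  "irreducible_form M E F \<longleftrightarrow>
     (\<forall>A. invariant_set M E F A \<longrightarrow> emeasure M A = 0 \<or> emeasure M (space M - A) = 0)"

end

(*
  Write I(p, g) = \<integral> p d\<Gamma>(g) = E(p g, g) - E(g^2, p)/2. The forms E_b(u, v) = b <u - b G_b u, v> built
  from the resolvent behave like pure jump forms with killing, so every inequality between quadratic
  expressions in increments passes to E on the core C. This gives the algebra and contraction
  properties of C, the positivity of I(., g), hence by a Riesz argument the existence and
  uniqueness of \<Gamma>(g), and, for f in C and p = min 1 (|f|/e), the bound
  E(f - clip_e f) <= 2 I(p, f).

  Let f_n in C be E-Cauchy and tend to 0 in L2(m), so m-a.e. after passing to a subsequence. As
  \<Gamma>(f_k) << m, dominated convergence and the Cauchy property give I(min 1 (|f_n|/e), f_n) -> 0,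
  hence E(f_n - clip_e f_n) -> 0 for every e. Finally E(clip_e f_n, f_n) is close to
  E(clip_e f_n, f_N) and this to E(clip_e f_n, b G_b f_N) = E_b(f_N, clip_e f_n), which is at most
  2 b e |f_N|_1. Choosing N, then b, then e shows E(f_n) -> 0.

  The closure inherits contractions and locality through bounded energy approximation: a sequence of
  bounded energy that converges in L2(m) has its limit in the domain and converges weakly.
*)
theory Submission
  imports Defs
begin

section \<open>Nonnegative symmetric bilinear forms on spaces of functions\<close>

text \<open>The measures \<open>\<mu>\<close> and \<open>m\<close> may be mutually singular, so
  \<open>m\<close>-a.e. convergence of f_n gives no control in L2 of \<open>\<mu>\<close>, and
  closedness over \<open>\<mu>\<close> cannot be applied to f_n. The sup norm is the bridge, since
  it refers to neither measure: clip_e f_n is uniformly at most e, and for fixed b the functional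
  E_b(f_N, .) is continuous for uniform convergence, because f_N has compact support and b G_b
  contracts the sup norm. The constant of that continuity grows with b, hence the order N, b, e, n
  of the choices.

  The jump-form principle has two pointwise hypotheses, one on increments and one on values (the
  killing part). Its approximate version asks only that the functions lie in C0, because E_b is
  defined on all of L2; this is what allows contractions and products to be proved members of the
  domain.

  Functions, not classes, carry the argument: a core function is continuous and means the same for
  both measures, while resolvents are determined only up to null sets of
  \<open>\<mu>\<close>.\<close>

locale nonneg_form =
  fixes D :: "('a \<Rightarrow> real) set" and B :: "'a form"
  assumes zero_mem: "(\<lambda>_. 0) \<in> D"
    and lin_mem: "u \<in> D \<Longrightarrow> v \<in> D \<Longrightarrow> (\<lambda>x. a * u x + b * v x) \<in> D"
    and lin_left: "u \<in> D \<Longrightarrow> v \<in> D \<Longrightarrow> w \<in> D \<Longrightarrow> B (\<lambda>x. a * u x + b * v x) w = a * B u w + b * B v w"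
    and sym: "u \<in> D \<Longrightarrow> v \<in> D \<Longrightarrow> B u v = B v u"
    and nonneg: "u \<in> D \<Longrightarrow> 0 \<le> B u u"
begin

lemma add_mem: "u \<in> D \<Longrightarrow> v \<in> D \<Longrightarrow> (\<lambda>x. u x + v x) \<in> D"
  using lin_mem[of u v 1 1] by simp

lemma diff_mem: "u \<in> D \<Longrightarrow> v \<in> D \<Longrightarrow> (\<lambda>x. u x - v x) \<in> D"
  using lin_mem[of u v 1 "-1"] by simp

lemma scale_mem: "u \<in> D \<Longrightarrow> (\<lambda>x. a * u x) \<in> D"
  using lin_mem[of u u a 0] by simp

lemma minus_mem: "u \<in> D \<Longrightarrow> (\<lambda>x. - u x) \<in> D"
  using scale_mem[of u "-1"] by simp

lemma sum_mem: "(\<And>i. i \<in> I \<Longrightarrow> u i \<in> D) \<Longrightarrow> (\<lambda>x. \<Sum>i\<in>I. u i x) \<in> D"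
  by (induction I rule: infinite_finite_induct) (auto simp: zero_mem add_mem)

lemmas mem = zero_mem lin_mem add_mem diff_mem scale_mem minus_mem

lemma add_left: "u \<in> D \<Longrightarrow> v \<in> D \<Longrightarrow> w \<in> D \<Longrightarrow> B (\<lambda>x. u x + v x) w = B u w + B v w"
  using lin_left[of u v w 1 1] by simp

lemma diff_left: "u \<in> D \<Longrightarrow> v \<in> D \<Longrightarrow> w \<in> D \<Longrightarrow> B (\<lambda>x. u x - v x) w = B u w - B v w"
  using lin_left[of u v w 1 "-1"] by simp

lemma scale_left: "u \<in> D \<Longrightarrow> w \<in> D \<Longrightarrow> B (\<lambda>x. a * u x) w = a * B u w"
  using lin_left[of u u w a 0] by simp

lemma minus_left: "u \<in> D \<Longrightarrow> w \<in> D \<Longrightarrow> B (\<lambda>x. - u x) w = - B u w"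
  using lin_left[of u u w "-1" 0] by simp

lemma zero_left: "w \<in> D \<Longrightarrow> B (\<lambda>x. 0) w = 0"
  using scale_left[OF zero_mem, of w 0] by simp

lemma lin_right: "u \<in> D \<Longrightarrow> v \<in> D \<Longrightarrow> w \<in> D \<Longrightarrow> B w (\<lambda>x. a * u x + b * v x) = a * B w u + b * B w v"
  using lin_left[of u v w a b] sym lin_mem by metis

lemma add_right: "u \<in> D \<Longrightarrow> v \<in> D \<Longrightarrow> w \<in> D \<Longrightarrow> B w (\<lambda>x. u x + v x) = B w u + B w v"
  using lin_right[of u v w 1 1] by simp

lemma diff_right: "u \<in> D \<Longrightarrow> v \<in> D \<Longrightarrow> w \<in> D \<Longrightarrow> B w (\<lambda>x. u x - v x) = B w u - B w v"
  using lin_right[of u v w 1 "-1"] by simp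

lemma scale_right: "u \<in> D \<Longrightarrow> w \<in> D \<Longrightarrow> B w (\<lambda>x. a * u x) = a * B w u"
  using lin_right[of u u w a 0] by simp

lemma minus_right: "u \<in> D \<Longrightarrow> w \<in> D \<Longrightarrow> B w (\<lambda>x. - u x) = - B w u"
  using lin_right[of u u w "-1" 0] by simp

lemma zero_right: "w \<in> D \<Longrightarrow> B w (\<lambda>x. 0) = 0"
  using scale_right[OF zero_mem, of w 0] by simp

lemmas expand = add_left diff_left scale_left minus_left zero_left
  add_right diff_right scale_right minus_right zero_right

text \<open>Discriminant of the nonnegative quadratic t |-> B(u + t v, u + t v). The form may be
  degenerate, so B v v = 0 is a separate case, in which the quadratic is affine and nonnegativity
  forces its slope to vanish.\<close>

lemma Cauchy_Schwarz_squared: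
  assumes u: "u \<in> D" and v: "v \<in> D"
  shows "(B u v)\<^sup>2 \<le> B u u * B v v"
proof -
  have q: "0 \<le> B u u + 2 * t * B u v + t\<^sup>2 * B v v" for t
  proof -
    have "0 \<le> B (\<lambda>x. u x + t * v x) (\<lambda>x. u x + t * v x)"
      by (intro nonneg mem u v)
    also have "\<dots> = B u u + 2 * t * B u v + t\<^sup>2 * B v v"
      using sym[OF u v] by (simp add: expand mem u v power2_eq_square algebra_simps)
    finally show ?thesis .
  qed
  show ?thesis
  proof (cases "B v v = 0")
    case True
    have "B u v = 0"
    proof (rule ccontr)
      assume "B u v \<noteq> 0"
      \<comment> \<open>This t makes the affine function take the value -1.\<close>
      then have "2 * (- (B u u + 1) / (2 * B u v)) * B u v = - (B u u + 1)"
        by (simp add: field_simps)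
      then show False
        using q[of "- (B u u + 1) / (2 * B u v)"] True by simp
    qed
    then show ?thesis using True by simp
  next
    case False
    then have pos: "B v v > 0" using nonneg[OF v] by simp
    have "0 \<le> B u u + 2 * (- B u v / B v v) * B u v + (- B u v / B v v)\<^sup>2 * B v v"
      by (rule q)
    also have "\<dots> = B u u - (B u v)\<^sup>2 / B v v"
      using pos by (simp add: field_simps power2_eq_square)
    finally show ?thesis using pos by (simp add: field_simps)
  qed
qed

lemma Cauchy_Schwarz:
  assumes u: "u \<in> D" and v: "v \<in> D"
  shows "\<bar>B u v\<bar> \<le> sqrt (B u u) * sqrt (B v v)"
  using real_sqrt_le_mono[OF Cauchy_Schwarz_squared[OF u v]] by (simp add: real_sqrt_mult)

lemma parallelogram:
  assumes u: "u \<in> D" and v: "v \<in> D"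
  shows "B (\<lambda>x. u x + v x) (\<lambda>x. u x + v x) + B (\<lambda>x. u x - v x) (\<lambda>x. u x - v x) = 2 * B u u + 2 * B v v"
  by (simp add: expand mem u v)

text \<open>The parallelogram law solved for the midpoint. If u and v nearly minimise B over a
  convex set, the left side is at least four times the infimum, so B(u - v, u - v) must be small;
  both minimisation arguments below rest on this.\<close>

lemma midpoint:
  assumes u: "u \<in> D" and v: "v \<in> D"
  shows "4 * B (\<lambda>x. (1/2) * u x + (1/2) * v x) (\<lambda>x. (1/2) * u x + (1/2) * v x)
    = 2 * B u u + 2 * B v v - B (\<lambda>x. u x - v x) (\<lambda>x. u x - v x)"
  using sym[OF u v]
  by (simp only: lin_left lin_right lin_mem u v) (simp add: expand mem u v field_simps)

lemma add_le:
  assumes u: "u \<in> D" and v: "v \<in> D"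
  shows "B (\<lambda>x. u x + v x) (\<lambda>x. u x + v x) \<le> 2 * B u u + 2 * B v v"
  using parallelogram[OF u v] nonneg[OF diff_mem[OF u v]] by linarith

lemma diff_commute:
  assumes u: "u \<in> D" and v: "v \<in> D"
  shows "B (\<lambda>x. u x - v x) (\<lambda>x. u x - v x) = B (\<lambda>x. v x - u x) (\<lambda>x. v x - u x)"
  using sym[OF u v] by (simp add: expand mem u v)

lemma diff_triangle_le:
  assumes u: "u \<in> D" and v: "v \<in> D" and w: "w \<in> D"
  shows "B (\<lambda>x. u x - w x) (\<lambda>x. u x - w x) \<le>
    2 * B (\<lambda>x. u x - v x) (\<lambda>x. u x - v x) + 2 * B (\<lambda>x. v x - w x) (\<lambda>x. v x - w x)"
  using add_le[OF diff_mem[OF u v] diff_mem[OF v w]] by simp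

lemma norm_triangle:
  assumes u: "u \<in> D" and v: "v \<in> D"
  shows "sqrt (B (\<lambda>x. u x + v x) (\<lambda>x. u x + v x)) \<le> sqrt (B u u) + sqrt (B v v)"
proof (rule real_le_lsqrt)
  have "B (\<lambda>x. u x + v x) (\<lambda>x. u x + v x) = B u u + 2 * B u v + B v v"
    using sym[OF u v] by (simp add: expand mem u v)
  also have "\<dots> \<le> (sqrt (B u u) + sqrt (B v v))\<^sup>2"
    using Cauchy_Schwarz[OF u v] nonneg[OF u] nonneg[OF v] by (simp add: power2_sum)
  finally show "B (\<lambda>x. u x + v x) (\<lambda>x. u x + v x) \<le> (sqrt (B u u) + sqrt (B v v))\<^sup>2" .
qed (use nonneg u v in auto)

lemma form_cauchyI_limit:
  assumes f: "\<And>n. f n \<in> D" and u: "u \<in> D"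
    and lim: "(\<lambda>n. B (\<lambda>x. f n x - u x) (\<lambda>x. f n x - u x)) \<longlonglongrightarrow> 0"
  shows "form_cauchy B f"
  unfolding form_cauchy_def
proof (intro allI impI)
  fix e :: real assume "e > 0"
  then obtain N where N: "\<And>n. n \<ge> N \<Longrightarrow> B (\<lambda>x. f n x - u x) (\<lambda>x. f n x - u x) < e / 4"
    using order_tendstoD(2)[OF lim, of "e / 4"] by (auto simp: eventually_sequentially)
  show "\<exists>N. \<forall>i\<ge>N. \<forall>j\<ge>N. B (\<lambda>x. f i x - f j x) (\<lambda>x. f i x - f j x) < e"
  proof (intro exI allI impI)
    fix i j assume "i \<ge> N" "j \<ge> N"
    then show "B (\<lambda>x. f i x - f j x) (\<lambda>x. f i x - f j x) < e"
      using diff_triangle_le[OF f u f, of i j] N[of i] N[of j] diff_commute[OF f u, of j] by simp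
  qed
qed

lemma tendsto_form:
  assumes f: "\<And>n. f n \<in> D" and g: "\<And>n. g n \<in> D" and u: "u \<in> D" and v: "v \<in> D"
    and fu: "(\<lambda>n. B (\<lambda>x. f n x - u x) (\<lambda>x. f n x - u x)) \<longlonglongrightarrow> 0"
    and gv: "(\<lambda>n. B (\<lambda>x. g n x - v x) (\<lambda>x. g n x - v x)) \<longlonglongrightarrow> 0"
  shows "(\<lambda>n. B (f n) (g n)) \<longlonglongrightarrow> B u v"
proof -
  let ?a = "\<lambda>n. sqrt (B (\<lambda>x. f n x - u x) (\<lambda>x. f n x - u x))"
  let ?b = "\<lambda>n. sqrt (B (\<lambda>x. g n x - v x) (\<lambda>x. g n x - v x))"
  have a: "?a \<longlonglongrightarrow> 0" and b: "?b \<longlonglongrightarrow> 0"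
    using tendsto_real_sqrt[OF fu] tendsto_real_sqrt[OF gv] by simp_all
  have "(\<lambda>n. B (f n) (g n) - B u v) \<longlonglongrightarrow> 0"
  proof (rule tendsto_rabs_zero_cancel, rule tendsto_sandwich[of "\<lambda>_. 0"])
    show "(\<lambda>n. ?a n * ?b n + ?a n * sqrt (B v v) + sqrt (B u u) * ?b n) \<longlonglongrightarrow> 0"
      using tendsto_add[OF tendsto_add[OF tendsto_mult[OF a b] tendsto_mult[OF a tendsto_const]]
          tendsto_mult[OF tendsto_const b]] by simp
    show "\<forall>\<^sub>F n in sequentially. \<bar>B (f n) (g n) - B u v\<bar> \<le> ?a n * ?b n + ?a n * sqrt (B v v) + sqrt (B u u) * ?b n"
    proof (intro always_eventually allI)
      fix n
      have "B (f n) (g n) - B u v = B (\<lambda>x. f n x - u x) (\<lambda>x. g n x - v x)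
          + B (\<lambda>x. f n x - u x) v + B u (\<lambda>x. g n x - v x)"
        by (simp add: expand mem f g u v)
      moreover have "\<bar>B (\<lambda>x. f n x - u x) (\<lambda>x. g n x - v x)\<bar> \<le> ?a n * ?b n"
        by (intro Cauchy_Schwarz mem f g u v)
      moreover have "\<bar>B (\<lambda>x. f n x - u x) v\<bar> \<le> ?a n * sqrt (B v v)"
        by (intro Cauchy_Schwarz mem f g u v)
      moreover have "\<bar>B u (\<lambda>x. g n x - v x)\<bar> \<le> sqrt (B u u) * ?b n"
        by (intro Cauchy_Schwarz mem f g u v)
      ultimately show "\<bar>B (f n) (g n) - B u v\<bar> \<le> ?a n * ?b n + ?a n * sqrt (B v v) + sqrt (B u u) * ?b n"
        by linarith
    qed
  qed (auto)
  then show ?thesis by (simp add: LIM_zero_iff)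
qed

lemma form_cauchy_bounded:
  assumes f: "\<And>n. f n \<in> D" and c: "form_cauchy B f"
  obtains K where "\<And>n. B (f n) (f n) \<le> K"
proof -
  obtain N where N: "\<And>i j. i \<ge> N \<Longrightarrow> j \<ge> N \<Longrightarrow> B (\<lambda>x. f i x - f j x) (\<lambda>x. f i x - f j x) < 1"
    using c unfolding form_cauchy_def by (meson zero_less_one)
  \<comment> \<open>The sum takes care of the indices up to N; the other terms come from
    \<open>add_le\<close> applied to f n - f N and f N.\<close>
  define K where "K = (\<Sum>i\<le>N. B (f i) (f i)) + 2 * B (f N) (f N) + 2"
  have S: "0 \<le> (\<Sum>i\<le>N. B (f i) (f i))" by (intro sum_nonneg nonneg f)
  show ?thesis
  proof
    fix n show "B (f n) (f n) \<le> K"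
    proof (cases "n \<le> N")
      case True
      then have "B (f n) (f n) \<le> (\<Sum>i\<le>N. B (f i) (f i))"
        using nonneg f by (intro member_le_sum) auto
      then show ?thesis using nonneg[OF f, of N] by (simp add: K_def)
    next
      case False
      then have "B (\<lambda>x. f n x - f N x) (\<lambda>x. f n x - f N x) < 1" using N by simp
      then show ?thesis
        using add_le[OF diff_mem[OF f f] f, of n N N] S by (simp add: K_def)
    qed
  qed
qed

end

section \<open>The space of square integrable functions\<close>

lemma L2_mult_integrable:
  assumes "u \<in> L2 M" "v \<in> L2 M"
  shows "integrable M (\<lambda>x. u x * v x)"
proof (rule Bochner_Integration.integrable_bound)
  show "integrable M (\<lambda>x. (u x)\<^sup>2 + (v x)\<^sup>2)"
    using assms by (auto simp: L2_def)
  show "(\<lambda>x. u x * v x) \<in> borel_measurable M"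
    using assms by (auto simp: L2_def)
  show "AE x in M. norm (u x * v x) \<le> norm ((u x)\<^sup>2 + (v x)\<^sup>2)"
  proof (rule AE_I2)
    fix x
    have "2 * (\<bar>u x\<bar> * \<bar>v x\<bar>) \<le> (u x)\<^sup>2 + (v x)\<^sup>2"
      using sum_squares_bound[of "\<bar>u x\<bar>" "\<bar>v x\<bar>"] by simp
    moreover have "0 \<le> \<bar>u x\<bar> * \<bar>v x\<bar>" by simp
    ultimately show "norm (u x * v x) \<le> norm ((u x)\<^sup>2 + (v x)\<^sup>2)"
      unfolding real_norm_def abs_mult by linarith
  qed
qed

lemma L2_measurable: "u \<in> L2 M \<Longrightarrow> u \<in> borel_measurable M"
  by (simp add: L2_def)

lemma L2_lin:
  assumes "u \<in> L2 M" "v \<in> L2 M"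
  shows "(\<lambda>x. a * u x + b * v x) \<in> L2 M"
proof -
  have "integrable M (\<lambda>x. a\<^sup>2 * (u x * u x) + 2 * a * b * (u x * v x) + b\<^sup>2 * (v x * v x))"
    by (intro Bochner_Integration.integrable_add integrable_mult_right L2_mult_integrable assms)
  then have "integrable M (\<lambda>x. (a * u x + b * v x)\<^sup>2)"
    by (simp add: power2_eq_square algebra_simps)
  then show ?thesis using assms by (auto simp: L2_def)
qed

text \<open>The inner product satisfies the axioms of an energy form, so Cauchy-Schwarz, the
  triangle inequality and the midpoint identity need no second proof.\<close>

interpretation L2: nonneg_form "L2 M" "l2_inner M" for M :: "'a measure"
proof
  fix u v w :: "'a \<Rightarrow> real" and a b :: real
  assume u: "u \<in> L2 M" and v: "v \<in> L2 M"
  show "l2_inner M u v = l2_inner M v u" by (simp add: l2_inner_def mult.commute)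
  assume w: "w \<in> L2 M"
  have "integrable M (\<lambda>x. a * (u x * w x))" "integrable M (\<lambda>x. b * (v x * w x))"
    by (intro integrable_mult_right L2_mult_integrable u v w)+
  then show "l2_inner M (\<lambda>x. a * u x + b * v x) w = a * l2_inner M u w + b * l2_inner M v w"
    by (simp add: l2_inner_def algebra_simps)
qed (simp_all add: L2_lin, simp_all add: l2_inner_def L2_def)

lemma l2_norm_nonneg: "0 \<le> l2_norm M u"
  by (simp add: l2_norm_def l2_inner_def)

lemma l2_norm_squared: "(l2_norm M u)\<^sup>2 = l2_inner M u u"
  by (simp add: l2_norm_def l2_inner_def)

lemma l2_inner_self_nonneg: "0 \<le> l2_inner M u u"
  by (simp add: l2_inner_def)

lemma l2_norm_triangle:
  "u \<in> L2 M \<Longrightarrow> v \<in> L2 M \<Longrightarrow> l2_norm M (\<lambda>x. u x + v x) \<le> l2_norm M u + l2_norm M v"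
  unfolding l2_norm_def by (rule L2.norm_triangle)

lemma l2_norm_diff_triangle:
  assumes "u \<in> L2 M" "v \<in> L2 M" "w \<in> L2 M"
  shows "l2_norm M (\<lambda>x. u x - w x) \<le> l2_norm M (\<lambda>x. u x - v x) + l2_norm M (\<lambda>x. v x - w x)"
  using l2_norm_triangle[OF L2.diff_mem L2.diff_mem, OF assms(1,2) assms(2,3)] by simp

lemma l2_norm_diff_commute: "l2_norm M (\<lambda>x. u x - v x) = l2_norm M (\<lambda>x. v x - u x)"
proof -
  have "(u x - v x) * (u x - v x) = (v x - u x) * (v x - u x)" for x by algebra
  then show ?thesis by (simp add: l2_norm_def l2_inner_def)
qed

lemma l2_norm_scale: "u \<in> L2 M \<Longrightarrow> l2_norm M (\<lambda>x. a * u x) = \<bar>a\<bar> * l2_norm M u"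
  by (simp add: l2_norm_def L2.expand L2.mem real_sqrt_mult)

lemma l2_norm_mono:
  assumes "v \<in> L2 M" "u \<in> borel_measurable M" "AE x in M. \<bar>u x\<bar> \<le> \<bar>v x\<bar>"
  shows "u \<in> L2 M" and "l2_norm M u \<le> l2_norm M v"
proof -
  have sq: "AE x in M. (u x)\<^sup>2 \<le> (v x)\<^sup>2"
    using assms(3) by (auto simp: abs_le_square_iff)
  have i: "integrable M (\<lambda>x. (u x)\<^sup>2)"
    by (rule Bochner_Integration.integrable_bound[of M "\<lambda>x. (v x)\<^sup>2"])
      (use assms sq in \<open>auto simp: L2_def\<close>)
  show u: "u \<in> L2 M" using i assms by (simp add: L2_def)
  have "(\<integral>x. (u x)\<^sup>2 \<partial>M) \<le> (\<integral>x. (v x)\<^sup>2 \<partial>M)"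
    using sq i assms(1) by (intro integral_mono_AE) (auto simp: L2_def)
  then show "l2_norm M u \<le> l2_norm M v"
    by (simp add: l2_norm_def l2_inner_def power2_eq_square)
qed

lemma l2_inner_cong_AE:
  assumes "AE x in M. u x = u' x" "AE x in M. v x = v' x"
    "u \<in> borel_measurable M" "u' \<in> borel_measurable M" "v \<in> borel_measurable M" "v' \<in> borel_measurable M"
  shows "l2_inner M u v = l2_inner M u' v'"
  unfolding l2_inner_def using assms by (intro integral_cong_AE) auto

lemma L2_cong_AE:
  assumes "u \<in> L2 M" "v \<in> borel_measurable M" "AE x in M. u x = v x"
  shows "v \<in> L2 M"
  by (rule l2_norm_mono(1)[OF assms(1,2)]) (use assms(3) in auto)

lemma l2_norm_eq_0_AE:
  assumes "u \<in> L2 M" "l2_norm M u = 0"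
  shows "AE x in M. u x = 0"
proof -
  have "(\<integral>x. (u x)\<^sup>2 \<partial>M) = 0"
    using assms(2) by (simp add: l2_norm_def l2_inner_def power2_eq_square)
  then have "AE x in M. (u x)\<^sup>2 = 0"
    using assms(1) by (subst (asm) integral_nonneg_eq_0_iff_AE) (auto simp: L2_def)
  then show ?thesis by simp
qed

lemma l2_norm_tendsto_unique:
  assumes "u \<in> L2 M" "v \<in> L2 M" "\<And>n. f n \<in> L2 M"
    and "(\<lambda>n. l2_norm M (\<lambda>x. f n x - u x)) \<longlonglongrightarrow> 0" "(\<lambda>n. l2_norm M (\<lambda>x. f n x - v x)) \<longlonglongrightarrow> 0"
  shows "AE x in M. u x = v x"
proof -
  have "(\<lambda>n. l2_norm M (\<lambda>x. u x - v x)) \<longlonglongrightarrow> 0"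
  proof (rule tendsto_sandwich[of "\<lambda>_. 0"])
    show "(\<lambda>n. l2_norm M (\<lambda>x. f n x - u x) + l2_norm M (\<lambda>x. f n x - v x)) \<longlonglongrightarrow> 0"
      using tendsto_add[OF assms(4,5)] by simp
    show "\<forall>\<^sub>F n in sequentially. l2_norm M (\<lambda>x. u x - v x)
        \<le> l2_norm M (\<lambda>x. f n x - u x) + l2_norm M (\<lambda>x. f n x - v x)"
      using l2_norm_diff_triangle[OF assms(1,3,2)] l2_norm_diff_commute[of M u]
      by (intro always_eventually allI) simp
  qed (auto simp: l2_norm_nonneg)
  then have "l2_norm M (\<lambda>x. u x - v x) = 0"
    by (simp add: LIMSEQ_const_iff)
  then have "AE x in M. u x - v x = 0"
    by (intro l2_norm_eq_0_AE L2.diff_mem assms)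
  then show ?thesis by simp
qed

lemma l2_norm_tendsto_0_iff:
  "(\<lambda>n. l2_norm M (f n)) \<longlonglongrightarrow> 0 \<longleftrightarrow> (\<lambda>n. l2_inner M (f n) (f n)) \<longlonglongrightarrow> 0"
proof
  assume "(\<lambda>n. l2_norm M (f n)) \<longlonglongrightarrow> 0"
  from tendsto_power[OF this, of 2] show "(\<lambda>n. l2_inner M (f n) (f n)) \<longlonglongrightarrow> 0"
    by (simp add: l2_norm_squared)
next
  assume "(\<lambda>n. l2_inner M (f n) (f n)) \<longlonglongrightarrow> 0"
  from tendsto_real_sqrt[OF this] show "(\<lambda>n. l2_norm M (f n)) \<longlonglongrightarrow> 0"
    by (simp add: l2_norm_def)
qed

text \<open>The sum of the squares has finite integral, so it is finite almost everywhere, and the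
  terms of a convergent series tend to 0. This turns fast L2 convergence into pointwise
  convergence.\<close>

lemma l2_summable_AE:
  assumes f: "\<And>n. f n \<in> L2 M" and s: "summable (\<lambda>n. l2_inner M (f n) (f n))"
  shows "AE x in M. (\<lambda>n. f n x) \<longlonglongrightarrow> 0"
proof -
  have m[measurable]: "\<And>n. f n \<in> borel_measurable M" using f by (simp add: L2_def)
  have nn: "(\<integral>\<^sup>+x. ennreal ((f n x)\<^sup>2) \<partial>M) = ennreal (l2_inner M (f n) (f n))" for n
    using f[of n] by (subst nn_integral_eq_integral) (auto simp: L2_def l2_inner_def power2_eq_square)
  have "(\<integral>\<^sup>+x. (\<Sum>n. ennreal ((f n x)\<^sup>2)) \<partial>M) = (\<Sum>n. ennreal (l2_inner M (f n) (f n)))"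
    by (subst nn_integral_suminf) (auto simp: nn)
  also have "\<dots> < \<infinity>"
    using s by (simp add: suminf_ennreal_eq l2_inner_self_nonneg less_top ennreal_suminf_neq_top)
  finally have "AE x in M. (\<Sum>n. ennreal ((f n x)\<^sup>2)) \<noteq> \<infinity>"
    by (intro nn_integral_PInf_AE) auto
  then show ?thesis
  proof (rule AE_mp, intro AE_I2 impI)
    fix x assume "(\<Sum>n. ennreal ((f n x)\<^sup>2)) \<noteq> \<infinity>"
    then have "summable (\<lambda>n. (f n x)\<^sup>2)"
      by (intro summable_suminf_not_top) (auto simp: top_unique)
    from summable_LIMSEQ_zero[OF this] have "(\<lambda>n. \<bar>f n x\<bar>) \<longlonglongrightarrow> 0"
      using tendsto_real_sqrt by fastforce
    then show "(\<lambda>n. f n x) \<longlonglongrightarrow> 0" by (rule tendsto_rabs_zero_cancel)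
  qed
qed

section \<open>Closed symmetric forms\<close>

locale closed_symmetric_form =
  fixes M :: "'a measure" and E :: "'a form" and D :: "('a \<Rightarrow> real) set"
  assumes symmetric: "symmetric_form M E D" and closed: "closed_form M E D"
begin

sublocale nonneg_form D E
  using symmetric unfolding symmetric_form_def by unfold_locales blast+

lemma mem_L2: "u \<in> D \<Longrightarrow> u \<in> L2 M"
  using symmetric by (auto simp: symmetric_form_def)

lemma mem_cong_AE: "u \<in> D \<Longrightarrow> v \<in> borel_measurable M \<Longrightarrow> AE x in M. u x = v x \<Longrightarrow> v \<in> D"
  using symmetric unfolding symmetric_form_def by blast

lemma form_cong_AE:
  "u \<in> D \<Longrightarrow> v \<in> borel_measurable M \<Longrightarrow> AE x in M. u x = v x \<Longrightarrow> w \<in> D \<Longrightarrow> E u w = E v w"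
  using symmetric unfolding symmetric_form_def by blast

text \<open>\<open>closed_form\<close> yields only some limit w in the \<open>form1\<close> norm.
  Uniqueness of L2 limits identifies w with u almost everywhere, and the last clause of
  \<open>symmetric_form\<close> transfers membership and energies to the representative u.\<close>

lemma closedD:
  assumes f: "\<And>n. f n \<in> D" and c: "form_cauchy E f" and u: "u \<in> L2 M"
    and lim: "(\<lambda>n. l2_norm M (\<lambda>x. f n x - u x)) \<longlonglongrightarrow> 0"
  shows "u \<in> D" and "(\<lambda>n. E (\<lambda>x. f n x - u x) (\<lambda>x. f n x - u x)) \<longlonglongrightarrow> 0"
proof -
  have fL: "f n \<in> L2 M" for n using f mem_L2 by blast
  have "form_cauchy (l2_inner M) f"
    using lim by (intro L2.form_cauchyI_limit[OF fL u]) (simp add: l2_norm_tendsto_0_iff)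
  have "form_cauchy (form1 M E) f"
    unfolding form_cauchy_def
  proof (intro allI impI)
    fix e :: real assume "e > 0"
    then obtain N1 N2 where
      "\<And>i j. i \<ge> N1 \<Longrightarrow> j \<ge> N1 \<Longrightarrow> E (\<lambda>x. f i x - f j x) (\<lambda>x. f i x - f j x) < e / 2"
      "\<And>i j. i \<ge> N2 \<Longrightarrow> j \<ge> N2 \<Longrightarrow> l2_inner M (\<lambda>x. f i x - f j x) (\<lambda>x. f i x - f j x) < e / 2"
      using c \<open>form_cauchy (l2_inner M) f\<close> unfolding form_cauchy_def by (meson half_gt_zero)
    then show "\<exists>N. \<forall>i\<ge>N. \<forall>j\<ge>N. form1 M E (\<lambda>x. f i x - f j x) (\<lambda>x. f i x - f j x) < e"
      unfolding form1_def by (intro exI[of _ "max N1 N2"]) (smt (verit) field_sum_of_halves max.bounded_iff)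
  qed
  then obtain w where w: "w \<in> D" and wl: "(\<lambda>n. form1 M E (\<lambda>x. f n x - w x) (\<lambda>x. f n x - w x)) \<longlonglongrightarrow> 0"
    using closed f unfolding closed_form_def by blast
  have "(\<lambda>n. l2_inner M (\<lambda>x. f n x - w x) (\<lambda>x. f n x - w x)) \<longlonglongrightarrow> 0"
    by (rule tendsto_sandwich[OF _ _ tendsto_const wl])
      (auto simp: form1_def l2_inner_self_nonneg nonneg mem f w intro!: always_eventually)
  then have wu: "AE x in M. w x = u x"
    using lim by (intro l2_norm_tendsto_unique[OF mem_L2[OF w] u fL]) (auto simp: l2_norm_tendsto_0_iff)
  have um: "u \<in> borel_measurable M" using u by (simp add: L2_def)
  show uD: "u \<in> D" by (rule mem_cong_AE[OF w um wu])
  have eq: "E u z = E w z" if "z \<in> D" for z using form_cong_AE[OF w um wu that] by simp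
  have "E (\<lambda>x. f n x - w x) (\<lambda>x. f n x - w x) = E (\<lambda>x. f n x - u x) (\<lambda>x. f n x - u x)" for n
    using eq[OF f[of n]] eq[OF w] eq[OF uD] sym[OF f[of n] w] sym[OF f[of n] uD] sym[OF w uD]
    by (simp add: expand mem f w uD)
  moreover have "(\<lambda>n. E (\<lambda>x. f n x - w x) (\<lambda>x. f n x - w x)) \<longlonglongrightarrow> 0"
    by (rule tendsto_sandwich[OF _ _ tendsto_const wl])
      (auto simp: form1_def l2_inner_self_nonneg nonneg mem f w intro!: always_eventually)
  ultimately show "(\<lambda>n. E (\<lambda>x. f n x - u x) (\<lambda>x. f n x - u x)) \<longlonglongrightarrow> 0" by simp
qed

text \<open>
  A Mazur-type argument: near-minimisers of \<open>E\<close> on the decreasing convex sets \<open>K N\<close>, which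
  contain the tails of the sequence \<open>v\<close>, form a Cauchy sequence by the parallelogram identity.
\<close>

lemma bounded_energy_limit:
  assumes v: "\<And>n. v n \<in> D" and C: "\<And>n. E (v n) (v n) \<le> C" and u: "u \<in> L2 M"
    and lim: "(\<lambda>n. l2_norm M (\<lambda>x. v n x - u x)) \<longlonglongrightarrow> 0"
  shows "u \<in> D" and "E u u \<le> C"
    and "\<And>z. z \<in> D \<Longrightarrow> (\<And>n. E (v n) z = 0) \<Longrightarrow> E u z = 0"
proof -
  \<comment> \<open>Vanishing against Z is a linear condition satisfied by every v n. It survives
    midpoints and energy limits, and so delivers the third claim without any appeal to weak
    compactness.\<close>
  define Z where "Z = {z \<in> D. \<forall>n. E (v n) z = 0}"
  define K where "K N = {w \<in> D. E w w \<le> C \<and> l2_norm M (\<lambda>x. w x - u x) \<le> 1 / real (Suc N) \<and>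
    (\<forall>z\<in>Z. E w z = 0)}" for N
  define a where "a N = (INF w\<in>K N. E w w)" for N
  have vL: "v n \<in> L2 M" for n using v mem_L2 by blast
  have Zv: "E (v n) z = 0" if "z \<in> Z" for n z using that by (simp add: Z_def)
  have ne: "K N \<noteq> {}" for N
  proof -
    have "\<forall>\<^sub>F n in sequentially. l2_norm M (\<lambda>x. v n x - u x) < 1 / real (Suc N)"
      by (rule order_tendstoD(2)[OF lim]) simp
    then obtain n where "l2_norm M (\<lambda>x. v n x - u x) < 1 / real (Suc N)"
      by (auto simp: eventually_sequentially)
    then have "v n \<in> K N" using v C Zv by (simp add: K_def)
    then show ?thesis by blast
  qed
  have bdd: "bdd_below ((\<lambda>w. E w w) ` K N)" for N
    by (rule bdd_belowI2[of _ 0]) (auto simp: K_def nonneg)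
  have anti: "K N' \<subseteq> K N" if "N \<le> N'" for N N'
  proof
    fix w assume w: "w \<in> K N'"
    have "1 / real (Suc N') \<le> 1 / real (Suc N)"
      using that by (simp add: frac_le)
    then show "w \<in> K N" using w by (auto simp: K_def intro: order_trans)
  qed
  have a_le: "a N \<le> E w w" if "w \<in> K N" for N w
    unfolding a_def by (rule cINF_lower[OF bdd that])
  have inc: "incseq a"
    unfolding a_def by (intro incseq_SucI cINF_superset_mono ne bdd anti) auto
  have aC: "a N \<le> C" for N
  proof -
    obtain w where w: "w \<in> K N" using ne by blast
    show ?thesis using a_le[OF w] w by (auto simp: K_def)
  qed
  obtain A where A: "a \<longlonglongrightarrow> A" and aA: "\<And>N. a N \<le> A"
    using incseq_convergent[OF inc, of C] aC by blast
  have "\<exists>w\<in>K N. E w w < a N + 1 / real (Suc N)" for N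
  proof -
    have "(INF w\<in>K N. E w w) < a N + 1 / real (Suc N)" by (simp add: a_def)
    then show ?thesis using cINF_less_iff[OF ne bdd] by blast
  qed
  then obtain w where wK: "\<And>N. w N \<in> K N" and wa: "\<And>N. E (w N) (w N) < a N + 1 / real (Suc N)"
    by metis
  have w: "w N \<in> D" for N using wK by (auto simp: K_def)
  have mid: "4 * a N \<le> 2 * E (w N) (w N) + 2 * E (w N') (w N') - E (\<lambda>x. w N x - w N' x) (\<lambda>x. w N x - w N' x)"
    if "N \<le> N'" for N N'
  proof -
    let ?m = "\<lambda>x. (1/2) * w N x + (1/2) * w N' x"
    have m: "?m \<in> D" by (intro mem w)
    have w2: "w N' \<in> K N" using anti[OF that] wK by blast
    have w1: "w N \<in> K N" by (rule wK)
    have em: "4 * E ?m ?m = 2 * E (w N) (w N) + 2 * E (w N') (w N') - E (\<lambda>x. w N x - w N' x) (\<lambda>x. w N x - w N' x)"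
      by (rule midpoint[OF w w])
    have "E ?m ?m \<le> C"
      using em w1 w2 nonneg[OF diff_mem[OF w w], of N N'] by (simp add: K_def)
    moreover have "l2_norm M (\<lambda>x. ?m x - u x) \<le> 1 / real (Suc N)"
    proof -
      have wL: "w N \<in> L2 M" "w N' \<in> L2 M" using w mem_L2 by blast+
      have "l2_norm M (\<lambda>x. ?m x - u x) = l2_norm M (\<lambda>x. (1/2) * (w N x - u x) + (1/2) * (w N' x - u x))"
        by (rule arg_cong[where f = "l2_norm M"]) (auto simp: fun_eq_iff field_simps)
      also have "\<dots> \<le> l2_norm M (\<lambda>x. (1/2) * (w N x - u x)) + l2_norm M (\<lambda>x. (1/2) * (w N' x - u x))"
        by (intro l2_norm_triangle L2.scale_mem L2.diff_mem wL u)
      also have "\<dots> = (1/2) * l2_norm M (\<lambda>x. w N x - u x) + (1/2) * l2_norm M (\<lambda>x. w N' x - u x)"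
        using l2_norm_scale[OF L2.diff_mem[OF wL(1) u], of "1/2"]
          l2_norm_scale[OF L2.diff_mem[OF wL(2) u], of "1/2"] by simp
      also have "\<dots> \<le> 1 / real (Suc N)" using w1 w2 by (simp add: K_def)
      finally show ?thesis .
    qed
    moreover have "E ?m z = 0" if "z \<in> Z" for z
    proof -
      have "z \<in> D" "E (w N) z = 0" "E (w N') z = 0" using w1 w2 that by (auto simp: K_def Z_def)
      then show ?thesis by (simp only: lin_left w)
    qed
    ultimately have "?m \<in> K N" using m by (simp add: K_def)
    from a_le[OF this] em show ?thesis by simp
  qed
  have cau: "form_cauchy E w"
    unfolding form_cauchy_def
  proof (intro allI impI)
    fix e :: real assume e: "e > 0"
    obtain N1 where N1: "a N > A - e / 8" if "N \<ge> N1" for N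
      using order_tendstoD(1)[OF A, of "A - e / 8"] e by (auto simp: eventually_sequentially)
    obtain N2 where N2: "1 / real (Suc N2) < e / 8" using e nat_approx_posE[of "e / 8"] by auto
    have *: "E (\<lambda>x. w i x - w j x) (\<lambda>x. w i x - w j x) < e"
      if ij: "i \<le> j" "i \<ge> max N1 N2" for i j
    proof -
      have "1 / real (Suc i) \<le> 1 / real (Suc N2)" "1 / real (Suc j) \<le> 1 / real (Suc N2)"
        using ij by (auto intro!: frac_le)
      \<comment> \<open>The energy of w i - w j is below 2 (a j - a i) + 2/(i+1) + 2/(j+1). Since a
        j - a i is at most A - a i < e/8, the total is below 6e/8.\<close>
      then show ?thesis
        using mid[OF ij(1)] wa[of i] wa[of j] N1[of i] N1[of j] aA[of i] aA[of j] ij N2 by simp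
    qed
    show "\<exists>N. \<forall>i\<ge>N. \<forall>j\<ge>N. E (\<lambda>x. w i x - w j x) (\<lambda>x. w i x - w j x) < e"
    proof (intro exI allI impI)
      fix i j assume "i \<ge> max N1 N2" "j \<ge> max N1 N2"
      then show "E (\<lambda>x. w i x - w j x) (\<lambda>x. w i x - w j x) < e"
        using *[of i j] *[of j i] diff_commute[OF w w, of i j] by (cases "i \<le> j") auto
    qed
  qed
  have wlim: "(\<lambda>n. l2_norm M (\<lambda>x. w n x - u x)) \<longlonglongrightarrow> 0"
  proof (rule tendsto_sandwich[OF _ _ tendsto_const])
    show "(\<lambda>n. 1 / real (Suc n)) \<longlonglongrightarrow> 0" using LIMSEQ_inverse_real_of_nat by (simp add: inverse_eq_divide)
    show "\<forall>\<^sub>F n in sequentially. l2_norm M (\<lambda>x. w n x - u x) \<le> 1 / real (Suc n)"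
      using wK by (auto simp: K_def intro!: always_eventually)
  qed (auto simp: l2_norm_nonneg)
  show uD: "u \<in> D" by (rule closedD(1)[OF w cau u wlim])
  have E0: "(\<lambda>n. E (\<lambda>x. w n x - u x) (\<lambda>x. w n x - u x)) \<longlonglongrightarrow> 0" by (rule closedD(2)[OF w cau u wlim])
  have "(\<lambda>n. E (w n) (w n)) \<longlonglongrightarrow> E u u" by (rule tendsto_form[OF w w uD uD E0 E0])
  then show "E u u \<le> C"
    using wK by (intro LIMSEQ_le_const2) (auto simp: K_def)
  fix z assume z: "z \<in> D" "\<And>n. E (v n) z = 0"
  have "(\<lambda>n. E (w n) z) \<longlonglongrightarrow> E u z"
    by (rule tendsto_form[OF w _ uD z(1) E0]) (use z in \<open>auto simp: zero_left mem\<close>)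
  moreover have "E (w n) z = 0" for n using wK z by (auto simp: K_def Z_def)
  ultimately show "E u z = 0" by (simp add: LIMSEQ_const_iff)
qed

subsection \<open>The resolvent\<close>

text \<open>Variational construction: g minimises Q v = E(v,v) + b |v - u|^2 over D, and the
  equation is the Euler equation of Q. The midpoint identities of E and of the inner product make a
  minimising sequence Cauchy, and closedness provides its limit.\<close>

lemma resolvent_exists:
  assumes b: "b > 0" and u: "u \<in> L2 M"
  shows "\<exists>g\<in>D. \<forall>v\<in>D. E g v + b * l2_inner M g v = b * l2_inner M u v"
proof -
  define Q where "Q v = E v v + b * l2_inner M (\<lambda>x. v x - u x) (\<lambda>x. v x - u x)" for v
  define a where "a = (INF v\<in>D. Q v)"
  have Q0: "0 \<le> Q v" if "v \<in> D" for v
    using b that by (simp add: Q_def nonneg l2_inner_self_nonneg)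
  have bdd: "bdd_below (Q ` D)" by (rule bdd_belowI2[of _ 0]) (rule Q0)
  have ne: "D \<noteq> {}" using zero_mem by blast
  have "\<exists>g\<in>D. Q g < a + 1 / real (Suc n)" for n
  proof -
    have "(INF v\<in>D. Q v) < a + 1 / real (Suc n)" by (simp add: a_def)
    then show ?thesis using cINF_less_iff[OF ne bdd] by blast
  qed
  then obtain g where g: "\<And>n. g n \<in> D" and ga: "\<And>n. Q (g n) < a + 1 / real (Suc n)"
    by metis
  have a_le: "a \<le> Q v" if "v \<in> D" for v unfolding a_def by (rule cINF_lower[OF bdd that])
  have gL: "g n \<in> L2 M" for n using g mem_L2 by blast
  have key: "E (\<lambda>x. g i x - g j x) (\<lambda>x. g i x - g j x) + b * l2_inner M (\<lambda>x. g i x - g j x) (\<lambda>x. g i x - g j x)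
     \<le> 2 * (1 / real (Suc i)) + 2 * (1 / real (Suc j))" for i j
  proof -
    let ?m = "\<lambda>x. (1/2) * g i x + (1/2) * g j x"
    have "a \<le> Q ?m" by (intro a_le mem g)
    moreover have "4 * Q ?m = 2 * Q (g i) + 2 * Q (g j) - E (\<lambda>x. g i x - g j x) (\<lambda>x. g i x - g j x)
      - b * l2_inner M (\<lambda>x. g i x - g j x) (\<lambda>x. g i x - g j x)"
    proof -
      have alg: "4 * (X + b * Y) = 2 * (p + b * q) + 2 * (p' + b * q') - r - b * r'"
        if "4 * X = 2 * p + 2 * p' - r" "4 * Y = 2 * q + 2 * q' - r'" for X Y p p' q q' r r' :: real
        using that by algebra
      have "(\<lambda>x. ?m x - u x) = (\<lambda>x. (1/2) * (g i x - u x) + (1/2) * (g j x - u x))"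
        by (auto simp: fun_eq_iff field_simps)
      then show ?thesis
        using alg[OF midpoint[OF g[of i] g[of j]] L2.midpoint[OF L2.diff_mem[OF gL[of i] u] L2.diff_mem[OF gL[of j] u]]]
        unfolding Q_def by simp
    qed
    ultimately show ?thesis using ga[of i] ga[of j] by linarith
  qed
  have cau: "form_cauchy (form1 M E) g"
    unfolding form_cauchy_def
  proof (intro allI impI)
    fix e :: real assume e: "e > 0"
    \<comment> \<open>Multiplying E + b l out by 1 + 1/b gives at least E + l, so this factor
      compares the weighted norm with \<open>form1\<close> for small and large b alike.\<close>
    let ?c = "1 + 1 / b"
    have c: "?c > 0" using b by (simp add: add_pos_pos)
    obtain N where N: "1 / real (Suc N) < e / (4 * ?c)"
      using nat_approx_posE[of "e / (4 * ?c)"] e c by (metis divide_pos_pos mult_pos_pos zero_less_numeral)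
    have e4: "e / ?c = 4 * (e / (4 * ?c))"
      unfolding times_divide_eq_right by (rule mult_divide_mult_cancel_left[symmetric]) simp
    show "\<exists>N. \<forall>i\<ge>N. \<forall>j\<ge>N. form1 M E (\<lambda>x. g i x - g j x) (\<lambda>x. g i x - g j x) < e"
    proof (intro exI allI impI)
      fix i j assume ij: "i \<ge> N" "j \<ge> N"
      let ?e = "E (\<lambda>x. g i x - g j x) (\<lambda>x. g i x - g j x)"
      let ?l = "l2_inner M (\<lambda>x. g i x - g j x) (\<lambda>x. g i x - g j x)"
      have pos: "0 \<le> ?e" "0 \<le> ?l" by (auto intro: nonneg mem g l2_inner_self_nonneg)
      have "1 / real (Suc i) \<le> 1 / real (Suc N)" "1 / real (Suc j) \<le> 1 / real (Suc N)"
        using ij by (auto intro!: frac_le)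
      moreover have "X < T" if "p \<le> r" "q \<le> r" "X \<le> 2 * p + 2 * q" "r < t" "T = 4 * t" for X T p q r t :: real
        using that by linarith
      ultimately have k: "?e + b * ?l < e / ?c" using key[of i j] N e4 by blast
      have "?e + ?l \<le> (?e + b * ?l) * ?c"
        using b pos by (simp add: field_simps)
      also have "\<dots> < e" using k c by (simp add: pos_less_divide_eq)
      finally show "form1 M E (\<lambda>x. g i x - g j x) (\<lambda>x. g i x - g j x) < e" by (simp add: form1_def)
    qed
  qed
  then obtain h where h: "h \<in> D" and hl: "(\<lambda>n. form1 M E (\<lambda>x. g n x - h x) (\<lambda>x. g n x - h x)) \<longlonglongrightarrow> 0"
    using closed g unfolding closed_form_def by blast
  have hL: "h \<in> L2 M" using h mem_L2 by blast
  have E0: "(\<lambda>n. E (\<lambda>x. g n x - h x) (\<lambda>x. g n x - h x)) \<longlonglongrightarrow> 0"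
    by (rule tendsto_sandwich[OF _ _ tendsto_const hl])
      (auto simp: form1_def l2_inner_self_nonneg nonneg mem g h intro!: always_eventually)
  have L0: "(\<lambda>n. l2_inner M (\<lambda>x. g n x - h x) (\<lambda>x. g n x - h x)) \<longlonglongrightarrow> 0"
    by (rule tendsto_sandwich[OF _ _ tendsto_const hl])
      (auto simp: form1_def l2_inner_self_nonneg nonneg mem g h intro!: always_eventually)
  have "(\<lambda>n. Q (g n)) \<longlonglongrightarrow> Q h"
    unfolding Q_def
  proof (intro tendsto_intros)
    show "(\<lambda>n. E (g n) (g n)) \<longlonglongrightarrow> E h h" by (rule tendsto_form[OF g g h h E0 E0])
    show "(\<lambda>n. l2_inner M (\<lambda>x. g n x - u x) (\<lambda>x. g n x - u x)) \<longlonglongrightarrow> l2_inner M (\<lambda>x. h x - u x) (\<lambda>x. h x - u x)"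
      by (rule L2.tendsto_form) (use L0 in \<open>auto intro!: L2.diff_mem gL hL u\<close>)
  qed
  moreover have "(\<lambda>n. a + 1 / real (Suc n)) \<longlonglongrightarrow> a + 0"
    using LIMSEQ_inverse_real_of_nat by (intro tendsto_intros) (simp add: inverse_eq_divide)
  ultimately have Qh: "Q h \<le> a"
    using ga by (intro LIMSEQ_le[where X = "\<lambda>n. Q (g n)" and Y = "\<lambda>n. a + 1 / real (Suc n)"])
      (auto intro: less_imp_le)
  have "E h v + b * l2_inner M h v = b * l2_inner M u v" if v: "v \<in> D" for v
  proof -
    have vL: "v \<in> L2 M" using v mem_L2 by blast
    define p where "p = E h v + b * l2_inner M h v - b * l2_inner M u v"
    define q where "q = E v v + b * l2_inner M v v"
    have q: "q \<ge> 0" using b v by (simp add: q_def nonneg l2_inner_self_nonneg)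
    have ge: "0 \<le> 2 * t * p + t\<^sup>2 * q" for t
    proof -
      have s: "E v h = E h v" "l2_inner M v h = l2_inner M h v" "l2_inner M v u = l2_inner M u v"
        "l2_inner M h u = l2_inner M u h"
        by (intro sym L2.sym v h hL vL u)+
      have "Q (\<lambda>x. h x + t * v x) = Q h + 2 * t * p + t\<^sup>2 * q"
        unfolding Q_def p_def q_def
        by (simp add: expand mem h v L2.expand L2.mem hL vL u s) (simp add: algebra_simps power2_eq_square)
      moreover have "a \<le> Q (\<lambda>x. h x + t * v x)" by (intro a_le mem h v)
      ultimately show ?thesis using Qh by simp
    qed
    \<comment> \<open>The denominator is q + 1 because q may be 0. At -t the quadratic of
      \<open>ge\<close> equals -t^2 (q + 2), which forces t = 0.\<close>
    define t where "t = p / (q + 1)"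
    have p: "p = t * (q + 1)" using q by (simp add: t_def)
    have "0 \<le> 2 * (- t) * p + (- t)\<^sup>2 * q" by (rule ge)
    also have "\<dots> = - (t\<^sup>2 * (q + 2))"
      by (simp add: p power2_eq_square algebra_simps)
    finally have "t\<^sup>2 * (q + 2) \<le> 0" by simp
    then have "t = 0" using q by (simp add: mult_le_0_iff)
    with p have "p = 0" by simp
    then show ?thesis by (simp add: p_def)
  qed
  then show ?thesis using h by blast
qed

text \<open>The operator \<open>res b\<close> is \<open>b\<close> times the resolvent \<open>G\<^sub>b\<close>.\<close>

definition res :: "real \<Rightarrow> ('a \<Rightarrow> real) \<Rightarrow> 'a \<Rightarrow> real" where
  "res b u = (SOME g. g \<in> D \<and> (\<forall>v\<in>D. E g v + b * l2_inner M g v = b * l2_inner M u v))"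

lemma res:
  assumes "b > 0" "u \<in> L2 M"
  shows res_mem: "res b u \<in> D"
    and res_eq: "v \<in> D \<Longrightarrow> E (res b u) v + b * l2_inner M (res b u) v = b * l2_inner M u v"
  using someI_ex[OF resolvent_exists[OF assms, unfolded Bex_def]] unfolding res_def by blast+

lemma res_L2: "b > 0 \<Longrightarrow> u \<in> L2 M \<Longrightarrow> res b u \<in> L2 M"
  using res_mem mem_L2 by blast

text \<open>The difference d of two solutions, tested against itself, gives E(d,d) + b |d|^2 = 0. As
  \<open>res\<close> is an arbitrary choice among a.e. equal functions, its algebraic rules can be
  stated only almost everywhere, and they are obtained from here.\<close>

lemma res_unique:
  assumes b: "b > 0" and u: "u \<in> L2 M" and g: "g \<in> D"
    and eq: "\<And>v. v \<in> D \<Longrightarrow> E g v + b * l2_inner M g v = b * l2_inner M u v"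
  shows "AE x in M. res b u x = g x"
proof -
  let ?r = "res b u" let ?d = "\<lambda>x. res b u x - g x"
  have r: "?r \<in> D" and rL: "?r \<in> L2 M" and gL: "g \<in> L2 M"
    using res_mem[OF b u] g mem_L2 by blast+
  have d: "?d \<in> D" by (intro mem r g)
  have dL: "?d \<in> L2 M" by (rule mem_L2[OF d])
  have "E ?d ?d + b * l2_inner M ?d ?d = 0"
    using res_eq[OF b u d] eq[OF d]
    by (simp add: diff_left[OF r g d] L2.diff_left[OF rL gL dL] right_diff_distrib)
  moreover have "0 \<le> E ?d ?d" "0 \<le> b * l2_inner M ?d ?d"
    using b d by (auto intro!: nonneg l2_inner_self_nonneg mult_nonneg_nonneg)
  ultimately have "b * l2_inner M ?d ?d = 0" by linarith
  then have "l2_norm M ?d = 0" using b by (simp add: l2_norm_def)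
  from l2_norm_eq_0_AE[OF dL this] show ?thesis by simp
qed

lemma res_lin:
  assumes b: "b > 0" and u: "u \<in> L2 M" and v: "v \<in> L2 M"
  shows "AE x in M. res b (\<lambda>x. p * u x + q * v x) x = p * res b u x + q * res b v x"
proof (rule res_unique[OF b L2.lin_mem[OF u v]])
  show "(\<lambda>x. p * res b u x + q * res b v x) \<in> D" by (intro mem res_mem b u v)
  fix w assume w: "w \<in> D"
  have "E (\<lambda>x. p * res b u x + q * res b v x) w + b * l2_inner M (\<lambda>x. p * res b u x + q * res b v x) w
    = p * (E (res b u) w + b * l2_inner M (res b u) w) + q * (E (res b v) w + b * l2_inner M (res b v) w)"
    by (simp add: lin_left L2.lin_left res_mem res_L2 b u v w mem_L2 algebra_simps)
  also have "\<dots> = b * l2_inner M (\<lambda>x. p * u x + q * v x) w"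
    by (simp add: res_eq b u v w L2.lin_left mem_L2 algebra_simps)
  finally show "E (\<lambda>x. p * res b u x + q * res b v x) w + b * l2_inner M (\<lambda>x. p * res b u x + q * res b v x) w
    = b * l2_inner M (\<lambda>x. p * u x + q * v x) w" .
qed

text \<open>Testing the equation of each resolvent with the other one produces the same symmetric
  expression on the left.\<close>

lemma res_symmetric:
  assumes b: "b > 0" and u: "u \<in> L2 M" and v: "v \<in> L2 M"
  shows "l2_inner M (res b u) v = l2_inner M u (res b v)"
proof -
  note r = res_mem[OF b u] res_mem[OF b v] res_L2[OF b u] res_L2[OF b v]
  have "b * l2_inner M u (res b v) = b * l2_inner M v (res b u)"
    using res_eq[OF b u r(2), symmetric] res_eq[OF b v r(1), symmetric]
    by (simp only: sym[OF r(1,2)] L2.sym[OF r(3,4)])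
  then have "l2_inner M u (res b v) = l2_inner M v (res b u)" using b by simp
  then show ?thesis using L2.sym[OF v r(3)] by simp
qed

text \<open>The Yosida approximation of E. It makes sense for every u in L2, so it can be evaluated
  before u is known to lie in D.\<close>

definition approx_form :: "real \<Rightarrow> 'a form" where
  "approx_form b u v = b * l2_inner M (\<lambda>x. u x - res b u x) v"

lemma approx_form_eq:
  assumes b: "b > 0" and u: "u \<in> L2 M" and v: "v \<in> D"
  shows "approx_form b u v = E (res b u) v"
  using res_eq[OF b u v]
  by (simp add: approx_form_def L2.diff_left u res_L2[OF b u] mem_L2[OF v] algebra_simps)

text \<open>Both summands are nonnegative, so a bound C on the left controls the energy of
  \<open>res b u\<close> and also yields |u - res b u|^2 <= C / b.\<close>

lemma approx_form_self:
  assumes b: "b > 0" and u: "u \<in> L2 M"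
  shows "approx_form b u u = E (res b u) (res b u) + b * l2_inner M (\<lambda>x. u x - res b u x) (\<lambda>x. u x - res b u x)"
proof -
  note rL = res_L2[OF b u]
  have "E (res b u) (res b u) = approx_form b u (res b u)"
    by (rule approx_form_eq[OF b u res_mem[OF b u], symmetric])
  then show ?thesis
    using L2.sym[OF u rL] by (simp add: approx_form_def L2.expand L2.mem u rL algebra_simps)
qed

text \<open>With r = \<open>res b u\<close>, the left side is E(r,u) and dominates E(r,r). Expanding
  0 <= E(u - r, u - r) then gives E(u,u) >= 2 E(r,u) - E(r,r) >= E(r,u).\<close>

lemma approx_form_le:
  assumes b: "b > 0" and u: "u \<in> D"
  shows "approx_form b u u \<le> E u u"
proof -
  note uL = mem_L2[OF u] and r = res_mem[OF b mem_L2[OF u]]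
  have le: "E (res b u) (res b u) \<le> approx_form b u u"
    using approx_form_self[OF b uL] b by (simp add: l2_inner_self_nonneg)
  have eq: "approx_form b u u = E (res b u) u" by (rule approx_form_eq[OF b uL u])
  have "0 \<le> E (\<lambda>x. u x - res b u x) (\<lambda>x. u x - res b u x)" by (intro nonneg mem u r)
  then show ?thesis using le eq sym[OF u r] by (simp add: expand mem u r)
qed

lemma res_tendsto_L2:
  assumes u: "u \<in> L2 M" and C: "\<And>n. approx_form (real (Suc n)) u u \<le> C"
  shows "(\<lambda>n. l2_norm M (\<lambda>x. res (real (Suc n)) u x - u x)) \<longlonglongrightarrow> 0"
proof -
  define a where "a n = l2_inner M (\<lambda>x. u x - res (real (Suc n)) u x) (\<lambda>x. u x - res (real (Suc n)) u x)" for n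
  have "a n \<le> C * inverse (real (Suc n))" for n
    using C[of n] approx_form_self[of "real (Suc n)", OF _ u] nonneg[OF res_mem[of "real (Suc n)", OF _ u]]
    by (simp add: field_simps a_def)
  then have le: "\<forall>\<^sub>F n in sequentially. a n \<le> C * inverse (real (Suc n))" by simp
  have ge: "\<forall>\<^sub>F n in sequentially. 0 \<le> a n" by (simp add: a_def l2_inner_self_nonneg)
  have "(\<lambda>n. C * inverse (real (Suc n))) \<longlonglongrightarrow> 0"
    using tendsto_mult[OF tendsto_const LIMSEQ_inverse_real_of_nat, of C] by simp
  from tendsto_sandwich[OF ge le tendsto_const this] have "a \<longlonglongrightarrow> 0" .
  then show ?thesis
    unfolding a_def l2_norm_tendsto_0_iff[symmetric] l2_norm_diff_commute[of M u] .
qed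

text \<open>Membership test for D: the resolvents of u have energy at most C and converge to u in
  L2, so \<open>bounded_energy_limit\<close> applies. Contractions of core functions enter D by this
  route.\<close>

lemma approx_form_bounded_mem:
  assumes u: "u \<in> L2 M" and C: "\<And>n. approx_form (real (Suc n)) u u \<le> C"
  shows "u \<in> D" and "E u u \<le> C"
proof -
  have r: "res (real (Suc n)) u \<in> D" for n by (rule res_mem[OF _ u]) simp
  have e: "E (res (real (Suc n)) u) (res (real (Suc n)) u) \<le> C" for n
    using C[of n] approx_form_self[of "real (Suc n)", OF _ u]
      l2_inner_self_nonneg[of M "\<lambda>x. u x - res (real (Suc n)) u x"]
      mult_nonneg_nonneg[of "real (Suc n)"] by (smt (verit) of_nat_0_le_iff of_nat_0_less_iff zero_less_Suc)
  show "u \<in> D" "E u u \<le> C"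
    by (rule bounded_energy_limit(1,2)[OF r e u res_tendsto_L2[OF u C]])+
qed

text \<open>The energy of the difference is at most E(u,u) - E_b(u,u), so it suffices that E_b(u,u)
  tends to E(u,u). Otherwise some subsequence of resolvents has energy at most E(u,u) - d, and lower
  semicontinuity would give E(u,u) <= E(u,u) - d.\<close>

lemma res_tendsto_form:
  assumes u: "u \<in> D"
  shows "(\<lambda>n. E (\<lambda>x. res (real (Suc n)) u x - u x) (\<lambda>x. res (real (Suc n)) u x - u x)) \<longlonglongrightarrow> 0"
proof -
  let ?r = "\<lambda>n. res (real (Suc n)) u" let ?a = "\<lambda>n. approx_form (real (Suc n)) u u"
  note uL = mem_L2[OF u]
  have r: "?r n \<in> D" for n by (rule res_mem[OF _ uL]) simp
  have le: "?a n \<le> E u u" for n by (intro approx_form_le u) simp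
  have Er: "E (?r n) (?r n) \<le> ?a n" for n
    using approx_form_self[of "real (Suc n)", OF _ uL]
      l2_inner_self_nonneg[of M "\<lambda>x. u x - ?r n x"] by simp
  have eq: "?a n = E (?r n) u" for n by (rule approx_form_eq[OF _ uL u]) simp
  have lim: "(\<lambda>n. l2_norm M (\<lambda>x. ?r n x - u x)) \<longlonglongrightarrow> 0" by (rule res_tendsto_L2[OF uL le])
  have ev: "\<forall>\<^sub>F n in sequentially. ?a n > E u u - d" if d: "d > 0" for d
  proof (rule ccontr)
    assume "\<not> (\<forall>\<^sub>F n in sequentially. ?a n > E u u - d)"
    then have "infinite {n. \<not> ?a n > E u u - d}"
      by (simp add: cofinite_eq_sequentially[symmetric] eventually_cofinite)
    then obtain s :: "nat \<Rightarrow> nat" where s: "strict_mono s" and sn: "\<And>n. s n \<in> {n. \<not> ?a n > E u u - d}"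
      using infinite_enumerate by blast
    have b: "E (?r (s n)) (?r (s n)) \<le> E u u - d" for n
      using sn[of n] Er[of "s n"] by simp
    have "(\<lambda>n. l2_norm M (\<lambda>x. ?r (s n) x - u x)) \<longlonglongrightarrow> 0"
      using LIMSEQ_subseq_LIMSEQ[OF lim s] by (simp add: o_def)
    from bounded_energy_limit(2)[OF r b uL this] d show False by simp
  qed
  have "?a \<longlonglongrightarrow> E u u"
  proof (rule order_tendstoI)
    fix y assume "y < E u u" then show "\<forall>\<^sub>F n in sequentially. y < ?a n"
      using ev[of "E u u - y"] by simp
  next
    fix y assume "E u u < y" then show "\<forall>\<^sub>F n in sequentially. ?a n < y"
      using le by (intro always_eventually) (meson le_less_trans)
  qed
  then have l: "(\<lambda>n. E u u - ?a n) \<longlonglongrightarrow> 0"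
    using tendsto_diff[OF tendsto_const[of "E u u"]] by fastforce
  show ?thesis
  proof (rule tendsto_sandwich[OF _ _ tendsto_const l])
    show "\<forall>\<^sub>F n in sequentially. E (\<lambda>x. ?r n x - u x) (\<lambda>x. ?r n x - u x) \<le> E u u - ?a n"
    proof (intro always_eventually allI)
      fix n
      have "E (\<lambda>x. ?r n x - u x) (\<lambda>x. ?r n x - u x) = E (?r n) (?r n) - 2 * E (?r n) u + E u u"
        using sym[OF u r[of n]] by (simp add: expand mem u r del: of_nat_Suc)
      then show "E (\<lambda>x. ?r n x - u x) (\<lambda>x. ?r n x - u x) \<le> E u u - ?a n"
        using Er[of n] eq[of n] by simp
    qed
  qed (intro always_eventually allI nonneg diff_mem u r)
qed

lemma approx_form_tendsto:
  assumes u: "u \<in> D" and v: "v \<in> D"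
  shows "(\<lambda>n. approx_form (real (Suc n)) u v) \<longlonglongrightarrow> E u v"
proof -
  have eq: "approx_form (real (Suc n)) u v = E (res (real (Suc n)) u) v" for n
    by (rule approx_form_eq[OF _ mem_L2[OF u] v]) simp
  show ?thesis
    unfolding eq by (rule tendsto_form[OF _ _ u v res_tendsto_form[OF u]])
      (auto simp: v zero_left mem intro!: res_mem mem_L2 u)
qed

end

section \<open>Dirichlet forms and the Markov property of the resolvent\<close>

locale dirichlet_form = closed_symmetric_form +
  assumes unit_contraction: "unit_contraction_operates E D"
begin

text \<open>The resolvent w minimises Q v = E(v,v) + b |v - u|^2, and truncation c of w to [0,1]
  increases neither term when u has values in [0,1]. As Q c - Q w equals E(c-w,c-w) + b |c - w|^2,
  the two functions agree almost everywhere.\<close>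

lemma res_unit_interval:
  assumes b: "b > 0" and u: "u \<in> L2 M" and u01: "AE x in M. 0 \<le> u x \<and> u x \<le> 1"
  shows "AE x in M. 0 \<le> res b u x \<and> res b u x \<le> 1"
proof -
  define w where "w = res b u"
  define c where "c x = min (max (w x) 0) 1" for x
  have w: "w \<in> D" unfolding w_def by (rule res_mem[OF b u])
  have c: "c \<in> D" and Ec: "E c c \<le> E w w"
    using unit_contraction w unfolding unit_contraction_operates_def c_def by blast+
  note wL = mem_L2[OF w] and cL = mem_L2[OF c]
  have "l2_norm M (\<lambda>x. c x - u x) \<le> l2_norm M (\<lambda>x. w x - u x)"
  proof (rule l2_norm_mono(2))
    show "(\<lambda>x. w x - u x) \<in> L2 M" by (intro L2.mem wL u)
    show "(\<lambda>x. c x - u x) \<in> borel_measurable M" by (intro L2_measurable L2.mem cL u)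
    show "AE x in M. \<bar>c x - u x\<bar> \<le> \<bar>w x - u x\<bar>"
      using u01 by eventually_elim (auto simp: c_def)
  qed
  then have n: "l2_inner M (\<lambda>x. c x - u x) (\<lambda>x. c x - u x) \<le> l2_inner M (\<lambda>x. w x - u x) (\<lambda>x. w x - u x)"
    using l2_norm_nonneg by (metis l2_norm_squared power_mono)
  have s: "E c w = E w c" "l2_inner M c w = l2_inner M w c" "l2_inner M c u = l2_inner M u c" "l2_inner M w u = l2_inner M u w"
    by (intro sym L2.sym w c wL cL u)+
  let ?d = "\<lambda>x. c x - w x"
  have "E ?d ?d + b * l2_inner M ?d ?d = (E c c - E w w) + b * (l2_inner M (\<lambda>x. c x - u x) (\<lambda>x. c x - u x)
     - l2_inner M (\<lambda>x. w x - u x) (\<lambda>x. w x - u x))"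
    using res_eq[OF b u c] res_eq[OF b u w] s
    by (simp add: expand mem c w L2.expand L2.mem cL wL u w_def[symmetric]) (simp add: algebra_simps)
  moreover have "b * (l2_inner M (\<lambda>x. c x - u x) (\<lambda>x. c x - u x) - l2_inner M (\<lambda>x. w x - u x) (\<lambda>x. w x - u x)) \<le> 0"
    using n b by (intro mult_nonneg_nonpos) auto
  ultimately have "E ?d ?d + b * l2_inner M ?d ?d \<le> 0" using Ec by linarith
  moreover have "0 \<le> E ?d ?d" by (intro nonneg mem c w)
  ultimately have "b * l2_inner M ?d ?d \<le> 0" by linarith
  then have "l2_inner M ?d ?d \<le> 0" using b by (simp add: mult_le_0_iff)
  then have "l2_norm M ?d = 0" using l2_inner_self_nonneg[of M ?d] by (simp add: l2_norm_def)
  from l2_norm_eq_0_AE[OF L2.diff_mem[OF cL wL] this]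
  have "AE x in M. c x - w x = 0" .
  then show ?thesis
    unfolding w_def[symmetric] by eventually_elim (auto simp: c_def split: if_splits simp: min_def max_def)
qed

lemma res_bounds:
  assumes b: "b > 0" and u: "u \<in> L2 M" and K: "AE x in M. 0 \<le> u x \<and> u x \<le> K"
  shows "AE x in M. 0 \<le> res b u x \<and> res b u x \<le> \<bar>K\<bar> + 1"
proof -
  \<comment> \<open>The summand 1 keeps L positive, so that u / L is defined and lies in [0,1]
    whatever the sign of K.\<close>
  define L where "L = \<bar>K\<bar> + 1"
  have L: "L > 0" by (simp add: L_def)
  have s: "(\<lambda>x. (1 / L) * u x) \<in> L2 M" by (intro L2.mem u)
  have "AE x in M. 0 \<le> (1 / L) * u x \<and> (1 / L) * u x \<le> 1"
    using K by eventually_elim (use L in \<open>auto simp: L_def field_simps\<close>)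
  from res_unit_interval[OF b s this]
  have 1: "AE x in M. 0 \<le> res b (\<lambda>x. (1 / L) * u x) x \<and> res b (\<lambda>x. (1 / L) * u x) x \<le> 1" .
  have "AE x in M. res b (\<lambda>x. (1 / L) * u x + 0 * u x) x = (1 / L) * res b u x + 0 * res b u x"
    by (rule res_lin[OF b u u])
  with 1 show ?thesis
    unfolding L_def[symmetric]
  proof eventually_elim
    case (elim x)
    then have "res b u x = L * res b (\<lambda>x. (1 / L) * u x) x" using L by simp
    moreover have "0 \<le> L * res b (\<lambda>x. (1 / L) * u x) x" "L * res b (\<lambda>x. (1 / L) * u x) x \<le> L * 1"
      using elim(1) L less_imp_le[OF L] by (blast intro: mult_nonneg_nonneg mult_left_mono)+
    ultimately show ?case by linarith
  qed
qed

lemma res_nonneg: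
  assumes "b > 0" "u \<in> L2 M" "\<And>x. 0 \<le> u x" "\<And>x. u x \<le> K"
  shows "AE x in M. 0 \<le> res b u x"
  using res_bounds[of b u K] assms by auto

text \<open>The positive and negative parts of u / K are mapped into [0,1], and the difference of
  two numbers in [0,1] has modulus at most 1. Splitting this way keeps the constant exactly
  K.\<close>

lemma res_abs_le:
  assumes b: "b > 0" and u: "u \<in> L2 M" and K: "\<And>x. \<bar>u x\<bar> \<le> K" and K0: "K > 0"
  shows "AE x in M. \<bar>res b u x\<bar> \<le> K"
proof -
  define p n where "p x = (1 / K) * max (u x) 0" and "n x = (1 / K) * max (- u x) 0" for x
  have um[measurable]: "u \<in> borel_measurable M" by (rule L2_measurable[OF u])
  have [measurable]: "p \<in> borel_measurable M" "n \<in> borel_measurable M"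
    unfolding p_def n_def by measurable
  have pL: "p \<in> L2 M" and nL: "n \<in> L2 M"
    using K0 by (auto simp: p_def n_def abs_mult divide_simps intro!: l2_norm_mono(1)[OF L2.scale_mem[OF u, of "1 / K"]])
  have 1: "AE x in M. 0 \<le> res b p x \<and> res b p x \<le> 1"
  proof (intro res_unit_interval b pL AE_I2)
    fix x show "0 \<le> p x \<and> p x \<le> 1" using K[of x] K0 by (auto simp: p_def field_simps)
  qed
  have 2: "AE x in M. 0 \<le> res b n x \<and> res b n x \<le> 1"
  proof (intro res_unit_interval b nL AE_I2)
    fix x show "0 \<le> n x \<and> n x \<le> 1" using K[of x] K0 by (auto simp: n_def field_simps)
  qed
  have u_eq: "u = (\<lambda>x. K * p x + (- K) * n x)" using K0 by (auto simp: p_def n_def fun_eq_iff max_def)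
  have "AE x in M. res b u x = K * res b p x + (- K) * res b n x"
    by (subst u_eq) (rule res_lin[OF b pL nL])
  with 1 2 show ?thesis
  proof eventually_elim
    case (elim x)
    have "res b u x = K * (res b p x - res b n x)" using elim by (simp add: algebra_simps)
    moreover have "\<bar>res b p x - res b n x\<bar> \<le> 1" using elim by auto
    ultimately show ?case using K0 by (simp add: abs_mult mult_left_le)
  qed
qed

end

section \<open>Continuous functions with compact support\<close>

lemma
  assumes "f \<in> C0"
  shows C0_continuous: "continuous_on UNIV f" and C0_compact_support: "compact (closure {x. f x \<noteq> 0})"
  using assms by (simp_all add: C0_def)

lemma C0_measurable: "f \<in> C0 \<Longrightarrow> f \<in> borel_measurable borel"
  by (simp add: C0_continuous borel_measurable_continuous_onI)

lemma C0I:
  fixes f :: "'a::t2_space \<Rightarrow> real"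
  assumes "continuous_on UNIV f" "compact K" "\<And>x. f x \<noteq> 0 \<Longrightarrow> x \<in> K"
  shows "f \<in> C0"
proof -
  have "closure {x. f x \<noteq> 0} \<subseteq> K"
    using assms by (intro closure_minimal) (auto intro: compact_imp_closed)
  then have "compact (closure {x. f x \<noteq> 0})"
    using assms(2) compact_Int_closed[OF assms(2) closed_closure, of "{x. f x \<noteq> 0}"]
    by (simp add: Int_absorb1)
  with assms(1) show ?thesis by (simp add: C0_def)
qed

lemma C0_outside_support: "x \<notin> closure {x. f x \<noteq> 0} \<Longrightarrow> f x = 0"
  using closure_subset[of "{x. f x \<noteq> 0}"] by auto

lemma C0_bounded:
  assumes "f \<in> C0"
  obtains B where "B > 0" "\<And>x. \<bar>f x\<bar> \<le> B"
proof -
  let ?K = "closure {x. f x \<noteq> 0}"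
  have "compact (f ` ?K)"
    using assms by (intro compact_continuous_image C0_compact_support continuous_on_subset[OF C0_continuous]) auto
  then have "bounded (f ` ?K)" by (rule compact_imp_bounded)
  then obtain B where B: "B > 0" "\<And>y. y \<in> f ` ?K \<Longrightarrow> norm y \<le> B"
    using bounded_pos by metis
  have "\<bar>f x\<bar> \<le> B" for x
  proof (cases "x \<in> ?K")
    case True then show ?thesis using B(2)[of "f x"] by simp
  next
    case False then show ?thesis using B(1) C0_outside_support[OF False] by simp
  qed
  then show ?thesis using B(1) that by blast
qed

lemma C0_mult:
  fixes f g :: "'a::t2_space \<Rightarrow> real"
  assumes "f \<in> C0" "continuous_on UNIV g"
  shows "(\<lambda>x. f x * g x) \<in> C0" "(\<lambda>x. g x * f x) \<in> C0"
proof -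
  have c: "continuous_on UNIV f" by (rule C0_continuous[OF assms(1)])
  have s: "x \<in> closure {x. f x \<noteq> 0}" if "f x \<noteq> 0" for x
    using that C0_outside_support by metis
  show "(\<lambda>x. f x * g x) \<in> C0" "(\<lambda>x. g x * f x) \<in> C0"
    by (rule C0I[OF continuous_on_mult[OF c assms(2)] C0_compact_support[OF assms(1)]], rule s, simp)
      (rule C0I[OF continuous_on_mult[OF assms(2) c] C0_compact_support[OF assms(1)]], rule s, simp)
qed

lemma C0_zero: "(\<lambda>x. 0) \<in> C0"
  by (simp add: C0_def)

lemma C0_compose:
  fixes f :: "'a::t2_space \<Rightarrow> real" and G :: "real \<Rightarrow> real"
  assumes f: "f \<in> C0" and "continuous_on UNIV G" "G 0 = 0"
  shows "(\<lambda>x. G (f x)) \<in> C0"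
proof (rule C0I[OF _ C0_compact_support[OF f]])
  show "continuous_on UNIV (\<lambda>x. G (f x))"
    using assms by (intro continuous_on_compose2[OF assms(2)] C0_continuous) auto
  fix x assume "G (f x) \<noteq> 0" then have "f x \<noteq> 0" using assms by auto
  then show "x \<in> closure {x. f x \<noteq> 0}" using closure_subset[of "{x. f x \<noteq> 0}"] by auto
qed

lemma C0_lin:
  fixes f g :: "'a::t2_space \<Rightarrow> real"
  assumes "f \<in> C0" "g \<in> C0"
  shows "(\<lambda>x. a * f x + b * g x) \<in> C0"
proof (rule C0I)
  show "compact (closure {x. f x \<noteq> 0} \<union> closure {x. g x \<noteq> 0})"
    using assms by (intro compact_Un C0_compact_support)
  show "x \<in> closure {x. f x \<noteq> 0} \<union> closure {x. g x \<noteq> 0}" if "a * f x + b * g x \<noteq> 0" for x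
    using that C0_outside_support[of x f] C0_outside_support[of x g] by (cases "f x = 0") auto
qed (use assms in \<open>intro continuous_intros C0_continuous\<close>)

text \<open>Open sets contained in compact sets cover the space; Lindelof leaves countably many of
  them, and finite unions of the compact sets exhaust the space.\<close>

lemma locally_compact_sigma_compact:
  assumes lc: "locally_compact_space (euclidean :: 'a::{metric_space,second_countable_topology} topology)"
  obtains K :: "nat \<Rightarrow> 'a::{metric_space,second_countable_topology} set" where "\<And>n. compact (K n)" "incseq K" "(\<Union>n. K n) = UNIV"
proof -
  have "\<forall>x::'a. \<exists>U L. open U \<and> compact L \<and> x \<in> U \<and> U \<subseteq> L"
    using lc by (simp add: locally_compact_space_def)
  then obtain U L where U: "\<And>x::'a. open (U x)" "\<And>x. compact (L x)" "\<And>x. x \<in> U x" "\<And>x. U x \<subseteq> L x"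
    by metis
  obtain F where F: "F \<subseteq> range U" "countable F" "\<Union>F = \<Union>(range U)"
    using Lindelof[of "range U"] U(1) by auto
  have cover: "\<Union>F = UNIV" using F(3) U(3) by auto
  then have ne: "F \<noteq> {}" by auto
  define V where "V = from_nat_into F"
  have rV: "range V = F" unfolding V_def by (rule range_from_nat_into[OF ne F(2)])
  have "\<exists>M. compact M \<and> V n \<subseteq> M" for n
  proof -
    obtain x where "V n = U x" using rV F(1) by blast
    then show ?thesis using U(2)[of x] U(4)[of x] by auto
  qed
  then obtain M where M: "\<And>n. compact (M n)" "\<And>n. V n \<subseteq> M n" by metis
  show thesis
  proof
    show "compact (\<Union>i\<le>n. M i)" for n using M(1) by (intro compact_UN) auto
    show "incseq (\<lambda>n. \<Union>i\<le>n. M i)" by (intro incseq_SucI UN_mono) auto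
    show "(\<Union>n. \<Union>i\<le>n. M i) = UNIV"
    proof -
      have "x \<in> (\<Union>n. \<Union>i\<le>n. M i)" for x
      proof -
        obtain n where "x \<in> V n" using cover rV by blast
        then show ?thesis using M(2) by auto
      qed
      then show ?thesis by auto
    qed
  qed
qed

text \<open>Urysohn's lemma for K and the complement of U intersected with V, where V is an open
  neighbourhood of K inside a compact set; V is what makes the support compact.\<close>

lemma C0_bump:
  fixes K :: "'a::metric_space set"
  assumes lc: "locally_compact_space (euclidean :: 'a topology)"
    and K: "compact K" and U: "open U" and KU: "K \<subseteq> U"
  obtains f where "f \<in> C0" "\<And>x. 0 \<le> f x" "\<And>x. f x \<le> 1" "\<And>x. x \<in> K \<Longrightarrow> f x = 1"
    "\<And>x. x \<notin> U \<Longrightarrow> f x = 0"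
proof -
  have T2: "Hausdorff_space (euclidean :: 'a topology)" by simp
  then obtain V L where V: "open V" "compact L" "K \<subseteq> V" "V \<subseteq> L"
    using lc locally_compact_space_compact_closed_compact[of "euclidean :: 'a topology"] K
    by (metis compactin_euclidean_iff open_openin)
  have "normal_space (euclidean :: 'a topology)"
    by (intro metrizable_imp_normal_space metrizable_space_euclidean)
  moreover have "closedin euclidean (- (U \<inter> V))" "closedin euclidean K"
    using U V(1) K by (auto simp: closed_closedin[symmetric] compact_imp_closed open_Int)
  moreover have "disjnt (- (U \<inter> V)) K" using KU V(3) by (auto simp: disjnt_def)
  ultimately obtain f where f: "continuous_map euclidean (top_of_set {0..1::real}) f"
      "f ` (- (U \<inter> V)) \<subseteq> {0}" "f ` K \<subseteq> {1}"
    using Urysohn_lemma[of euclidean "- (U \<inter> V)" K 0 1] by auto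
  have c: "continuous_on UNIV f" and r: "\<And>x. f x \<in> {0..1}"
    using f(1) by (auto simp: continuous_map_in_subtopology)
  show thesis
  proof
    show "f \<in> C0" by (rule C0I[OF c V(2)]) (use f(2) V(4) in blast)
    show "0 \<le> f x" "f x \<le> 1" for x using r[of x] by auto
    show "x \<in> K \<Longrightarrow> f x = 1" for x using f(3) by auto
    show "x \<notin> U \<Longrightarrow> f x = 0" for x using f(2) by auto
  qed
qed

section \<open>Radon measures\<close>

lemma radon_sets: "radon_measure M \<Longrightarrow> sets M = sets borel"
  by (simp add: radon_measure_def)

lemma radon_space: "radon_measure M \<Longrightarrow> space M = UNIV"
  using radon_sets sets_eq_imp_space_eq[of M borel] by auto

lemma radon_compact:
  assumes "radon_measure M" "compact (K :: 'a::t2_space set)"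
  shows "K \<in> sets M" "emeasure M K < \<infinity>"
  using assms by (auto simp: radon_measure_def intro: borel_closed compact_imp_closed)

lemma radon_C0_measurable: "radon_measure M \<Longrightarrow> f \<in> C0 \<Longrightarrow> f \<in> borel_measurable M"
  using C0_measurable measurable_cong_sets[OF radon_sets refl] by blast

lemma radon_C0_integrable:
  fixes f :: "'a::t2_space \<Rightarrow> real"
  assumes M: "radon_measure M" and f: "f \<in> C0"
  shows "integrable M f"
proof -
  obtain B where B: "B > 0" "\<And>x. \<bar>f x\<bar> \<le> B" using C0_bounded[OF f] by blast
  let ?K = "closure {x. f x \<noteq> 0}"
  note K = radon_compact[OF M C0_compact_support[OF f]]
  show ?thesis
  proof (rule Bochner_Integration.integrable_bound)
    show "integrable M (\<lambda>x. indicator ?K x * B)"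
      using K by (intro integrable_mult_left integrable_real_indicator)
    show "AE x in M. norm (f x) \<le> norm (indicator ?K x * B)"
      using B C0_outside_support by (intro AE_I2) (fastforce simp: indicator_def)
  qed (rule radon_C0_measurable[OF M f])
qed

lemma radon_C0_L2:
  fixes f :: "'a::t2_space \<Rightarrow> real"
  assumes M: "radon_measure M" and f: "f \<in> C0"
  shows "f \<in> L2 M"
  using radon_C0_integrable[OF M C0_mult(1)[OF f C0_continuous[OF f]]] radon_C0_measurable[OF M f]
  by (simp add: L2_def power2_eq_square)

section \<open>Regular Dirichlet forms\<close>

locale regular_dirichlet_form = dirichlet_form M E D
  for M :: "'a::{metric_space, second_countable_topology} measure" and E D +
  assumes locally_compact: "locally_compact_space (euclidean :: 'a topology)"
    and admissible: "admissible_reference_measure M"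
    and regular: "regular_form M E D"
begin

abbreviation core :: "('a \<Rightarrow> real) set" where "core \<equiv> C0 \<inter> D"

lemma radon: "radon_measure M"
  using admissible by (simp add: admissible_reference_measure_def)

lemma C0_L2: "f \<in> C0 \<Longrightarrow> f \<in> L2 M"
  by (rule radon_C0_L2[OF radon])

lemma res_sum:
  assumes b: "b > 0" and I: "finite I" and f: "\<And>i. i \<in> I \<Longrightarrow> f i \<in> L2 M"
  shows "AE x in M. res b (\<lambda>x. \<Sum>i\<in>I. f i x) x = (\<Sum>i\<in>I. res b (f i) x)"
  using I f
proof (induction I rule: finite_induct)
  case empty
  have "AE x in M. res b (\<lambda>x. 0) x = (\<lambda>x. 0) x"
    by (rule res_unique[OF b L2.zero_mem zero_mem])
      (simp add: zero_left L2.zero_left mem_L2)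
  then show ?case by simp
next
  case (insert i I)
  have "AE x in M. res b (\<lambda>x. 1 * f i x + 1 * (\<Sum>i\<in>I. f i x)) x = 1 * res b (f i) x + 1 * res b (\<lambda>x. \<Sum>i\<in>I. f i x) x"
    using insert by (intro res_lin b L2.sum_mem) auto
  moreover have "AE x in M. res b (\<lambda>x. \<Sum>i\<in>I. f i x) x = (\<Sum>i\<in>I. res b (f i) x)"
    using insert by auto
  ultimately show ?case
    by eventually_elim (use insert in simp)
qed

text \<open>
  Positivity is inherited from pure jump forms: \<open>approx_form b (u, v)\<close> is
  \<open>b/2 \<integral>\<integral> (u x - u y) (v x - v y) P(x, dy) dx + b \<integral> u v (1 - P 1) dx\<close> with the Markovian
  kernel \<open>P = res b\<close>. Kernels are avoided by applying \<open>P\<close> to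
  \<open>y \<mapsto> \<Sum> a i (u i s - u i y) (v i s - v i y)\<close> for \<open>s\<close> in a countable dense set and then letting
  \<open>s\<close> tend to the point of evaluation.
\<close>

lemma approx_form_sum_nonneg:
  fixes u v :: "'i \<Rightarrow> 'a \<Rightarrow> real" and a :: "'i \<Rightarrow> real"
  assumes b: "b > 0" and I: "finite I"
    and u: "\<And>i. i \<in> I \<Longrightarrow> u i \<in> C0" and v: "\<And>i. i \<in> I \<Longrightarrow> v i \<in> C0"
    and jump: "\<And>x y. 0 \<le> (\<Sum>i\<in>I. a i * ((u i x - u i y) * (v i x - v i y)))"
    and kill: "\<And>x. 0 \<le> (\<Sum>i\<in>I. a i * (u i x * v i x))"
  shows "0 \<le> (\<Sum>i\<in>I. a i * approx_form b (u i) (v i))"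
proof -
  define A where "A = (\<Union>i\<in>I. closure {x. u i x \<noteq> 0} \<union> closure {x. v i x \<noteq> 0})"
  have A: "compact A" unfolding A_def using I u v
    by (intro compact_UN compact_Un C0_compact_support) auto
  note AM = radon_compact[OF radon A]
  \<comment> \<open>Stands in for the constant 1, which need not be square integrable; all u i and v
    i vanish off A.\<close>
  define e where "e = (indicator A :: 'a \<Rightarrow> real)"
  have u0: "u i x = 0" and v0: "v i x = 0" if "i \<in> I" "x \<notin> A" for i x
    using that C0_outside_support[of x "u i"] C0_outside_support[of x "v i"] by (auto simp: A_def)
  have eL: "e \<in> L2 M"
    using AM by (auto simp: L2_def e_def power2_eq_square indicator_inter_arith[symmetric] intro!: integrable_real_indicator)
  define w where "w i x = u i x * v i x" for i x
  have w: "w i \<in> C0" if "i \<in> I" for i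
    unfolding w_def using that by (intro C0_mult u v C0_continuous)
  have uL: "u i \<in> L2 M" and vL: "v i \<in> L2 M" and wL: "w i \<in> L2 M" if "i \<in> I" for i
    using that u v w C0_L2 by auto
  define P where "P = res b"
  have PL: "P f \<in> L2 M" if "f \<in> L2 M" for f unfolding P_def by (rule res_L2[OF b that])
  \<comment> \<open>The sum p + q is the product of increments (u i s - u i y)(v i s - v i y)
    multiplied out as a function of y with s frozen, grouped in pairs so that \<open>res_lin\<close>
    applies.\<close>
  define p where "p s i y = u i s * v i s * e y + (- u i s) * v i y" for s i y
  define q where "q s i y = (- v i s) * u i y + 1 * w i y" for s i y
  define h where "h s i y = a i * p s i y + a i * q s i y" for s i y
  have pL: "p s i \<in> L2 M" and qL: "q s i \<in> L2 M" and hL: "h s i \<in> L2 M" if "i \<in> I" for s i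
    unfolding p_def q_def h_def using that by (intro L2.lin_mem eL uL vL wL; simp)+
  define H where "H s y = (\<Sum>i\<in>I. h s i y)" for s y
  have HL: "H s \<in> L2 M" for s unfolding H_def by (intro L2.sum_mem hL)
  have H_eq: "H s y = indicator A y * (\<Sum>i\<in>I. a i * ((u i s - u i y) * (v i s - v i y)))" for s y
  proof (cases "y \<in> A")
    case True then show ?thesis
      by (simp add: H_def h_def p_def q_def w_def e_def algebra_simps)
  next
    case False then show ?thesis
      using u0 v0 by (simp add: H_def h_def p_def q_def w_def e_def)
  qed
  have Hb: "\<exists>K. \<forall>y. H s y \<le> K" for s
  proof -
    have "compact ((\<lambda>y. \<Sum>i\<in>I. a i * ((u i s - u i y) * (v i s - v i y))) ` A)"
      by (intro compact_continuous_image A continuous_intros continuous_on_subset[OF C0_continuous[OF u]]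
          continuous_on_subset[OF C0_continuous[OF v]]) auto
    from compact_imp_bounded[OF this]
    obtain K where K: "\<And>y. y \<in> A \<Longrightarrow> \<bar>\<Sum>i\<in>I. a i * ((u i s - u i y) * (v i s - v i y))\<bar> \<le> K"
      by (auto simp: bounded_iff)
    have "H s y \<le> \<bar>K\<bar>" for y
      using K[of y] by (cases "y \<in> A") (auto simp: H_eq)
    then show ?thesis by blast
  qed
  have PH: "AE x in M. 0 \<le> P (H s) x" for s
  proof -
    obtain K where "\<And>y. H s y \<le> K" using Hb by blast
    then show ?thesis unfolding P_def using jump
      by (intro res_nonneg[OF b HL]) (auto simp: H_eq)
  qed
  have Pp: "AE x in M. P (p s i) x = u i s * v i s * P e x + (- u i s) * P (v i) x" if "i \<in> I" for s i
    unfolding P_def p_def using that by (intro res_lin b eL vL)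
  have Pq: "AE x in M. P (q s i) x = (- v i s) * P (u i) x + 1 * P (w i) x" if "i \<in> I" for s i
    unfolding P_def q_def using that by (intro res_lin b uL wL)
  have Ph: "AE x in M. P (h s i) x = a i * P (p s i) x + a i * P (q s i) x" if "i \<in> I" for s i
    unfolding P_def h_def using that by (intro res_lin b pL qL)
  \<comment> \<open>Almost everywhere this is \<open>P (H s) x\<close>. Written out, it depends on s
    only through the continuous functions u i and v i, so for fixed x it is continuous in s
    whichever representatives of P were chosen.\<close>
  define T where "T s x = (\<Sum>i\<in>I. a i * (u i s * v i s * P e x - u i s * P (v i) x - v i s * P (u i) x + P (w i) x))" for s x
  have "AE x in M. 0 \<le> T s x" for s
  proof -
    have "AE x in M. \<forall>i\<in>I. P (h s i) x = a i * (u i s * v i s * P e x - u i s * P (v i) x - v i s * P (u i) x + P (w i) x)"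
    proof (rule AE_finite_allI[OF I])
      fix i assume i: "i \<in> I"
      show "AE x in M. P (h s i) x = a i * (u i s * v i s * P e x - u i s * P (v i) x - v i s * P (u i) x + P (w i) x)"
        using Pp[OF i, of s] Pq[OF i, of s] Ph[OF i, of s]
        by eventually_elim (simp only:, simp add: algebra_simps)
    qed
    moreover have "AE x in M. P (H s) x = (\<Sum>i\<in>I. P (h s i) x)"
      unfolding P_def H_def by (rule res_sum[OF b I hL])
    ultimately show ?thesis using PH[of s]
      by eventually_elim (simp add: T_def)
  qed
  moreover obtain S :: "'a set" where S: "countable S" "\<And>X. open X \<Longrightarrow> X \<noteq> {} \<Longrightarrow> \<exists>d\<in>S. d \<in> X"
    using countable_dense_exists by blast
  ultimately have TS: "AE x in M. \<forall>s\<in>S. 0 \<le> T s x"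
    by (subst AE_ball_countable) auto
  have clS: "closure S = UNIV"
    using S(2)[of "- closure S"] closure_subset[of S] by blast
  have e01: "AE x in M. 0 \<le> P e x \<and> P e x \<le> 1"
    unfolding P_def by (rule res_unit_interval[OF b eL]) (auto simp: e_def indicator_def)
  \<comment> \<open>On the diagonal s = x, with P e replaced by its upper bound 1, which is
    legitimate because its coefficient is nonnegative by \<open>kill\<close>. The factor e makes the
    last term a product of two L2 functions, hence integrable.\<close>
  define R where "R x = (\<Sum>i\<in>I. a i * (u i x * v i x - u i x * P (v i) x - v i x * P (u i) x + e x * P (w i) x))" for x
  have R0: "AE x in M. 0 \<le> R x"
    using TS e01
  proof eventually_elim
    case (elim x)
    have "continuous_on UNIV (\<lambda>s. T s x)"
      unfolding T_def
      by (intro continuous_on_sum continuous_on_mult continuous_on_add continuous_on_diff continuous_on_const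
          C0_continuous u v)
    then have "continuous_on (closure S) (\<lambda>s. T s x)" unfolding clS .
    from continuous_ge_on_closure[OF this, of x 0] have "0 \<le> T x x"
      using elim(1) clS by blast
    also have "T x x \<le> (\<Sum>i\<in>I. a i * (u i x * v i x - u i x * P (v i) x - v i x * P (u i) x + P (w i) x))"
    proof -
      have "(\<Sum>i\<in>I. a i * (u i x * v i x)) * P e x \<le> (\<Sum>i\<in>I. a i * (u i x * v i x)) * 1"
        using elim(2) kill by (intro mult_left_mono) auto
      then show ?thesis
        by (simp add: T_def algebra_simps sum.distrib sum_subtractf sum_distrib_left sum_distrib_right)
    qed
    finally have "0 \<le> (\<Sum>i\<in>I. a i * (u i x * v i x - u i x * P (v i) x - v i x * P (u i) x + P (w i) x))" .
    then show ?case
      by (cases "x \<in> A") (simp_all add: R_def e_def u0 v0)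
  qed
  have int: "integrable M (\<lambda>x. u i x * v i x)" "integrable M (\<lambda>x. u i x * P (v i) x)"
     "integrable M (\<lambda>x. v i x * P (u i) x)" "integrable M (\<lambda>x. e x * P (w i) x)" if "i \<in> I" for i
    using that by (intro L2_mult_integrable uL vL PL eL wL; assumption)+
  have "0 \<le> (\<integral>x. R x \<partial>M)" by (rule integral_nonneg_AE[OF R0])
  also have "(\<integral>x. R x \<partial>M) = (\<Sum>i\<in>I. a i * (l2_inner M (u i) (v i) - l2_inner M (u i) (P (v i))
      - l2_inner M (v i) (P (u i)) + l2_inner M e (P (w i))))"
    unfolding R_def l2_inner_def using int by simp
  finally have 1: "0 \<le> (\<Sum>i\<in>I. a i * (l2_inner M (u i) (v i) - l2_inner M (u i) (P (v i))
      - l2_inner M (v i) (P (u i)) + l2_inner M e (P (w i))))" .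
  \<comment> \<open>Symmetry moves P from w i to e; then P e <= 1 and \<open>kill\<close> give the
    sign of the killing part.\<close>
  have "(\<Sum>i\<in>I. a i * l2_inner M e (P (w i))) = (\<Sum>i\<in>I. a i * l2_inner M (P e) (w i))"
    unfolding P_def by (intro sum.cong refl) (simp add: res_symmetric[OF b eL wL])
  also have "\<dots> = (\<integral>x. P e x * (\<Sum>i\<in>I. a i * w i x) \<partial>M)"
  proof -
    have "integrable M (\<lambda>x. P e x * w i x)" if "i \<in> I" for i
      using that by (intro L2_mult_integrable PL eL wL)
    then have "(\<Sum>i\<in>I. a i * l2_inner M (P e) (w i)) = (\<integral>x. (\<Sum>i\<in>I. a i * (P e x * w i x)) \<partial>M)"
      by (simp add: l2_inner_def)
    then show ?thesis by (simp add: sum_distrib_left algebra_simps)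
  qed
  also have "\<dots> \<le> (\<integral>x. (\<Sum>i\<in>I. a i * w i x) \<partial>M)"
  proof (rule integral_mono_AE)
    have wi: "integrable M (w i)" if "i \<in> I" for i using radon_C0_integrable[OF radon w[OF that]] .
    then show "integrable M (\<lambda>x. \<Sum>i\<in>I. a i * w i x)" by simp
    have "integrable M (\<lambda>x. \<Sum>i\<in>I. a i * (P e x * w i x))"
      by (intro Bochner_Integration.integrable_sum integrable_mult_right L2_mult_integrable PL eL wL)
    then show "integrable M (\<lambda>x. P e x * (\<Sum>i\<in>I. a i * w i x))"
      by (simp add: sum_distrib_left algebra_simps)
    show "AE x in M. P e x * (\<Sum>i\<in>I. a i * w i x) \<le> (\<Sum>i\<in>I. a i * w i x)"
      using e01
    proof eventually_elim
      case (elim x)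
      have "P e x * (\<Sum>i\<in>I. a i * w i x) \<le> 1 * (\<Sum>i\<in>I. a i * w i x)"
        using elim kill[of x] by (intro mult_right_mono) (auto simp: w_def)
      then show ?case by simp
    qed
  qed
  also have "\<dots> = (\<Sum>i\<in>I. a i * l2_inner M (u i) (v i))"
    using int(1) by (simp add: l2_inner_def w_def)
  finally have 2: "(\<Sum>i\<in>I. a i * l2_inner M e (P (w i))) \<le> (\<Sum>i\<in>I. a i * l2_inner M (u i) (v i))" .
  \<comment> \<open>Twice the form is the jump bracket, nonnegative by 1, plus the killing bracket,
    nonnegative by 2; the terms with e and w i cancel.\<close>
  have "(\<Sum>i\<in>I. a i * (b * 2 * (l2_inner M (u i) (v i) - l2_inner M (P (u i)) (v i)))) =
    b * ((\<Sum>i\<in>I. a i * (l2_inner M (u i) (v i) - l2_inner M (u i) (P (v i))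
      - l2_inner M (v i) (P (u i)) + l2_inner M e (P (w i)))) +
      ((\<Sum>i\<in>I. a i * l2_inner M (u i) (v i)) - (\<Sum>i\<in>I. a i * l2_inner M e (P (w i)))))"
  proof -
    have "l2_inner M (u i) (P (v i)) = l2_inner M (P (u i)) (v i)" "l2_inner M (v i) (P (u i)) = l2_inner M (P (u i)) (v i)"
      if "i \<in> I" for i
      using res_symmetric[OF b uL vL, OF that that] L2.sym[OF vL PL[OF uL], OF that that] by (simp_all add: P_def)
    then show ?thesis
      unfolding sum_distrib_left sum.distrib[symmetric] sum_subtractf[symmetric]
      by (intro sum.cong refl) (simp add: algebra_simps)
  qed
  also have "\<dots> \<ge> 0" using 1 2 b by (intro mult_nonneg_nonneg) auto
  also have "(\<Sum>i\<in>I. a i * (b * 2 * (l2_inner M (u i) (v i) - l2_inner M (P (u i)) (v i))))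
      = 2 * (\<Sum>i\<in>I. a i * approx_form b (u i) (v i))"
    unfolding sum_distrib_left approx_form_def P_def
    by (intro sum.cong refl) (simp add: L2.diff_left uL vL res_L2 b)
  finally show ?thesis by simp
qed

text \<open>Limit of the approximate inequality as b tends to infinity. From here on, an inequality
  between energies of core functions reduces to two elementary inequalities between real
  numbers.\<close>

lemma form_sum_nonneg:
  fixes u v :: "'i \<Rightarrow> 'a \<Rightarrow> real" and a :: "'i \<Rightarrow> real"
  assumes I: "finite I"
    and u: "\<And>i. i \<in> I \<Longrightarrow> u i \<in> core" and v: "\<And>i. i \<in> I \<Longrightarrow> v i \<in> core"
    and jump: "\<And>x y. 0 \<le> (\<Sum>i\<in>I. a i * ((u i x - u i y) * (v i x - v i y)))"
    and kill: "\<And>x. 0 \<le> (\<Sum>i\<in>I. a i * (u i x * v i x))"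
  shows "0 \<le> (\<Sum>i\<in>I. a i * E (u i) (v i))"
proof (rule LIMSEQ_le_const)
  show "(\<lambda>n. \<Sum>i\<in>I. a i * approx_form (real (Suc n)) (u i) (v i)) \<longlonglongrightarrow> (\<Sum>i\<in>I. a i * E (u i) (v i))"
    using u v by (intro tendsto_sum tendsto_mult tendsto_const approx_form_tendsto) auto
  show "\<exists>N. \<forall>n\<ge>N. 0 \<le> (\<Sum>i\<in>I. a i * approx_form (real (Suc n)) (u i) (v i))"
    using u v by (intro exI[of _ 0] allI impI approx_form_sum_nonneg I jump kill) auto
qed

lemma form_nonneg3:
  assumes c: "u \<in> core" "v \<in> core" "u' \<in> core" "v' \<in> core" "u'' \<in> core" "v'' \<in> core"
    and jump: "\<And>x y. 0 \<le> a * ((u x - u y) * (v x - v y)) + a' * ((u' x - u' y) * (v' x - v' y))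
      + a'' * ((u'' x - u'' y) * (v'' x - v'' y))"
    and kill: "\<And>x. 0 \<le> a * (u x * v x) + a' * (u' x * v' x) + a'' * (u'' x * v'' x)"
  shows "0 \<le> a * E u v + a' * E u' v' + a'' * E u'' v''"
proof -
  have "0 \<le> (\<Sum>i\<in>{0, 1, 2::nat}. (if i = 0 then a else if i = 1 then a' else a'') *
      E (if i = 0 then u else if i = 1 then u' else u'') (if i = 0 then v else if i = 1 then v' else v''))"
    by (rule form_sum_nonneg) (use c jump kill in \<open>auto simp: add.assoc\<close>)
  then show ?thesis by simp
qed

subsection \<open>Normal contractions and products\<close>

text \<open>As w is not yet known to lie in D, the comparison is made for the approximating forms,
  which accept every function of C0. Their boundedness then gives both membership and the energy
  bound.\<close>

lemma contraction_mem:
  assumes w: "w \<in> C0" and u: "u \<in> core"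
    and jump: "\<And>x y. \<bar>w x - w y\<bar> \<le> L * \<bar>u x - u y\<bar>" and kill: "\<And>x. \<bar>w x\<bar> \<le> L * \<bar>u x\<bar>"
  shows "w \<in> core" and "E w w \<le> L\<^sup>2 * E u u"
proof -
  have jump2: "0 \<le> L\<^sup>2 * ((u x - u y) * (u x - u y)) + - 1 * ((w x - w y) * (w x - w y))" for x y
    using power_mono[OF jump[of x y], of 2] unfolding power_mult_distrib power2_abs by (simp add: power2_eq_square)
  have kill2: "0 \<le> L\<^sup>2 * (u x * u x) + - 1 * (w x * w x)" for x
    using power_mono[OF kill[of x], of 2] unfolding power_mult_distrib power2_abs by (simp add: power2_eq_square)
  have "approx_form (real (Suc n)) w w \<le> L\<^sup>2 * E u u" for n
  proof -
    have "0 \<le> (\<Sum>i\<in>{0, 1::nat}. (if i = 0 then L\<^sup>2 else - 1) *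
        approx_form (real (Suc n)) (if i = 0 then u else w) (if i = 0 then u else w))"
      by (rule approx_form_sum_nonneg) (use w u jump2 kill2 in \<open>auto\<close>)
    then have "approx_form (real (Suc n)) w w \<le> L\<^sup>2 * approx_form (real (Suc n)) u u"
      by simp
    also have "\<dots> \<le> L\<^sup>2 * E u u"
      using u by (intro mult_left_mono approx_form_le) auto
    finally show ?thesis .
  qed
  from approx_form_bounded_mem[OF C0_L2[OF w] this] w
  show "w \<in> core" "E w w \<le> L\<^sup>2 * E u u" by auto
qed

lemma core_zero: "(\<lambda>x. 0) \<in> core"
  using C0_zero zero_mem by auto

lemma core_lin: "u \<in> core \<Longrightarrow> v \<in> core \<Longrightarrow> (\<lambda>x. a * u x + b * v x) \<in> core"
  by (auto intro: C0_lin lin_mem)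

lemma core_add: "u \<in> core \<Longrightarrow> v \<in> core \<Longrightarrow> (\<lambda>x. u x + v x) \<in> core"
  using core_lin[of u v 1 1] by simp

lemma core_diff: "u \<in> core \<Longrightarrow> v \<in> core \<Longrightarrow> (\<lambda>x. u x - v x) \<in> core"
  using core_lin[of u v 1 "-1"] by simp

lemma core_scale: "u \<in> core \<Longrightarrow> (\<lambda>x. a * u x) \<in> core"
  using core_lin[of u u a 0] by simp

lemma core_compose:
  assumes u: "u \<in> core" and G: "continuous_on UNIV G" "G 0 = 0"
    and L: "\<And>x y. \<bar>G x - G y\<bar> \<le> L * \<bar>x - y\<bar>"
  shows "(\<lambda>x. G (u x)) \<in> core" and "E (\<lambda>x. G (u x)) (\<lambda>x. G (u x)) \<le> L\<^sup>2 * E u u"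
proof -
  have "(\<lambda>x. G (u x)) \<in> C0" using C0_compose[of u G] u G by blast
  from contraction_mem[OF this u L] L[of _ 0] G(2)
  show "(\<lambda>x. G (u x)) \<in> core" "E (\<lambda>x. G (u x)) (\<lambda>x. G (u x)) \<le> L\<^sup>2 * E u u" by simp_all
qed

lemma core_square:
  assumes u: "u \<in> core"
  shows "(\<lambda>x. u x * u x) \<in> core"
proof -
  obtain B where B: "B > 0" "\<And>x. \<bar>u x\<bar> \<le> B" using C0_bounded u by blast
  show ?thesis
  proof (rule contraction_mem(1))
    show "(\<lambda>x. u x * u x) \<in> C0" using u by (intro C0_mult C0_continuous) auto
    fix x y
    have "\<bar>u x * u x - u y * u y\<bar> = \<bar>u x + u y\<bar> * \<bar>u x - u y\<bar>"
      by (simp add: abs_mult[symmetric] algebra_simps)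
    also have "\<dots> \<le> (2 * B) * \<bar>u x - u y\<bar>"
      using B(2)[of x] B(2)[of y] by (intro mult_right_mono) auto
    finally show "\<bar>u x * u x - u y * u y\<bar> \<le> (2 * B) * \<bar>u x - u y\<bar>" .
    have "\<bar>u x\<bar> * \<bar>u x\<bar> \<le> (2 * B) * \<bar>u x\<bar>"
      using B(2)[of x] B(1) by (intro mult_right_mono) auto
    then show "\<bar>u x * u x\<bar> \<le> (2 * B) * \<bar>u x\<bar>" by (simp add: abs_mult)
  qed (rule u)
qed

lemma core_mult:
  assumes u: "u \<in> core" and v: "v \<in> core"
  shows "(\<lambda>x. u x * v x) \<in> core"
proof -
  have "(\<lambda>x. (1/4) * ((u x + v x) * (u x + v x)) + (-1/4) * ((u x - v x) * (u x - v x))) \<in> core"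
    by (intro core_lin core_square core_add core_diff u v)
  also have "(\<lambda>x. (1/4) * ((u x + v x) * (u x + v x)) + (-1/4) * ((u x - v x) * (u x - v x))) = (\<lambda>x. u x * v x)"
    by (auto simp: fun_eq_iff field_simps)
  finally show ?thesis .
qed

text \<open>Discrete Leibniz rule: the increment of u v is v(x) times that of u plus u(y) times that
  of v, and (a + b)^2 <= 2 a^2 + 2 b^2. It keeps the energy bounded when a function is localised by
  a cutoff.\<close>

lemma core_mult_energy:
  assumes u: "u \<in> core" and v: "v \<in> core" and A: "\<And>x. \<bar>u x\<bar> \<le> A" and B: "\<And>x. \<bar>v x\<bar> \<le> B"
  shows "E (\<lambda>x. u x * v x) (\<lambda>x. u x * v x) \<le> 2 * B\<^sup>2 * E u u + 2 * A\<^sup>2 * E v v"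
proof -
  have "0 \<le> 2 * B\<^sup>2 * E u u + 2 * A\<^sup>2 * E v v + - 1 * E (\<lambda>x. u x * v x) (\<lambda>x. u x * v x)"
  proof (rule form_nonneg3[OF u u v v core_mult[OF u v] core_mult[OF u v]])
    have sq: "(v x)\<^sup>2 \<le> B\<^sup>2" "(u x)\<^sup>2 \<le> A\<^sup>2" for x
      using A[of x] B[of x] by (metis abs_ge_zero power2_abs power_mono)+
    fix x y
    have "(u x * v x - u y * v y)\<^sup>2 = (v x * (u x - u y) + u y * (v x - v y))\<^sup>2"
      by (rule arg_cong[where f = "\<lambda>z. z\<^sup>2"]) (simp add: algebra_simps)
    also have "\<dots> \<le> 2 * (v x * (u x - u y))\<^sup>2 + 2 * (u y * (v x - v y))\<^sup>2"
      using sum_squares_bound[of "v x * (u x - u y)" "u y * (v x - v y)"] by (simp add: power2_sum)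
    also have "\<dots> \<le> 2 * (B\<^sup>2 * (u x - u y)\<^sup>2) + 2 * (A\<^sup>2 * (v x - v y)\<^sup>2)"
      unfolding power_mult_distrib using sq by (intro add_mono mult_left_mono mult_right_mono) auto
    finally show "0 \<le> 2 * B\<^sup>2 * ((u x - u y) * (u x - u y)) + 2 * A\<^sup>2 * ((v x - v y) * (v x - v y))
        + - 1 * ((u x * v x - u y * v y) * (u x * v x - u y * v y))"
      by (simp add: power2_eq_square)
    have "(u x * v x)\<^sup>2 \<le> B\<^sup>2 * (u x)\<^sup>2"
      unfolding power_mult_distrib mult.commute[of "(u x)\<^sup>2"] using sq(1)[of x] by (intro mult_right_mono) auto
    moreover have "0 \<le> A\<^sup>2 * (v x)\<^sup>2" "0 \<le> B\<^sup>2 * (u x)\<^sup>2" by simp_all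
    ultimately have "(u x * v x)\<^sup>2 \<le> 2 * (B\<^sup>2 * (u x)\<^sup>2) + 2 * (A\<^sup>2 * (v x)\<^sup>2)" by linarith
    then show "0 \<le> 2 * B\<^sup>2 * (u x * u x) + 2 * A\<^sup>2 * (v x * v x) + - 1 * (u x * v x * (u x * v x))"
      by (simp add: power2_eq_square)
  qed
  then show ?thesis by simp
qed

lemma core_bump:
  assumes K: "compact K" and U: "open U" and KU: "K \<subseteq> U"
  obtains f where "f \<in> core" "\<And>x. 0 \<le> f x" "\<And>x. f x \<le> 1" "\<And>x. x \<in> K \<Longrightarrow> f x = 1"
    "\<And>x. x \<notin> U \<Longrightarrow> f x = 0"
proof -
  obtain f where f: "f \<in> C0" "\<And>x. x \<in> K \<Longrightarrow> f x = 1" "\<And>x. x \<notin> U \<Longrightarrow> f x = 0"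
    using C0_bump[OF locally_compact K U KU] by metis
  obtain v where v: "v \<in> core" "\<And>x. \<bar>f x - v x\<bar> < 1/4"
    using regular f(1) unfolding regular_form_def by (meson zero_less_divide_1_iff zero_less_numeral)
  \<comment> \<open>G is 0 up to 1/4 and 1 from 3/4 on. Since v is within 1/4 of f, this restores
    the exact values 0 and 1 lost in the uniform approximation.\<close>
  define G where "G t = min (max (2 * t - 1/2) 0) (1::real)" for t
  have G: "continuous_on UNIV G" unfolding G_def by (intro continuous_intros)
  have "(\<lambda>x. G (v x)) \<in> core"
    by (rule core_compose(1)[OF v(1) G, of 2]) (auto simp: G_def min_def max_def abs_if)
  moreover have "G (v x) = 1" if "x \<in> K" for x
    using v(2)[of x] f(2)[OF that] by (auto simp: G_def abs_if split: if_splits)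
  moreover have "G (v x) = 0" if "x \<notin> U" for x
    using v(2)[of x] f(3)[OF that] by (auto simp: G_def abs_if split: if_splits)
  moreover have "0 \<le> G t" "G t \<le> 1" for t by (auto simp: G_def)
  ultimately show thesis using that[of "\<lambda>x. G (v x)"] by blast
qed

end

section \<open>Representation of bounded positive functionals by measures\<close>

text \<open>Setting for a Riesz representation of a functional known only on an algebra C inside C0,
  such as the core. Stability under Lipschitz functions and the supply of bumps in C do the work of
  arbitrary continuous functions; the constant \<open>B\<close> will bound the total mass.\<close>

locale positive_functional =
  fixes C :: "('a::{metric_space, second_countable_topology} \<Rightarrow> real) set" and \<Lambda> :: "('a \<Rightarrow> real) \<Rightarrow> real"
    and B :: real
  assumes locally_compact: "locally_compact_space (euclidean :: 'a topology)"
    and C_C0: "C \<subseteq> C0"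
    and C_lin: "f \<in> C \<Longrightarrow> g \<in> C \<Longrightarrow> (\<lambda>x. a * f x + b * g x) \<in> C"
    and C_mult: "f \<in> C \<Longrightarrow> g \<in> C \<Longrightarrow> (\<lambda>x. f x * g x) \<in> C"
    and C_compose: "f \<in> C \<Longrightarrow> G 0 = 0 \<Longrightarrow> (\<And>s t. \<bar>G s - G t\<bar> \<le> L * \<bar>s - t\<bar>) \<Longrightarrow> (\<lambda>x. G (f x)) \<in> C"
    and C_bump: "compact K \<Longrightarrow> open U \<Longrightarrow> K \<subseteq> U \<Longrightarrow>
      \<exists>f\<in>C. (\<forall>x. 0 \<le> f x \<and> f x \<le> 1) \<and> (\<forall>x\<in>K. f x = 1) \<and> (\<forall>x. x \<notin> U \<longrightarrow> f x = 0)"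
    and \<Lambda>_lin: "f \<in> C \<Longrightarrow> g \<in> C \<Longrightarrow> \<Lambda> (\<lambda>x. a * f x + b * g x) = a * \<Lambda> f + b * \<Lambda> g"
    and \<Lambda>_nonneg: "f \<in> C \<Longrightarrow> (\<And>x. 0 \<le> f x) \<Longrightarrow> 0 \<le> \<Lambda> f"
    and \<Lambda>_bound: "f \<in> C \<Longrightarrow> (\<And>x. \<bar>f x\<bar> \<le> c) \<Longrightarrow> \<bar>\<Lambda> f\<bar> \<le> B * c"
begin

lemma C_ne: "C \<noteq> {}"
  using C_bump[of "{}" "{}"] by auto

lemma C_scale: "f \<in> C \<Longrightarrow> (\<lambda>x. a * f x) \<in> C"
  using C_lin[of f f a 0] by simp

lemma C_zero: "(\<lambda>x. 0) \<in> C"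
proof -
  obtain f where "f \<in> C" using C_ne by blast
  from C_scale[OF this, of 0] show ?thesis by simp
qed

lemma C_add: "f \<in> C \<Longrightarrow> g \<in> C \<Longrightarrow> (\<lambda>x. f x + g x) \<in> C"
  using C_lin[of f g 1 1] by simp

lemma C_diff: "f \<in> C \<Longrightarrow> g \<in> C \<Longrightarrow> (\<lambda>x. f x - g x) \<in> C"
  using C_lin[of f g 1 "-1"] by simp

lemma \<Lambda>_add: "f \<in> C \<Longrightarrow> g \<in> C \<Longrightarrow> \<Lambda> (\<lambda>x. f x + g x) = \<Lambda> f + \<Lambda> g"
  using \<Lambda>_lin[of f g 1 1] by simp

lemma \<Lambda>_diff: "f \<in> C \<Longrightarrow> g \<in> C \<Longrightarrow> \<Lambda> (\<lambda>x. f x - g x) = \<Lambda> f - \<Lambda> g"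
  using \<Lambda>_lin[of f g 1 "-1"] by simp

lemma \<Lambda>_scale: "f \<in> C \<Longrightarrow> \<Lambda> (\<lambda>x. a * f x) = a * \<Lambda> f"
  using \<Lambda>_lin[of f f a 0] by simp

lemma \<Lambda>_zero: "\<Lambda> (\<lambda>x. 0) = 0"
  using \<Lambda>_diff[OF C_zero C_zero] by simp

lemma C_sum: "(\<And>i. i \<in> I \<Longrightarrow> f i \<in> C) \<Longrightarrow> (\<lambda>x. \<Sum>i\<in>I. f i x) \<in> C"
  by (induction I rule: infinite_finite_induct) (simp_all add: C_zero C_add)

lemma \<Lambda>_sum: "(\<And>i. i \<in> I \<Longrightarrow> f i \<in> C) \<Longrightarrow> \<Lambda> (\<lambda>x. \<Sum>i\<in>I. f i x) = (\<Sum>i\<in>I. \<Lambda> (f i))"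
  by (induction I rule: infinite_finite_induct) (simp_all add: \<Lambda>_zero \<Lambda>_add C_sum)

lemma \<Lambda>_mono: "f \<in> C \<Longrightarrow> g \<in> C \<Longrightarrow> (\<And>x. f x \<le> g x) \<Longrightarrow> \<Lambda> f \<le> \<Lambda> g"
  using \<Lambda>_nonneg[OF C_diff[of g f]] \<Lambda>_diff[of g f] by simp

text \<open>Daniell-type covers: sets are covered by countable sums of nonnegative functions in C,
  to which the functional applies directly. The sums are taken in \<open>ennreal\<close> because
  they may diverge.\<close>

definition covers :: "'a set \<Rightarrow> (nat \<Rightarrow> 'a \<Rightarrow> real) set" where
  "covers A = {h. (\<forall>i. h i \<in> C) \<and> (\<forall>i x. 0 \<le> h i x) \<and> (\<forall>x\<in>A. 1 \<le> (\<Sum>i. ennreal (h i x)))}"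

definition outer :: "'a set \<Rightarrow> ennreal" where
  "outer A = (INF h\<in>covers A. \<Sum>i. ennreal (\<Lambda> (h i)))"

lemma coversD:
  assumes "h \<in> covers A"
  shows "h i \<in> C" "0 \<le> h i x" "x \<in> A \<Longrightarrow> 1 \<le> (\<Sum>i. ennreal (h i x))" "0 \<le> \<Lambda> (h i)"
  using assms by (auto simp: covers_def intro!: \<Lambda>_nonneg)

lemma outer_le: "h \<in> covers A \<Longrightarrow> outer A \<le> (\<Sum>i. ennreal (\<Lambda> (h i)))"
  unfolding outer_def by (rule INF_lower)

lemma outer_empty: "outer {} = 0"
proof -
  have "(\<lambda>_ _. 0) \<in> covers {}" by (simp add: covers_def C_zero)
  from outer_le[OF this] show ?thesis by (simp add: \<Lambda>_zero)
qed

lemma outer_mono: "A \<subseteq> A' \<Longrightarrow> outer A \<le> outer A'"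
  unfolding outer_def by (rule INF_superset_mono) (auto simp: covers_def)

text \<open>Doubly indexed families are admissible covers after re-enumeration by the pairing
  function. Both subadditivity and the splitting of covers produce such families.\<close>

lemma outer_le_family:
  fixes h :: "nat \<Rightarrow> nat \<Rightarrow> 'a \<Rightarrow> real"
  assumes h: "\<And>i k. h i k \<in> C" and nn: "\<And>i k x. 0 \<le> h i k x"
    and cover: "\<And>x. x \<in> A \<Longrightarrow> 1 \<le> (\<Sum>i. \<Sum>k. ennreal (h i k x))"
  shows "outer A \<le> (\<Sum>i. \<Sum>k. ennreal (\<Lambda> (h i k)))"
proof -
  define H where "H n = h (fst (prod_decode n)) (snd (prod_decode n))" for n
  have s: "(\<Sum>n. f (fst (prod_decode n)) (snd (prod_decode n))) = (\<Sum>i. \<Sum>k. f i k)" for f :: "nat \<Rightarrow> nat \<Rightarrow> ennreal"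
    using suminf_ennreal_2dimen[of "\<lambda>i. \<Sum>k. f i k" "\<lambda>p. f (fst p) (snd p)"] by simp
  have "H \<in> covers A"
    unfolding covers_def H_def using h nn cover s[of "\<lambda>i k. ennreal (h i k x)" for x] by auto
  from outer_le[OF this] show ?thesis
    unfolding H_def using s[of "\<lambda>i k. ennreal (\<Lambda> (h i k))"] by simp
qed

lemma outer_countably_subadditive: "outer (\<Union>n. A n) \<le> (\<Sum>n. outer (A n))"
proof (rule ennreal_le_epsilon)
  fix e :: real assume e: "0 < e" and fin: "(\<Sum>n. outer (A n)) < top"
  have "\<exists>h\<in>covers (A n). (\<Sum>i. ennreal (\<Lambda> (h i))) < outer (A n) + ennreal (e * (1/2) ^ Suc n)" for n
  proof (rule INF_approx_ennreal[OF _ outer_def])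
    show "outer (A n) \<noteq> \<infinity>" using fin ennreal_suminf_lessD[OF fin, of n] by auto
  qed (use e in simp)
  then obtain h where h: "\<And>n. h n \<in> covers (A n)"
    "\<And>n. (\<Sum>i. ennreal (\<Lambda> (h n i))) < outer (A n) + ennreal (e * (1/2) ^ Suc n)" by metis
  have "outer (\<Union>n. A n) \<le> (\<Sum>n. \<Sum>i. ennreal (\<Lambda> (h n i)))"
  proof (rule outer_le_family)
    fix x assume "x \<in> (\<Union>n. A n)"
    then obtain n where "x \<in> A n" by blast
    then have "1 \<le> (\<Sum>k. ennreal (h n k x))" by (rule coversD(3)[OF h(1)])
    also have "\<dots> = (\<Sum>i\<in>{n}. \<Sum>k. ennreal (h i k x))" by simp
    also have "\<dots> \<le> (\<Sum>i. \<Sum>k. ennreal (h i k x))" by (rule sum_le_suminf) auto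
    finally show "1 \<le> (\<Sum>i. \<Sum>k. ennreal (h i k x))" .
  qed (use coversD[OF h(1)] in auto)
  also have "\<dots> \<le> (\<Sum>n. outer (A n) + ennreal (e * (1/2) ^ Suc n))"
    using h(2) by (intro suminf_le less_imp_le) auto
  also have "\<dots> = (\<Sum>n. outer (A n)) + (\<Sum>n. ennreal (e * (1/2) ^ Suc n))"
    by (subst suminf_add[symmetric]) auto
  also have "(\<Sum>n. ennreal (e * (1/2) ^ Suc n)) = ennreal e"
  proof (rule suminf_ennreal_eq)
    show "(\<lambda>n. e * (1/2) ^ Suc n) sums e" using sums_mult[OF power_half_series, of e] by simp
  qed (use e in simp)
  finally show "outer (\<Union>n. A n) \<le> (\<Sum>n. outer (A n)) + ennreal e" .
qed

lemma outer_measure_space_outer: "outer_measure_space (Pow UNIV) outer"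
  unfolding outer_measure_space_def positive_def increasing_def countably_subadditive_def
  using outer_empty outer_mono outer_countably_subadditive by auto

text \<open>
  A cover \<open>h\<close> of \<open>A\<close> splits as \<open>h = h \<phi>\<^sub>k + h (1 - \<phi>\<^sub>k)\<close> with \<open>\<phi>\<^sub>k = min 1 (k \<phi>)\<close> increasing to the
  indicator of \<open>{\<phi> > 0}\<close>; the increments \<open>h (\<phi>\<^sub>k\<^sub>+\<^sub>1 - \<phi>\<^sub>k)\<close> form a cover of \<open>A \<inter> {\<phi> > 0}\<close>.
\<close>

lemma superlevel_lambda_system:
  assumes \<phi>: "\<phi> \<in> C" and \<phi>0: "\<And>x. 0 \<le> \<phi> x"
  shows "{x. 0 < \<phi> x} \<in> lambda_system UNIV (Pow UNIV) outer"
proof -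
  let ?P = "{x. 0 < \<phi> x}"
  define p where "p k x = min 1 (real k * \<phi> x)" for k x
  have p: "p k \<in> C" for k
  proof -
    have "(\<lambda>x. (\<lambda>t. min 1 (real k * t)) (\<phi> x)) \<in> C"
    proof (rule C_compose[OF \<phi>, of _ "real k"])
      fix s t :: real
      have "\<bar>min 1 (real k * s) - min 1 (real k * t)\<bar> \<le> \<bar>real k * s - real k * t\<bar>" by (auto simp: min_def)
      also have "\<dots> = real k * \<bar>s - t\<bar>" by (simp add: right_diff_distrib[symmetric] abs_mult)
      finally show "\<bar>min 1 (real k * s) - min 1 (real k * t)\<bar> \<le> real k * \<bar>s - t\<bar>" .
    qed simp
    then show ?thesis by (simp add: p_def[abs_def])
  qed
  have p01: "0 \<le> p k x" "p k x \<le> 1" for k x using \<phi>0[of x] by (auto simp: p_def)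
  have pinc: "p k x \<le> p (Suc k) x" for k x
    unfolding p_def by (intro min.mono mult_right_mono order_refl \<phi>0) simp
  have p0: "p k x = 0" if "x \<notin> ?P" for k x using that \<phi>0[of x] by (auto simp: p_def not_less)
  have plim: "(\<lambda>k. p k x) \<longlonglongrightarrow> 1" if "x \<in> ?P" for x
  proof (rule tendsto_eventually)
    obtain N where N: "1 / \<phi> x < real N" using reals_Archimedean2 by blast
    show "\<forall>\<^sub>F k in sequentially. p k x = 1"
      unfolding eventually_sequentially
    proof (intro exI allI impI)
      fix k assume "N \<le> k"
      then have "1 / \<phi> x < real k" using N by (meson less_le_trans of_nat_mono)
      then have "1 < real k * \<phi> x" using that by (simp add: field_simps)
      then show "p k x = 1" by (simp add: p_def)
    qed
  qed
  have le: "outer (?P \<inter> A) + outer ((UNIV - ?P) \<inter> A) \<le> outer A" for A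
  proof -
    have "outer (?P \<inter> A) + outer ((UNIV - ?P) \<inter> A) \<le> (\<Sum>i. ennreal (\<Lambda> (h i)))" if h: "h \<in> covers A" for h
    proof -
      note hC = coversD(1)[OF h] and h0 = coversD(2)[OF h]
      define g where "g i k x = h i x * p (Suc k) x - h i x * p k x" for i k x
      have gC: "g i k \<in> C" for i k unfolding g_def by (intro C_diff C_mult hC p)
      have g0: "0 \<le> g i k x" for i k x
        using pinc[of k x] h0[of i x] by (simp add: g_def mult_left_mono)
      have "outer (?P \<inter> A) \<le> (\<Sum>i. \<Sum>k. ennreal (\<Lambda> (g i k)))"
      proof (rule outer_le_family[OF gC g0])
        fix x assume x: "x \<in> ?P \<inter> A"
        have "(\<Sum>k. ennreal (g i k x)) = ennreal (h i x)" for i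
        proof (rule suminf_ennreal_eq[OF g0])
          have "(\<lambda>k. h i x * p k x) \<longlonglongrightarrow> h i x * 1" using x by (intro tendsto_mult tendsto_const plim) auto
          from telescope_sums[OF this] show "(\<lambda>k. g i k x) sums h i x" by (simp add: g_def p_def)
        qed
        then show "1 \<le> (\<Sum>i. \<Sum>k. ennreal (g i k x))" using coversD(3)[OF h] x by simp
      qed
      also have "\<dots> = (\<Sum>i. SUP k. ennreal (\<Lambda> (\<lambda>x. h i x * p k x)))"
      proof (rule arg_cong[where f = suminf], rule ext)
        fix i
        have "(\<Sum>k<n. \<Lambda> (g i k)) = \<Lambda> (\<lambda>x. h i x * p n x)" for n
        proof -
          have "\<Lambda> (g i k) = \<Lambda> (\<lambda>x. h i x * p (Suc k) x) - \<Lambda> (\<lambda>x. h i x * p k x)" for k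
            unfolding g_def by (intro \<Lambda>_diff C_mult hC p)
          then have "(\<Sum>k<n. \<Lambda> (g i k)) = \<Lambda> (\<lambda>x. h i x * p n x) - \<Lambda> (\<lambda>x. h i x * p 0 x)"
            using sum_lessThan_telescope[of "\<lambda>k. \<Lambda> (\<lambda>x. h i x * p k x)" n] by simp
          moreover have "(\<lambda>x. h i x * p 0 x) = (\<lambda>x. 0)" by (simp add: p_def)
          ultimately show ?thesis by (simp add: \<Lambda>_zero)
        qed
        then show "(\<Sum>k. ennreal (\<Lambda> (g i k))) = (SUP k. ennreal (\<Lambda> (\<lambda>x. h i x * p k x)))"
          by (simp add: suminf_eq_SUP sum_ennreal \<Lambda>_nonneg gC g0)
      qed
      \<comment> \<open>Monotone convergence for series: the values increase with k because p k
        does. One k can then serve all members of the cover at once.\<close>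
      also have "\<dots> = (SUP k. \<Sum>i. ennreal (\<Lambda> (\<lambda>x. h i x * p k x)))"
        by (intro ennreal_suminf_SUP_eq incseq_SucI ennreal_leI \<Lambda>_mono C_mult hC p mult_left_mono pinc h0)
      finally have 1: "outer (?P \<inter> A) \<le> (SUP k. \<Sum>i. ennreal (\<Lambda> (\<lambda>x. h i x * p k x)))" .
      have 2: "(\<Sum>i. ennreal (\<Lambda> (\<lambda>x. h i x * p k x))) + outer ((UNIV - ?P) \<inter> A) \<le> (\<Sum>i. ennreal (\<Lambda> (h i)))" for k
      proof -
        define q where "q i x = h i x - h i x * p k x" for i x
        have qC: "q i \<in> C" for i unfolding q_def by (intro C_diff C_mult hC p)
        have q0: "0 \<le> q i x" for i x
          using p01(2)[of k x] h0[of i x] by (simp add: q_def mult_left_le)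
        have "q \<in> covers ((UNIV - ?P) \<inter> A)"
          unfolding covers_def using qC q0 coversD(3)[OF h] p0 by (auto simp: q_def)
        then have "outer ((UNIV - ?P) \<inter> A) \<le> (\<Sum>i. ennreal (\<Lambda> (q i)))" by (rule outer_le)
        moreover have "(\<Sum>i. ennreal (\<Lambda> (h i))) = (\<Sum>i. ennreal (\<Lambda> (\<lambda>x. h i x * p k x)) + ennreal (\<Lambda> (q i)))"
        proof (intro arg_cong[where f = suminf] ext)
          fix i
          have "h i = (\<lambda>x. h i x * p k x + q i x)" by (simp add: q_def)
          then have "\<Lambda> (h i) = \<Lambda> (\<lambda>x. h i x * p k x + q i x)" by simp
          also have "\<dots> = \<Lambda> (\<lambda>x. h i x * p k x) + \<Lambda> (q i)"
            by (intro \<Lambda>_add C_mult hC p qC)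
          finally show "ennreal (\<Lambda> (h i)) = ennreal (\<Lambda> (\<lambda>x. h i x * p k x)) + ennreal (\<Lambda> (q i))"
            by (simp add: ennreal_plus \<Lambda>_nonneg C_mult hC p h0 p01 qC q0)
        qed
        moreover have "\<dots> = (\<Sum>i. ennreal (\<Lambda> (\<lambda>x. h i x * p k x))) + (\<Sum>i. ennreal (\<Lambda> (q i)))"
          by (subst suminf_add[symmetric]) auto
        ultimately show ?thesis by (simp add: add_left_mono)
      qed
      have "outer (?P \<inter> A) + outer ((UNIV - ?P) \<inter> A)
          \<le> (SUP k. \<Sum>i. ennreal (\<Lambda> (\<lambda>x. h i x * p k x))) + outer ((UNIV - ?P) \<inter> A)"
        using 1 by (rule add_right_mono)
      also have "\<dots> = (SUP k. (\<Sum>i. ennreal (\<Lambda> (\<lambda>x. h i x * p k x))) + outer ((UNIV - ?P) \<inter> A))"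
        by (rule ennreal_SUP_add_left[symmetric]) simp
      also have "\<dots> \<le> (\<Sum>i. ennreal (\<Lambda> (h i)))" by (rule SUP_least) (rule 2)
      finally show ?thesis .
    qed
    then show ?thesis unfolding outer_def[of A] by (intro INF_greatest)
  qed
  have ge: "outer A \<le> outer (?P \<inter> A) + outer ((UNIV - ?P) \<inter> A)" for A
  proof -
    define F where "F n = (if n = 0 then ?P \<inter> A else if n = 1 then (UNIV - ?P) \<inter> A else {})" for n :: nat
    have "A = (\<Union>n. F n)"
    proof -
      have "?P \<inter> A = F 0" "(UNIV - ?P) \<inter> A = F 1" by (simp_all add: F_def)
      then have "A \<subseteq> F 0 \<union> F 1" by blast
      moreover have "F n \<subseteq> A" for n by (auto simp: F_def)
      ultimately show ?thesis by (intro equalityI UN_least) (simp_all, blast)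
    qed
    then have "outer A \<le> (\<Sum>n. outer (F n))" using outer_countably_subadditive[of F] by simp
    also have "\<dots> = (\<Sum>n\<in>{0, 1}. outer (F n))"
      by (rule suminf_finite) (auto simp: F_def outer_empty)
    finally show ?thesis by (simp add: F_def)
  qed
  show ?thesis
    unfolding lambda_system_def using le ge by (auto intro!: antisym)
qed

text \<open>A bump at each point of U, and Lindelof to keep countably many. With the superlevel sets
  already measurable for the outer measure, all Borel sets become so.\<close>

lemma open_Union_superlevel:
  assumes U: "open U"
  shows "\<exists>\<phi> :: nat \<Rightarrow> 'a \<Rightarrow> real. (\<forall>n. \<phi> n \<in> C \<and> (\<forall>x. 0 \<le> \<phi> n x)) \<and> U = (\<Union>n. {x. 0 < \<phi> n x})"
proof -
  have "\<exists>f. f \<in> C \<and> (\<forall>x. 0 \<le> f x) \<and> 0 < f z \<and> {x. 0 < f x} \<subseteq> U" if "z \<in> U" for z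
    using C_bump[of "{z}" U] U that by force
  then obtain f where f: "\<And>z. z \<in> U \<Longrightarrow> f z \<in> C" "\<And>z x. z \<in> U \<Longrightarrow> 0 \<le> f z x"
    "\<And>z. z \<in> U \<Longrightarrow> 0 < f z z" "\<And>z. z \<in> U \<Longrightarrow> {x. 0 < f z x} \<subseteq> U" by metis
  have op: "open {x. 0 < f z x}" if "z \<in> U" for z
  proof -
    have "f z \<in> C0" using f(1)[OF that] C_C0 by blast
    then show ?thesis
      by (intro open_Collect_less continuous_on_const C0_continuous)
  qed
  define FF where "FF = (\<lambda>z. {x. 0 < f z x}) ` U"
  obtain F' where F': "F' \<subseteq> FF" "countable F'" "\<Union>F' = \<Union>FF"
    using Lindelof[of FF] op by (auto simp: FF_def)
  have UFF: "\<Union>FF = U" using f(3,4) by (auto simp: FF_def)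
  show ?thesis
  proof (cases "U = {}")
    case True
    then show ?thesis by (intro exI[of _ "\<lambda>_ _. 0"]) (simp add: C_zero)
  next
    case False
    then have "F' \<noteq> {}" using F'(3) UFF by auto
    define V where "V = from_nat_into F'"
    have rV: "range V = F'" unfolding V_def by (rule range_from_nat_into[OF \<open>F' \<noteq> {}\<close> F'(2)])
    have "\<exists>z\<in>U. V n = {x. 0 < f z x}" for n
      using rV F'(1) by (auto simp: FF_def)
    then obtain z where z: "\<And>n. z n \<in> U" "\<And>n. V n = {x. 0 < f (z n) x}" by metis
    have "U = (\<Union>n. V n)" using rV F'(3) UFF by simp
    then show ?thesis using z f(1,2) by (intro exI[of _ "\<lambda>n. f (z n)"]) auto
  qed
qed

lemma borel_measure_space: "measure_space UNIV (sets borel) outer"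
proof -
  let ?L = "lambda_system UNIV (Pow UNIV) outer"
  have ms: "measure_space UNIV ?L outer"
    by (rule sigma_algebra.caratheodory_lemma[OF sigma_algebra_Pow outer_measure_space_outer])
  then have sa: "sigma_algebra UNIV ?L" by (simp add: measure_space_def)
  interpret L: sigma_algebra UNIV ?L by (rule sa)
  have "U \<in> ?L" if oU: "open U" for U :: "'a set"
  proof -
    obtain \<phi> :: "nat \<Rightarrow> 'a \<Rightarrow> real" where \<phi>: "\<forall>n. \<phi> n \<in> C \<and> (\<forall>x. 0 \<le> \<phi> n x)"
      and U: "U = (\<Union>n. {x. 0 < \<phi> n x})"
      using open_Union_superlevel[OF oU] by (elim exE conjE)
    have "{x. 0 < \<phi> n x} \<in> ?L" for n using \<phi> by (intro superlevel_lambda_system) auto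
    then show ?thesis unfolding U by (intro L.countable_nat_UN) auto
  qed
  then have "sigma_sets UNIV (Collect open) \<subseteq> ?L"
    by (intro L.sigma_sets_subset) auto
  then have "sets (borel :: 'a measure) \<subseteq> ?L" by (simp add: sets_borel)
  then show ?thesis
    using sets.sigma_algebra_axioms[of "borel :: 'a measure"] by (intro measure_down[OF ms]) auto
qed

section \<open>The representing measure and its integrals\<close>

definition rep :: "'a measure" where
  "rep = measure_of UNIV (sets borel) outer"

lemma sets_rep: "sets rep = sets borel"
  unfolding rep_def using sets.sigma_sets_eq[of "borel :: 'a measure"] by (simp add: sets_measure_of_conv)

lemma space_rep: "space rep = UNIV"
  unfolding rep_def by (simp add: space_measure_of_conv)

lemma emeasure_rep: "A \<in> sets borel \<Longrightarrow> emeasure rep A = outer A"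
  unfolding rep_def using borel_measure_space
  by (intro emeasure_measure_of_sigma) (auto simp: measure_space_def)

lemma outer_le_functional:
  assumes f: "f \<in> C" "\<And>x. 0 \<le> f x" "\<And>x. x \<in> A \<Longrightarrow> 1 \<le> f x"
  shows "outer A \<le> ennreal (\<Lambda> f)"
proof -
  have "(\<lambda>i. if i = 0 then f else (\<lambda>x. 0)) \<in> covers A"
  proof -
    have "(\<Sum>i. ennreal ((if i = 0 then f else (\<lambda>x. 0)) x)) = ennreal (f x)" for x
      by (subst suminf_finite[of "{0::nat}"]) auto
    then show ?thesis using f by (auto simp: covers_def C_zero)
  qed
  from outer_le[OF this] have "outer A \<le> (\<Sum>i. ennreal (\<Lambda> (if i = 0 then f else (\<lambda>x. 0))))" .
  also have "\<dots> = ennreal (\<Lambda> f)" by (subst suminf_finite[of "{0::nat}"]) (auto simp: \<Lambda>_zero)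
  finally show ?thesis .
qed

text \<open>Dini's theorem on the compact support of \<open>f\<close>.\<close>

lemma functional_le_outer:
  assumes f: "f \<in> C" and f0: "\<And>x. 0 \<le> f x" and f1: "\<And>x. f x \<le> 1" and A: "\<And>x. x \<notin> A \<Longrightarrow> f x = 0"
  shows "ennreal (\<Lambda> f) \<le> outer A"
  unfolding outer_def
proof (rule INF_greatest)
  fix h assume h: "h \<in> covers A"
  note hC = coversD(1)[OF h] and h0 = coversD(2)[OF h]
  have B0: "0 \<le> B" using \<Lambda>_bound[OF C_zero, of 1] by simp
  show "ennreal (\<Lambda> f) \<le> (\<Sum>i. ennreal (\<Lambda> (h i)))"
  proof (rule ennreal_le_epsilon)
    fix e :: real assume e: "0 < e"
    \<comment> \<open>Dividing by B + 1 makes B * d at most e and stays defined when B is 0.\<close>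
    define d where "d = e / (B + 1)"
    have d: "d > 0" "B * d \<le> e" using e B0 by (auto simp: d_def field_simps)
    let ?K = "closure {x. f x \<noteq> 0}"
    define V where "V n = {x. f x < (\<Sum>i<n. h i x) + d}" for n
    have cont: "continuous_on UNIV (h i)" "continuous_on UNIV f" for i
      using C0_continuous hC f C_C0 by auto
    have oV: "open (V n)" for n unfolding V_def
      by (intro open_Collect_less continuous_intros cont)
    have "?K \<subseteq> (\<Union>n. V n)"
    proof
      fix x assume "x \<in> ?K"
      show "x \<in> (\<Union>n. V n)"
      proof (cases "x \<in> A")
        case False then show ?thesis using A d(1) by (auto simp: V_def intro!: exI[of _ 0])
      next
        case True
        have "1 \<le> (\<Sum>i. ennreal (h i x))" by (rule coversD(3)[OF h True])
        moreover have "ennreal (1 - d) < 1" using d(1) by (simp add: ennreal_less_one_iff)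
        ultimately have "ennreal (1 - d) < (\<Sum>i. ennreal (h i x))" by (rule less_le_trans[rotated])
        then have "ennreal (1 - d) < (SUP n. \<Sum>i<n. ennreal (h i x))"
          by (simp add: suminf_eq_SUP)
        then obtain n where "ennreal (1 - d) < (\<Sum>i<n. ennreal (h i x))"
          by (auto simp: less_SUP_iff)
        then have "ennreal (1 - d) < ennreal (\<Sum>i<n. h i x)" by (simp add: sum_ennreal h0)
        then have "1 - d < (\<Sum>i<n. h i x)"
          using sum_nonneg[of "{..<n}" "\<lambda>i. h i x"] h0 by (meson ennreal_leI not_less)
        then have "x \<in> V n" using f1[of x] by (simp add: V_def)
        then show ?thesis by blast
      qed
    qed
    moreover have "compact ?K" using f C_C0 by (auto intro: C0_compact_support)
    ultimately obtain N where N: "finite N" "?K \<subseteq> (\<Union>n\<in>N. V n)"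
      using compactE_image[of ?K UNIV V] oV by (metis)
    define n where "n = Max (insert 0 N)"
    have Vmono: "V i \<subseteq> V n" if "i \<in> N" for i
    proof
      fix x assume x: "x \<in> V i"
      have "i \<le> n" using that N(1) by (auto simp: n_def)
      then have "(\<Sum>j<i. h j x) \<le> (\<Sum>j<n. h j x)" using h0 by (intro sum_mono2) auto
      then show "x \<in> V n" using x by (simp add: V_def)
    qed
    have le: "f x < (\<Sum>i<n. h i x) + d" for x
    proof (cases "x \<in> ?K")
      case True then show ?thesis using N(2) Vmono by (auto simp: V_def)
    next
      case False
      then show ?thesis using C0_outside_support[OF False] d(1) sum_nonneg[of "{..<n}" "\<lambda>i. h i x"] h0 by simp
    qed
    let ?s = "\<lambda>x. \<Sum>i<n. h i x"
    have sC: "?s \<in> C" by (intro C_sum hC)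
    \<comment> \<open>The finite sum dominates f only up to d. The excess g belongs to C and is at
      most d, so by \<open>\<Lambda>_bound\<close> it costs at most B * d.\<close>
    define g where "g x = max 0 (f x - ?s x)" for x
    have gC: "g \<in> C"
      unfolding g_def by (rule C_compose[OF C_diff[OF f sC], of "\<lambda>t. max 0 t" 1, simplified]) (auto simp: max_def)
    have "\<bar>g x\<bar> \<le> d" for x using le[of x] d(1) by (auto simp: g_def)
    then have "\<Lambda> g \<le> B * d" using \<Lambda>_bound[OF gC, of d] by auto
    moreover have "\<Lambda> f \<le> \<Lambda> (\<lambda>x. ?s x + g x)"
      by (intro \<Lambda>_mono f C_add sC gC) (auto simp: g_def)
    moreover have "\<Lambda> (\<lambda>x. ?s x + g x) = (\<Sum>i<n. \<Lambda> (h i)) + \<Lambda> g"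
      by (simp add: \<Lambda>_add sC gC \<Lambda>_sum hC)
    ultimately have "\<Lambda> f \<le> (\<Sum>i<n. \<Lambda> (h i)) + e" using d(2) by linarith
    then have "ennreal (\<Lambda> f) \<le> ennreal ((\<Sum>i<n. \<Lambda> (h i)) + e)" by (rule ennreal_leI)
    also have "\<dots> = (\<Sum>i<n. ennreal (\<Lambda> (h i))) + ennreal e"
      using e coversD(4)[OF h] by (simp add: sum_nonneg sum_ennreal)
    also have "\<dots> \<le> (\<Sum>i. ennreal (\<Lambda> (h i))) + ennreal e"
      by (intro add_right_mono sum_le_suminf) auto
    finally show "ennreal (\<Lambda> f) \<le> (\<Sum>i. ennreal (\<Lambda> (h i))) + ennreal e" .
  qed
qed

lemma finite_measure_rep: "finite_measure rep"
proof (rule finite_measureI)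
  obtain K :: "nat \<Rightarrow> 'a set" where K: "\<And>n. compact (K n)" "incseq K" "(\<Union>n. K n) = UNIV"
    using locally_compact_sigma_compact[OF locally_compact] by blast
  have Kb: "K n \<in> sets borel" for n using K(1) by (intro borel_closed compact_imp_closed)
  have "emeasure rep (K n) \<le> ennreal B" for n
  proof -
    obtain f where f: "f \<in> C" "\<And>x. 0 \<le> f x" "\<And>x. f x \<le> 1" "\<And>x. x \<in> K n \<Longrightarrow> f x = 1"
      using C_bump[OF K(1), of UNIV n] by auto
    have "emeasure rep (K n) \<le> ennreal (\<Lambda> f)"
      unfolding emeasure_rep[OF Kb] by (rule outer_le_functional) (use f in auto)
    also have "\<Lambda> f \<le> B" using \<Lambda>_bound[OF f(1), of 1] f(2,3) by (auto simp: abs_le_iff)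
    finally show ?thesis by (simp add: ennreal_leI)
  qed
  moreover have "(SUP n. emeasure rep (K n)) = emeasure rep UNIV"
    using SUP_emeasure_incseq[of K rep] Kb K by (auto simp: sets_rep)
  ultimately have "emeasure rep UNIV \<le> ennreal B" by (metis SUP_least)
  then show "emeasure rep (space rep) \<noteq> \<infinity>" by (auto simp: space_rep top_unique)
qed

lemma C_measurable: "f \<in> C \<Longrightarrow> f \<in> borel_measurable rep"
  using C_C0 C0_measurable measurable_cong_sets[OF sets_rep refl] by blast

lemma C_integrable:
  assumes f: "f \<in> C" shows "integrable rep f"
proof -
  interpret finite_measure rep by (rule finite_measure_rep)
  obtain K where "\<And>x. \<bar>f x\<bar> \<le> K" using C0_bounded[of f] f C_C0 by blast
  then show ?thesis by (intro integrable_const_bound[of _ K] C_measurable f) auto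
qed

text \<open>Horizontal slicing: f is a sum of slices s k of height r above the level r k. Both the
  functional and the integral of s k lie between r d(k+1) and r d(k), where d k is the mass of {f >
  r k}; the discrepancies telescope to at most r times the total mass.\<close>

lemma rep_integral_nonneg:
  assumes f: "f \<in> C" and f0: "\<And>x. 0 \<le> f x"
  shows "(\<integral>x. f x \<partial>rep) = \<Lambda> f"
proof -
  interpret finite_measure rep by (rule finite_measure_rep)
  have fC: "continuous_on UNIV f" using f C_C0 C0_continuous by auto
  obtain K where K: "K > 0" "\<And>x. \<bar>f x\<bar> \<le> K" using C0_bounded[of f] f C_C0 by blast
  have est: "\<bar>(\<integral>x. f x \<partial>rep) - \<Lambda> f\<bar> \<le> measure rep UNIV / real (Suc n)" for n
  proof -
    define r where "r = 1 / real (Suc n)"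
    have r: "r > 0" by (simp add: r_def)
    obtain N where N: "K / r \<le> real N" using real_arch_simple by blast
    then have KN: "K \<le> r * real N" using r by (simp add: field_simps)
    define s where "s k x = min (max (f x - r * real k) 0) r" for k x
    have sC: "s k \<in> C" for k
    proof -
      have "(\<lambda>x. (\<lambda>t. min (max (t - r * real k) 0) r) (f x)) \<in> C"
        by (rule C_compose[OF f, of _ 1]) (use r in \<open>auto simp: min_def max_def\<close>)
      then show ?thesis by (simp add: s_def[abs_def])
    qed
    have s_sum: "(\<Sum>k<m. s k x) = min (f x) (r * real m)" for m x
      by (induction m) (use f0[of x] r in \<open>auto simp: s_def min_def max_def algebra_simps\<close>)
    have f_eq: "f = (\<lambda>x. \<Sum>k<N. s k x)"
    proof
      fix x have "f x \<le> r * real N" using K(2)[of x] KN by auto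
      then show "f x = (\<Sum>k<N. s k x)" by (simp add: s_sum min_def)
    qed
    define S where "S k = {x. r * real k < f x}" for k
    have Sb: "S k \<in> sets borel" for k
      unfolding S_def by (intro borel_open open_Collect_less continuous_on_const fC)
    then have Sr: "S k \<in> sets rep" for k by (simp add: sets_rep)
    define d where "d k = measure rep (S k)" for k
    have em: "emeasure rep (S k) = ennreal (d k)" for k by (simp add: d_def emeasure_eq_measure)
    have up: "\<Lambda> (s k) \<le> r * d k" for k
    proof -
      have "ennreal (\<Lambda> (\<lambda>x. (1/r) * s k x)) \<le> outer (S k)"
      proof (rule functional_le_outer[OF C_scale[OF sC]])
        fix x show "0 \<le> (1/r) * s k x" "(1/r) * s k x \<le> 1" using r by (auto simp: s_def)
        show "(1/r) * s k x = 0" if "x \<notin> S k" using that r by (auto simp: s_def S_def)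
      qed
      then have "ennreal (\<Lambda> (s k) / r) \<le> ennreal (d k)"
        unfolding emeasure_rep[OF Sb, symmetric] em \<Lambda>_scale[OF sC, of "1/r"] by simp
      then have "\<Lambda> (s k) / r \<le> d k" by (simp add: d_def)
      then show ?thesis using r by (simp add: field_simps)
    qed
    have lo: "r * d (Suc k) \<le> \<Lambda> (s k)" for k
    proof -
      have sn: "0 \<le> \<Lambda> (s k)" using r by (intro \<Lambda>_nonneg sC) (auto simp: s_def)
      have "outer (S (Suc k)) \<le> ennreal (\<Lambda> (\<lambda>x. (1/r) * s k x))"
      proof (rule outer_le_functional[OF C_scale[OF sC]])
        fix x show "0 \<le> (1/r) * s k x" using r by (auto simp: s_def)
        show "1 \<le> (1/r) * s k x" if "x \<in> S (Suc k)"
        proof -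
          have "s k x = r" using that r by (auto simp: s_def S_def algebra_simps)
          then show ?thesis using r by simp
        qed
      qed
      then have "ennreal (d (Suc k)) \<le> ennreal (\<Lambda> (s k) / r)"
        unfolding emeasure_rep[OF Sb, symmetric] em \<Lambda>_scale[OF sC, of "1/r"] by simp
      then have "d (Suc k) \<le> \<Lambda> (s k) / r" using sn r by (simp add: ennreal_le_iff)
      then show ?thesis using r by (simp add: field_simps)
    qed
    have iup: "(\<integral>x. s k x \<partial>rep) \<le> r * d k" for k
    proof -
      have "(\<integral>x. s k x \<partial>rep) \<le> (\<integral>x. r * indicator (S k) x \<partial>rep)"
      proof (rule integral_mono)
        show "integrable rep (\<lambda>x. r * indicator (S k) x)"
          using Sr[of k] by (intro integrable_mult_right integrable_real_indicator) (auto simp: emeasure_eq_measure)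
        show "s k x \<le> r * indicator (S k) x" for x using r by (auto simp: s_def S_def indicator_def)
      qed (intro C_integrable sC)
      then show ?thesis using Sr by (simp add: d_def)
    qed
    have ilo: "r * d (Suc k) \<le> (\<integral>x. s k x \<partial>rep)" for k
    proof -
      have "(\<integral>x. r * indicator (S (Suc k)) x \<partial>rep) \<le> (\<integral>x. s k x \<partial>rep)"
      proof (rule integral_mono)
        show "integrable rep (\<lambda>x. r * indicator (S (Suc k)) x)"
          using Sr[of "Suc k"] by (intro integrable_mult_right integrable_real_indicator) (auto simp: emeasure_eq_measure)
        show "r * indicator (S (Suc k)) x \<le> s k x" for x
          using r by (auto simp: s_def S_def indicator_def algebra_simps)
      qed (intro C_integrable sC)
      then show ?thesis using Sr by (simp add: d_def)
    qed
    have "\<bar>(\<integral>x. f x \<partial>rep) - \<Lambda> f\<bar> = \<bar>\<Sum>k<N. (\<integral>x. s k x \<partial>rep) - \<Lambda> (s k)\<bar>"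
    proof -
      have "(\<integral>x. f x \<partial>rep) = (\<Sum>k<N. \<integral>x. s k x \<partial>rep)"
        by (subst f_eq) (simp add: C_integrable sC)
      moreover have "\<Lambda> f = (\<Sum>k<N. \<Lambda> (s k))" by (subst f_eq) (intro \<Lambda>_sum sC)
      ultimately show ?thesis by (simp add: sum_subtractf)
    qed
    also have "\<dots> \<le> (\<Sum>k<N. r * (d k - d (Suc k)))"
    proof (rule order_trans[OF sum_abs sum_mono])
      fix k show "\<bar>(\<integral>x. s k x \<partial>rep) - \<Lambda> (s k)\<bar> \<le> r * (d k - d (Suc k))"
        using up[of k] lo[of k] iup[of k] ilo[of k] by (simp add: algebra_simps abs_le_iff)
    qed
    also have "\<dots> = r * (d 0 - d N)"
      by (simp add: sum_distrib_left[symmetric] sum_lessThan_telescope')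
    also have "\<dots> \<le> r * measure rep UNIV"
    proof (rule mult_left_mono)
      have "d 0 \<le> measure rep UNIV" unfolding d_def by (rule finite_measure_mono) (auto simp: sets_rep)
      then show "d 0 - d N \<le> measure rep UNIV" by (simp add: d_def add_increasing2 diff_le_eq)
    qed (use r in simp)
    finally show ?thesis by (simp add: r_def)
  qed
  have "(\<lambda>n. measure rep UNIV * inverse (real (Suc n))) \<longlonglongrightarrow> measure rep UNIV * 0"
    by (intro tendsto_mult tendsto_const LIMSEQ_inverse_real_of_nat)
  then have "\<bar>(\<integral>x. f x \<partial>rep) - \<Lambda> f\<bar> \<le> measure rep UNIV * 0"
    by (rule LIMSEQ_le_const) (use est in \<open>auto simp: divide_inverse\<close>)
  then show ?thesis by simp
qed

lemma rep_integral:
  assumes f: "f \<in> C"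
  shows "(\<integral>x. f x \<partial>rep) = \<Lambda> f"
proof -
  define p n where "p x = max (f x) 0" and "n x = max (- f x) 0" for x
  have pC: "p \<in> C" unfolding p_def
    by (rule C_compose[OF f, of "\<lambda>t. max t 0" 1, simplified]) (auto simp: max_def)
  have nC: "n \<in> C" unfolding n_def
    by (rule C_compose[OF f, of "\<lambda>t. max (- t) 0" 1, simplified]) (auto simp: max_def)
  have f_eq: "f = (\<lambda>x. p x - n x)" by (auto simp: p_def n_def fun_eq_iff)
  have "(\<integral>x. f x \<partial>rep) = (\<integral>x. p x \<partial>rep) - (\<integral>x. n x \<partial>rep)"
    by (subst f_eq) (intro Bochner_Integration.integral_diff C_integrable pC nC)
  also have "\<dots> = \<Lambda> p - \<Lambda> n"
    using rep_integral_nonneg[OF pC] rep_integral_nonneg[OF nC] by (simp add: p_def[abs_def] n_def[abs_def])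
  also have "\<dots> = \<Lambda> f" by (subst f_eq) (rule \<Lambda>_diff[OF pC nC, symmetric])
  finally show ?thesis .
qed

end

section \<open>Regularity and uniqueness of the representing measure\<close>

context positive_functional
begin

text \<open>A nearly optimal cover h of A has sum at least 1 on A. The set where the sum exceeds
  some c < 1 is open and contains A, and h / c covers it at a slightly higher cost.\<close>

lemma outer_regular:
  assumes fin: "outer A \<noteq> \<infinity>" and e: "e > (0::real)"
  obtains U where "open U" "A \<subseteq> U" "outer U \<le> outer A + ennreal e"
proof -
  define a where "a = enn2real (outer A)"
  have a: "outer A = ennreal a" "a \<ge> 0" using fin by (auto simp: a_def less_top)
  \<comment> \<open>Chosen so that (a + e/2) / c = a + e, the permitted cost of the enlarged
    cover.\<close>
  define c where "c = (a + e / 2) / (a + e)"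
  have c: "0 < c" "c < 1" "(a + e / 2) / c = a + e"
    using a(2) e by (auto simp: c_def field_simps)
  have "\<exists>h\<in>covers A. (\<Sum>i. ennreal (\<Lambda> (h i))) < outer A + ennreal (e / 2)"
    by (rule INF_approx_ennreal[OF _ outer_def fin]) (use e in simp)
  then obtain h where h: "h \<in> covers A" and hs: "(\<Sum>i. ennreal (\<Lambda> (h i))) < outer A + ennreal (e / 2)" by blast
  note hC = coversD(1)[OF h] and h0 = coversD(2)[OF h]
  define U where "U = (\<Union>n. {x. c < (\<Sum>i<n. h i x)})"
  have U_iff: "x \<in> U \<longleftrightarrow> ennreal c < (\<Sum>i. ennreal (h i x))" for x
  proof -
    have "ennreal c < (\<Sum>i. ennreal (h i x)) \<longleftrightarrow> (\<exists>n. ennreal c < (\<Sum>i<n. ennreal (h i x)))"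
      by (simp add: suminf_eq_SUP less_SUP_iff)
    also have "\<dots> \<longleftrightarrow> (\<exists>n. c < (\<Sum>i<n. h i x))"
      using c(1) by (simp add: sum_ennreal h0 ennreal_less_iff)
    finally show ?thesis by (simp add: U_def)
  qed
  show thesis
  proof
    have "continuous_on UNIV (h i)" for i using hC C_C0 C0_continuous by blast
    then show "open U" unfolding U_def
      by (intro open_UN ballI open_Collect_less continuous_on_const continuous_on_sum)
    show "A \<subseteq> U"
    proof
      fix x assume "x \<in> A"
      then have "1 \<le> (\<Sum>i. ennreal (h i x))" by (rule coversD(3)[OF h])
      moreover have "ennreal c < 1" using c by (simp add: ennreal_less_one_iff)
      ultimately show "x \<in> U" unfolding U_iff by (rule less_le_trans[rotated])
    qed
    have "(\<lambda>i x. (1 / c) * h i x) \<in> covers U"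
    proof -
      have "1 \<le> (\<Sum>i. ennreal ((1 / c) * h i x))" if "x \<in> U" for x
      proof -
        have "1 = ennreal (1 / c) * ennreal c" using c by (simp add: ennreal_mult[symmetric])
        also have "\<dots> \<le> ennreal (1 / c) * (\<Sum>i. ennreal (h i x))"
          using less_imp_le[OF that[unfolded U_iff]] by (intro mult_left_mono) auto
        also have "\<dots> = (\<Sum>i. ennreal (1 / c) * ennreal (h i x))" by simp
        also have "\<dots> = (\<Sum>i. ennreal ((1 / c) * h i x))"
          using c by (intro arg_cong[where f = suminf] ext ennreal_mult[symmetric] h0) simp
        finally show ?thesis .
      qed
      moreover have "0 \<le> (1 / c) * h i x" for i x using c h0[of i x] by simp
      ultimately show ?thesis unfolding covers_def using C_scale[OF hC] by blast
    qed
    from outer_le[OF this] have "outer U \<le> (\<Sum>i. ennreal ((1 / c) * \<Lambda> (h i)))"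
      by (simp only: \<Lambda>_scale[OF hC])
    also have "\<dots> = (\<Sum>i. ennreal (1 / c) * ennreal (\<Lambda> (h i)))"
      using c coversD(4)[OF h] by (intro arg_cong[where f = suminf] ext ennreal_mult) auto
    also have "\<dots> = ennreal (1 / c) * (\<Sum>i. ennreal (\<Lambda> (h i)))" by simp
    also have "\<dots> \<le> ennreal (1 / c) * (outer A + ennreal (e / 2))"
      using less_imp_le[OF hs] by (intro mult_left_mono) auto
    also have "\<dots> = ennreal ((1 / c) * (a + e / 2))"
      unfolding a(1) using a(2) e c by (simp add: ennreal_mult[symmetric] ennreal_plus[symmetric] del: ennreal_plus)
    also have "(1 / c) * (a + e / 2) = a + e" using c(3) by simp
    also have "ennreal (a + e) = outer A + ennreal e" using a e by simp
    finally show "outer U \<le> outer A + ennreal e" .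
  qed
qed

text \<open>Inner regularity by complements: an open U slightly larger than the complement of A
  leaves a closed set inside A, and intersecting it with a compact exhaustion of the space makes it
  compact.\<close>

lemma radon_rep: "radon_measure rep"
  unfolding radon_measure_def
proof (intro conjI allI impI ballI)
  interpret finite_measure rep by (rule finite_measure_rep)
  show "sets rep = sets borel" by (rule sets_rep)
  show "emeasure rep K < \<infinity>" for K by (simp add: less_top[symmetric])
  fix A :: "'a set" assume A: "A \<in> sets borel"
  let ?KK = "{K. compact K \<and> K \<subseteq> A}"
  obtain K :: "nat \<Rightarrow> 'a set" where K: "\<And>n. compact (K n)" "incseq K" "(\<Union>n. K n) = UNIV"
    using locally_compact_sigma_compact[OF locally_compact] by blast
  have Kb: "K n \<in> sets rep" for n unfolding sets_rep using K(1) by (intro borel_closed compact_imp_closed)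
  show "emeasure rep A = (SUP K\<in>?KK. emeasure rep K)"
  proof (rule antisym)
    show "(SUP K\<in>?KK. emeasure rep K) \<le> emeasure rep A"
      using A by (intro SUP_least emeasure_mono) (auto simp: sets_rep)
    show "emeasure rep A \<le> (SUP K\<in>?KK. emeasure rep K)"
    proof (rule ennreal_le_epsilon)
      fix e :: real assume e: "0 < e"
      have cA: "- A \<in> sets borel" using A by auto
      have "outer (- A) \<noteq> \<infinity>" using emeasure_rep[OF cA] emeasure_finite[of "- A"] by simp
      from outer_regular[OF this e] obtain U where U: "open U" "- A \<subseteq> U" "outer U \<le> outer (- A) + ennreal e"
        by blast
      have Ub: "U \<in> sets borel" using U(1) by simp
      have "ennreal (measure rep U) \<le> ennreal (measure rep (- A)) + ennreal e"
        using U(3) unfolding emeasure_rep[OF Ub, symmetric] emeasure_rep[OF cA, symmetric] emeasure_eq_measure .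
      also have "\<dots> = ennreal (measure rep (- A) + e)" using e by simp
      finally have mU: "measure rep U \<le> measure rep (- A) + e"
        by (rule iffD1[OF ennreal_le_iff, rotated]) (use e in simp)
      have "measure rep (- U) = measure rep (space rep) - measure rep U"
        using finite_measure_compl[of U] Ub by (simp add: sets_rep space_rep Compl_eq_Diff_UNIV)
      moreover have "measure rep (- A) = measure rep (space rep) - measure rep A"
        using finite_measure_compl[of A] A by (simp add: sets_rep space_rep Compl_eq_Diff_UNIV)
      ultimately have "measure rep A \<le> measure rep (- U) + e" using mU by simp
      then have "emeasure rep A \<le> emeasure rep (- U) + ennreal e"
        using e by (simp add: emeasure_eq_measure ennreal_plus[symmetric] del: ennreal_plus)
      also have "emeasure rep (- U) = (SUP n. emeasure rep (- U \<inter> K n))"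
      proof -
        have "(SUP n. emeasure rep (- U \<inter> K n)) = emeasure rep (\<Union>n. - U \<inter> K n)"
          by (rule SUP_emeasure_incseq) (use Kb Ub K(2) in \<open>auto simp: sets_rep incseq_def\<close>)
        then show ?thesis using K(3) by (simp add: Int_UN_distrib[symmetric])
      qed
      also have "\<dots> \<le> (SUP K\<in>?KK. emeasure rep K)"
      proof (rule SUP_mono)
        fix n
        have "compact (- U \<inter> K n)" using K(1) U(1) by (simp add: closed_Int_compact closed_Compl)
        then show "\<exists>L\<in>?KK. emeasure rep (- U \<inter> K n) \<le> emeasure rep L" using U(2) by (intro bexI[of _ "- U \<inter> K n"]) auto
      qed
      finally show "emeasure rep A \<le> (SUP K\<in>?KK. emeasure rep K) + ennreal e" by (simp add: add_right_mono)
    qed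
  qed
qed

text \<open>A bump in C fits between the indicators of K and U for each compact K in U, and inner
  regularity takes the supremum over K. Used in both directions, it shows that a finite Radon
  measure is determined by its integrals over C.\<close>

lemma emeasure_open_le:
  assumes \<nu>: "radon_measure \<nu>" "finite_measure \<nu>" and \<nu>': "radon_measure \<nu>'" "finite_measure \<nu>'"
    and eq: "\<And>f. f \<in> C \<Longrightarrow> (\<integral>x. f x \<partial>\<nu>) = (\<integral>x. f x \<partial>\<nu>')" and U: "open U"
  shows "emeasure \<nu> U \<le> emeasure \<nu>' U"
proof -
  interpret a: finite_measure \<nu> by (rule \<nu>(2))
  interpret b: finite_measure \<nu>' by (rule \<nu>'(2))
  have "emeasure \<nu> U = (SUP K\<in>{K. compact K \<and> K \<subseteq> U}. emeasure \<nu> K)"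
    using \<nu>(1) U unfolding radon_measure_def by auto
  also have "\<dots> \<le> emeasure \<nu>' U"
  proof (rule SUP_least)
    fix K assume "K \<in> {K. compact K \<and> K \<subseteq> U}"
    then have K: "compact K" "K \<subseteq> U" by auto
    obtain f where f: "f \<in> C" "\<And>x. 0 \<le> f x" "\<And>x. f x \<le> 1" "\<And>x. x \<in> K \<Longrightarrow> f x = 1" "\<And>x. x \<notin> U \<Longrightarrow> f x = 0"
      using C_bump[OF K(1) U K(2)] by metis
    have fC0: "f \<in> C0" using f(1) C_C0 by blast
    have Ks: "K \<in> sets \<nu>" by (rule radon_compact(1)[OF \<nu>(1) K(1)])
    have Us: "U \<in> sets \<nu>'" using U radon_sets[OF \<nu>'(1)] by auto
    have "measure \<nu> K = (\<integral>x. indicator K x \<partial>\<nu>)" using Ks by simp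
    also have "\<dots> \<le> (\<integral>x. f x \<partial>\<nu>)"
      by (intro integral_mono radon_C0_integrable[OF \<nu>(1) fC0] integrable_real_indicator Ks)
        (use f in \<open>auto simp: indicator_def a.emeasure_eq_measure\<close>)
    also have "\<dots> = (\<integral>x. f x \<partial>\<nu>')" by (rule eq[OF f(1)])
    also have "\<dots> \<le> (\<integral>x. indicator U x \<partial>\<nu>')"
      by (intro integral_mono radon_C0_integrable[OF \<nu>'(1) fC0] integrable_real_indicator Us)
        (use f in \<open>auto simp: indicator_def b.emeasure_eq_measure\<close>)
    also have "\<dots> = measure \<nu>' U" using Us by simp
    finally show "emeasure \<nu> K \<le> emeasure \<nu>' U"
      by (simp add: a.emeasure_eq_measure b.emeasure_eq_measure)
  qed
  finally show ?thesis .
qed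

lemma rep_unique:
  assumes \<nu>: "radon_measure \<nu>" "finite_measure \<nu>" and eq: "\<And>f. f \<in> C \<Longrightarrow> (\<integral>x. f x \<partial>\<nu>) = \<Lambda> f"
  shows "\<nu> = rep"
proof (rule measure_eqI_generator_eq[where A = "\<lambda>_. UNIV" and \<Omega> = UNIV and E = "Collect open"])
  show "Int_stable (Collect open)" by (auto simp: Int_stable_def)
  show "emeasure \<nu> X = emeasure rep X" if "X \<in> Collect open" for X
    using that eq rep_integral \<nu> radon_rep finite_measure_rep
    by (intro antisym emeasure_open_le) auto
  show "sets \<nu> = sigma_sets UNIV (Collect open)" "sets rep = sigma_sets UNIV (Collect open)"
    using radon_sets[OF \<nu>(1)] sets_rep by (simp_all add: sets_borel)
  show "emeasure \<nu> UNIV \<noteq> \<infinity>" for i :: nat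
    using \<nu>(2) by (simp add: finite_measure.emeasure_finite)
qed auto

end

section \<open>Energy measures\<close>

definition clip :: "real \<Rightarrow> real \<Rightarrow> real" where
  "clip e t = max (- e) (min t e)"

lemma clip_lipschitz: "\<bar>clip e s - clip e t\<bar> \<le> 1 * \<bar>s - t\<bar>"
  by (auto simp: clip_def max_def min_def)

lemma clip_0: "e \<ge> 0 \<Longrightarrow> clip e 0 = 0"
  by (simp add: clip_def)

lemma clip_abs_le: "e \<ge> 0 \<Longrightarrow> \<bar>clip e t\<bar> \<le> e"
  by (auto simp: clip_def)

lemma continuous_clip: "continuous_on UNIV (clip e)"
  unfolding clip_def[abs_def] by (intro continuous_intros)

context regular_dirichlet_form
begin

text \<open>\<open>energy_functional g f = \<integral> f d\<Gamma>(g)\<close>\<close>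

definition energy_functional :: "('a \<Rightarrow> real) \<Rightarrow> ('a \<Rightarrow> real) \<Rightarrow> real" where
  "energy_functional g f = E (\<lambda>x. f x * g x) g - E (\<lambda>x. g x * g x) f / 2"

lemma core_D: "u \<in> core \<Longrightarrow> u \<in> D" by simp

lemma energy_functional_lin:
  assumes g: "g \<in> core" and f: "f \<in> core" and f': "f' \<in> core"
  shows "energy_functional g (\<lambda>x. a * f x + b * f' x) = a * energy_functional g f + b * energy_functional g f'"
proof -
  have fg: "(\<lambda>x. f x * g x) \<in> D" "(\<lambda>x. f' x * g x) \<in> D" "(\<lambda>x. g x * g x) \<in> D" "f \<in> D" "f' \<in> D" "g \<in> D"
    using core_mult[OF f g] core_mult[OF f' g] core_mult[OF g g] f f' g by auto
  have "(\<lambda>x. (a * f x + b * f' x) * g x) = (\<lambda>x. a * (f x * g x) + b * (f' x * g x))"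
    by (simp add: algebra_simps)
  then have "E (\<lambda>x. (a * f x + b * f' x) * g x) g = a * E (\<lambda>x. f x * g x) g + b * E (\<lambda>x. f' x * g x) g"
    using fg by (simp only: lin_left)
  moreover have "E (\<lambda>x. g x * g x) (\<lambda>x. a * f x + b * f' x) = a * E (\<lambda>x. g x * g x) f + b * E (\<lambda>x. g x * g x) f'"
    using fg by (simp only: lin_right)
  ultimately show ?thesis by (simp add: energy_functional_def field_simps)
qed

text \<open>For a jump form the density of the combination is (1/2) (f x + f y) (g x - g y)^2, and
  the killing part contributes (1/2) f g^2.\<close>

lemma energy_functional_nonneg:
  assumes g: "g \<in> core" and f: "f \<in> core" and f0: "\<And>x. 0 \<le> f x"
  shows "0 \<le> energy_functional g f"
proof -
  have "0 \<le> 1 * E (\<lambda>x. f x * g x) g + (- 1/2) * E (\<lambda>x. g x * g x) f + 0 * E g g"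
  proof (rule form_nonneg3[OF core_mult[OF f g] g core_mult[OF g g] f g g])
    fix x y
    have "1 * ((f x * g x - f y * g y) * (g x - g y)) + (- 1/2) * ((g x * g x - g y * g y) * (f x - f y)) + 0 * ((g x - g y) * (g x - g y))
      = (1/2) * (f x + f y) * (g x - g y)\<^sup>2" by (simp add: field_simps power2_eq_square)
    also have "\<dots> \<ge> 0" using f0 by (intro mult_nonneg_nonneg) auto
    finally show "0 \<le> 1 * ((f x * g x - f y * g y) * (g x - g y)) + (- 1/2) * ((g x * g x - g y * g y) * (f x - f y)) + 0 * ((g x - g y) * (g x - g y))" .
    have "1 * (f x * g x * g x) + (- 1/2) * (g x * g x * f x) + 0 * (g x * g x) = (1/2) * (f x * (g x)\<^sup>2)"
      by (simp add: power2_eq_square)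
    also have "\<dots> \<ge> 0" using f0[of x] by simp
    finally show "0 \<le> 1 * (f x * g x * g x) + (- 1/2) * (g x * g x * f x) + 0 * (g x * g x)" .
  qed
  then show ?thesis by (simp add: energy_functional_def)
qed

text \<open>The same computation with c - f in place of f on increments and c - f/2 on values. It
  bounds the energy measure of g by E(g,g) in total mass.\<close>

lemma energy_functional_le:
  assumes g: "g \<in> core" and f: "f \<in> core" and c: "\<And>x. f x \<le> c" and c0: "0 \<le> c"
  shows "energy_functional g f \<le> c * E g g"
proof -
  have "0 \<le> (-1) * E (\<lambda>x. f x * g x) g + (1/2) * E (\<lambda>x. g x * g x) f + c * E g g"
  proof (rule form_nonneg3[OF core_mult[OF f g] g core_mult[OF g g] f g g])
    fix x y
    have "(-1) * ((f x * g x - f y * g y) * (g x - g y)) + (1/2) * ((g x * g x - g y * g y) * (f x - f y)) + c * ((g x - g y) * (g x - g y))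
      = (1/2) * ((c - f x) + (c - f y)) * (g x - g y)\<^sup>2" by (simp add: field_simps power2_eq_square)
    also have "\<dots> \<ge> 0" using c[of x] c[of y] by (intro mult_nonneg_nonneg) auto
    finally show "0 \<le> (-1) * ((f x * g x - f y * g y) * (g x - g y)) + (1/2) * ((g x * g x - g y * g y) * (f x - f y)) + c * ((g x - g y) * (g x - g y))" .
    have "(-1) * (f x * g x * g x) + (1/2) * (g x * g x * f x) + c * (g x * g x) = (c - (1/2) * f x) * (g x)\<^sup>2"
      by (simp add: power2_eq_square algebra_simps)
    also have "\<dots> \<ge> 0" using c[of x] c0 by (intro mult_nonneg_nonneg) auto
    finally show "0 \<le> (-1) * (f x * g x * g x) + (1/2) * (g x * g x * f x) + c * (g x * g x)" .
  qed
  then show ?thesis by (simp add: energy_functional_def)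
qed

lemma energy_functional_bound:
  assumes g: "g \<in> core" and f: "f \<in> core" and c: "\<And>x. \<bar>f x\<bar> \<le> c"
  shows "\<bar>energy_functional g f\<bar> \<le> E g g * c"
proof -
  have c0: "0 \<le> c" using c[of undefined] by linarith
  have "energy_functional g f \<le> c * E g g"
    by (rule energy_functional_le[OF g f _ c0]) (use c in \<open>auto simp: abs_le_iff\<close>)
  moreover have "energy_functional g (\<lambda>x. (-1) * f x + 0 * f x) \<le> c * E g g"
    by (rule energy_functional_le[OF g core_lin[OF f f] _ c0]) (use c in \<open>auto simp: abs_le_iff\<close>)
  moreover have "energy_functional g (\<lambda>x. (-1) * f x + 0 * f x) = - energy_functional g f"
    using energy_functional_lin[OF g f f, of "-1" 0] by simp
  ultimately show ?thesis by (simp add: abs_le_iff mult.commute)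
qed

lemma positive_functional_energy:
  assumes g: "g \<in> core"
  shows "positive_functional core (energy_functional g) (E g g)"
proof
  show "locally_compact_space (euclidean :: 'a topology)" by (rule locally_compact)
  show "(\<lambda>x. G (f x)) \<in> core" if "f \<in> core" "G 0 = 0" "\<And>s t. \<bar>G s - G t\<bar> \<le> L * \<bar>s - t\<bar>" for f G L
  proof -
    have L: "L \<ge> 0" using that(3)[of 1 0] by (simp add: order_trans[OF abs_ge_zero])
    have "L-lipschitz_on UNIV G"
      using that(3) L by (intro lipschitz_onI) (auto simp: dist_real_def)
    then have "continuous_on UNIV G" by (rule lipschitz_on_continuous_on)
    then show ?thesis by (rule core_compose(1)[OF that(1) _ that(2,3)])
  qed
  show "\<exists>f\<in>core. (\<forall>x. 0 \<le> f x \<and> f x \<le> 1) \<and> (\<forall>x\<in>K. f x = 1) \<and> (\<forall>x. x \<notin> U \<longrightarrow> f x = 0)"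
    if "compact K" "open U" "K \<subseteq> U" for K U
    using core_bump[OF that] by metis
  fix f h :: "'a \<Rightarrow> real" and a b c :: real
  assume f: "f \<in> core"
  show "0 \<le> energy_functional g f" if "\<And>x. 0 \<le> f x" by (rule energy_functional_nonneg[OF g f that])
  show "\<bar>energy_functional g f\<bar> \<le> E g g * c" if "\<And>x. \<bar>f x\<bar> \<le> c" by (rule energy_functional_bound[OF g f that])
  assume h: "h \<in> core"
  show "(\<lambda>x. a * f x + b * h x) \<in> core" by (rule core_lin[OF f h])
  show "(\<lambda>x. f x * h x) \<in> core" by (rule core_mult[OF f h])
  show "energy_functional g (\<lambda>x. a * f x + b * h x) = a * energy_functional g f + b * energy_functional g h"
    by (rule energy_functional_lin[OF g f h])
qed simp

text \<open>\<open>energy_measure\<close> is a definite description, so nothing about it is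
  available before existence (\<open>rep\<close>) and uniqueness (\<open>rep_unique\<close>) of the
  measure are both in place.\<close>

lemma energy_measure:
  assumes g: "g \<in> core"
  shows radon_energy_measure: "radon_measure (energy_measure E D g)"
    and finite_energy_measure: "finite_measure (energy_measure E D g)"
    and integral_energy_measure: "f \<in> core \<Longrightarrow> (\<integral>x. f x \<partial>energy_measure E D g) = energy_functional g f"
proof -
  interpret positive_functional core "energy_functional g" "E g g" by (rule positive_functional_energy[OF g])
  let ?P = "\<lambda>\<nu>. radon_measure \<nu> \<and> finite_measure \<nu> \<and>
        (\<forall>f\<in>core. 2 * (\<integral>x. f x \<partial>\<nu>) = E (\<lambda>x. f x * g x) g + E (\<lambda>x. f x * g x) g - E (\<lambda>x. g x * g x) f)"
  have ex: "?P rep"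
    using radon_rep finite_measure_rep rep_integral by (simp add: energy_functional_def)
  have "\<nu> = rep" if "?P \<nu>" for \<nu>
  proof (rule rep_unique)
    fix f assume "f \<in> core"
    then have "2 * (\<integral>x. f x \<partial>\<nu>) = E (\<lambda>x. f x * g x) g + E (\<lambda>x. f x * g x) g - E (\<lambda>x. g x * g x) f"
      using that by blast
    then show "(\<integral>x. f x \<partial>\<nu>) = energy_functional g f" by (simp add: energy_functional_def)
  qed (use that in auto)
  with ex have "?P (energy_measure E D g)"
    unfolding energy_measure_def by (rule theI)
  then show "radon_measure (energy_measure E D g)" "finite_measure (energy_measure E D g)"
    by auto
  assume "f \<in> core"
  then have "2 * (\<integral>x. f x \<partial>energy_measure E D g) = E (\<lambda>x. f x * g x) g + E (\<lambda>x. f x * g x) g - E (\<lambda>x. g x * g x) f"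
    using \<open>?P (energy_measure E D g)\<close> by blast
  then show "(\<integral>x. f x \<partial>energy_measure E D g) = energy_functional g f"
    by (simp add: energy_functional_def)
qed

text \<open>Parallelogram law for the quadratic form I(p, .) at f - h and h: I(f) + I(f - 2h) = 2
  I(f - h) + 2 I(h), where I(f - 2h) is nonnegative. The expansion \<open>k\<close> in t is used at
  t = 0, -1 and -2.\<close>

lemma energy_functional_le_add:
  assumes f: "f \<in> core" and h: "h \<in> core" and p: "p \<in> core" and p0: "\<And>x. 0 \<le> p x"
  shows "energy_functional f p \<le> 2 * energy_functional h p + 2 * energy_functional (\<lambda>x. f x - h x) p"
proof -
  note c = core_mult[OF p f] core_mult[OF p h] core_mult[OF f f] core_mult[OF f h] core_mult[OF h h] f h p
  note d = c[THEN core_D]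
  have k: "energy_functional (\<lambda>x. f x + t * h x) p = E (\<lambda>x. p x * f x) f + t * (E (\<lambda>x. p x * f x) h + E (\<lambda>x. p x * h x) f)
    + t * t * E (\<lambda>x. p x * h x) h - (E (\<lambda>x. f x * f x) p + 2 * t * E (\<lambda>x. f x * h x) p + t * t * E (\<lambda>x. h x * h x) p) / 2" for t
  proof -
    have 1: "(\<lambda>x. p x * (f x + t * h x)) = (\<lambda>x. p x * f x + t * (p x * h x))" by (simp add: algebra_simps)
    have 2: "(\<lambda>x. (f x + t * h x) * (f x + t * h x)) = (\<lambda>x. f x * f x + ((2 * t) * (f x * h x) + (t * t) * (h x * h x)))"
      by (simp add: algebra_simps)
    show ?thesis
      unfolding energy_functional_def 1 2
      by (simp only: add_left add_right scale_left scale_right lin_left add_mem scale_mem lin_mem d)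
        (simp add: algebra_simps)
  qed
  have "0 \<le> energy_functional (\<lambda>x. f x + (-2) * h x) p"
    by (intro energy_functional_nonneg core_add core_scale f h p p0)
  moreover have "energy_functional f p = energy_functional (\<lambda>x. f x + 0 * h x) p" by simp
  moreover have "energy_functional (\<lambda>x. f x - h x) p = energy_functional (\<lambda>x. f x + (-1) * h x) p" by simp
  moreover have "energy_functional h p = E (\<lambda>x. p x * h x) h - E (\<lambda>x. h x * h x) p / 2"
    by (simp add: energy_functional_def)
  ultimately show ?thesis unfolding k by (simp add: field_simps)
qed

section \<open>Truncation of core functions\<close>

lemma core_clip:
  assumes "f \<in> core" "e \<ge> 0"
  shows "(\<lambda>x. clip e (f x)) \<in> core" "E (\<lambda>x. clip e (f x)) (\<lambda>x. clip e (f x)) \<le> E f f"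
  using core_compose[OF assms(1) continuous_clip clip_0[OF assms(2)] clip_lipschitz] by simp_all

text \<open>
  If \<open>\<bar>s\<bar>\<close> or \<open>\<bar>t\<bar>\<close> exceeds \<open>e\<close> then the weights \<open>min 1 (\<bar>s\<bar>/e) + min 1 (\<bar>t\<bar>/e)\<close> are at least
  1; otherwise both truncations vanish. Hence no locality is needed to bound the energy of
  \<open>f - clip e f\<close> by the energy measure of \<open>f\<close> on the set where \<open>f\<close> does not vanish.
\<close>

lemma unclipped_energy_le:
  assumes f: "f \<in> core" and e: "e > 0"
  defines "p \<equiv> \<lambda>x. min 1 (\<bar>f x\<bar> / e)"
  shows "p \<in> core" "E (\<lambda>x. f x - clip e (f x)) (\<lambda>x. f x - clip e (f x)) \<le> 2 * energy_functional f p"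
proof -
  have "(\<lambda>x. (\<lambda>t. min 1 (\<bar>t\<bar> / e)) (f x)) \<in> core"
  proof (rule core_compose(1)[OF f, of _ "1 / e"])
    show "continuous_on UNIV (\<lambda>t. min 1 (\<bar>t\<bar> / e))" by (intro continuous_intros) (use e in auto)
    fix s t :: real
    have "\<bar>min 1 (\<bar>s\<bar> / e) - min 1 (\<bar>t\<bar> / e)\<bar> \<le> \<bar>\<bar>s\<bar> / e - \<bar>t\<bar> / e\<bar>" by (auto simp: min_def)
    also have "\<dots> = \<bar>\<bar>s\<bar> - \<bar>t\<bar>\<bar> / e" using e by (simp add: diff_divide_distrib[symmetric])
    also have "\<dots> \<le> 1 / e * \<bar>s - t\<bar>" using e abs_triangle_ineq3[of s t] by (simp add: divide_right_mono)
    finally show "\<bar>min 1 (\<bar>s\<bar> / e) - min 1 (\<bar>t\<bar> / e)\<bar> \<le> 1 / e * \<bar>s - t\<bar>" .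
  qed simp
  then show p: "p \<in> core" by (simp add: p_def)
  define T where "T x = f x - clip e (f x)" for x
  have T: "T \<in> core" unfolding T_def by (intro core_diff f core_clip) (use e in simp)
  have p01: "0 \<le> p x" for x using e by (simp add: p_def)
  have key: "(T x - T y)\<^sup>2 \<le> (p x + p y) * (f x - f y)\<^sup>2" for x y
  proof (cases "\<bar>f x\<bar> \<le> e \<and> \<bar>f y\<bar> \<le> e")
    case True
    then have "T x = 0" "T y = 0" by (auto simp: T_def clip_def)
    then show ?thesis using p01[of x] p01[of y] by simp
  next
    case False
    then have "1 \<le> p x + p y" using p01[of x] p01[of y] e by (auto simp: p_def)
    moreover have "\<bar>T x - T y\<bar> \<le> \<bar>f x - f y\<bar>" by (auto simp: T_def clip_def max_def min_def)
    then have "(T x - T y)\<^sup>2 \<le> (f x - f y)\<^sup>2" by (simp add: abs_le_square_iff)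
    ultimately show ?thesis using mult_right_mono[of 1 "p x + p y" "(f x - f y)\<^sup>2"] by simp
  qed
  have kill: "(T x)\<^sup>2 \<le> p x * (f x)\<^sup>2" for x
  proof (cases "\<bar>f x\<bar> \<le> e")
    case True
    then have "T x = 0" by (auto simp: T_def clip_def)
    then show ?thesis using p01[of x] by simp
  next
    case False
    then have "p x = 1" using e by (simp add: p_def)
    moreover have "\<bar>T x\<bar> \<le> \<bar>f x\<bar>" using e by (auto simp: T_def clip_def max_def min_def)
    ultimately show ?thesis by (simp add: abs_le_square_iff)
  qed
  have "0 \<le> 2 * E (\<lambda>x. p x * f x) f + (-1) * E (\<lambda>x. f x * f x) p + (-1) * E T T"
  proof (rule form_nonneg3[OF core_mult[OF p f] f core_mult[OF f f] p T T])
    fix x y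
    have "2 * ((p x * f x - p y * f y) * (f x - f y)) + (-1) * ((f x * f x - f y * f y) * (p x - p y)) + (-1) * ((T x - T y) * (T x - T y))
      = (p x + p y) * (f x - f y)\<^sup>2 - (T x - T y)\<^sup>2" by (simp add: power2_eq_square algebra_simps)
    also have "\<dots> \<ge> 0" using key[of x y] by simp
    finally show "0 \<le> 2 * ((p x * f x - p y * f y) * (f x - f y)) + (-1) * ((f x * f x - f y * f y) * (p x - p y)) + (-1) * ((T x - T y) * (T x - T y))" .
    show "0 \<le> 2 * (p x * f x * f x) + (-1) * (f x * f x * p x) + (-1) * (T x * T x)"
      using kill[of x] by (simp add: power2_eq_square mult_ac)
  qed
  then show "E (\<lambda>x. f x - clip e (f x)) (\<lambda>x. f x - clip e (f x)) \<le> 2 * energy_functional f p"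
    by (simp add: energy_functional_def T_def[abs_def])
qed

end

section \<open>Closability with respect to an energy dominant measure\<close>

lemma (in nonneg_form) form_cauchy_subseq:
  assumes "form_cauchy B f" "strict_mono r"
  shows "form_cauchy B (\<lambda>n. f (r n))"
  unfolding form_cauchy_def
proof (intro allI impI)
  fix e :: real assume "e > 0"
  then obtain N where N: "\<And>i j. i \<ge> N \<Longrightarrow> j \<ge> N \<Longrightarrow> B (\<lambda>x. f i x - f j x) (\<lambda>x. f i x - f j x) < e"
    using assms(1) unfolding form_cauchy_def by blast
  show "\<exists>N. \<forall>i\<ge>N. \<forall>j\<ge>N. B (\<lambda>x. f (r i) x - f (r j) x) (\<lambda>x. f (r i) x - f (r j) x) < e"
    using N seq_suble[OF assms(2)] by (meson order_trans)
qed

lemma l2_norm_tendsto_0_AE_subseq: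
  assumes f: "\<And>n. f n \<in> L2 M" and lim: "(\<lambda>n. l2_norm M (f n)) \<longlonglongrightarrow> 0"
  obtains r :: "nat \<Rightarrow> nat" where "strict_mono r" "AE x in M. (\<lambda>n. f (r n) x) \<longlonglongrightarrow> 0"
proof -
  have "\<exists>r::nat \<Rightarrow> nat. strict_mono r \<and> (AE x in M. (\<lambda>n. (f (r n) x)\<^sup>2) \<longlonglongrightarrow> 0)"
  proof (rule tendsto_L1_AE_subseq)
    show "integrable M (\<lambda>x. (f n x)\<^sup>2)" for n using f[of n] by (simp add: L2_def)
    show "(\<lambda>n. \<integral>x. norm ((f n x)\<^sup>2) \<partial>M) \<longlonglongrightarrow> 0"
      using lim by (simp add: l2_norm_tendsto_0_iff l2_inner_def power2_eq_square)
  qed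
  then obtain r :: "nat \<Rightarrow> nat" where r: "strict_mono r" "AE x in M. (\<lambda>n. (f (r n) x)\<^sup>2) \<longlonglongrightarrow> 0" by blast
  have "AE x in M. (\<lambda>n. f (r n) x) \<longlonglongrightarrow> 0"
    using r(2)
  proof eventually_elim
    case (elim x)
    have "(\<lambda>n. \<bar>f (r n) x\<bar>) \<longlonglongrightarrow> 0" using tendsto_real_sqrt[OF elim] by simp
    then show ?case by (rule tendsto_rabs_zero_cancel)
  qed
  with r(1) show thesis by (rule that)
qed

context regular_dirichlet_form
begin

text \<open>By symmetry of the resolvent both terms become integrals of u against v or
  \<open>res b v\<close>, and each of these is at most e in modulus; hence the factor 2. The right
  side is finite because u is integrable.\<close>

lemma approx_form_small:
  assumes b: "b > 0" and u: "u \<in> C0" and v: "v \<in> C0" and e: "\<And>x. \<bar>v x\<bar> \<le> e" and e0: "e > 0"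
  shows "\<bar>approx_form b u v\<bar> \<le> 2 * b * e * (\<integral>x. \<bar>u x\<bar> \<partial>M)"
proof -
  note uL = C0_L2[OF u] and vL = C0_L2[OF v]
  have ui: "integrable M (\<lambda>x. \<bar>u x\<bar> * e)"
    using radon_C0_integrable[OF radon u] by (intro integrable_mult_left integrable_abs)
  have key: "\<bar>l2_inner M u w\<bar> \<le> e * (\<integral>x. \<bar>u x\<bar> \<partial>M)" if w: "w \<in> L2 M" and we: "AE x in M. \<bar>w x\<bar> \<le> e" for w
  proof -
    have "\<bar>l2_inner M u w\<bar> \<le> (\<integral>x. \<bar>u x * w x\<bar> \<partial>M)"
      unfolding l2_inner_def using integral_norm_bound[of M "\<lambda>x. u x * w x"] by simp
    also have "\<dots> \<le> (\<integral>x. \<bar>u x\<bar> * e \<partial>M)"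
    proof (rule integral_mono_AE[OF _ ui])
      show "integrable M (\<lambda>x. \<bar>u x * w x\<bar>)" by (intro integrable_abs L2_mult_integrable uL w)
      show "AE x in M. \<bar>u x * w x\<bar> \<le> \<bar>u x\<bar> * e"
        using we by eventually_elim (simp add: abs_mult mult_left_mono)
    qed
    finally show ?thesis by (simp add: mult.commute)
  qed
  have 1: "\<bar>l2_inner M u v\<bar> \<le> e * (\<integral>x. \<bar>u x\<bar> \<partial>M)" by (rule key[OF vL]) (simp add: e)
  have 2: "\<bar>l2_inner M u (res b v)\<bar> \<le> e * (\<integral>x. \<bar>u x\<bar> \<partial>M)"
    by (rule key[OF res_L2[OF b vL] res_abs_le[OF b vL e e0]])
  have "approx_form b u v = b * (l2_inner M u v - l2_inner M u (res b v))"
    using res_symmetric[OF b uL vL] by (simp add: approx_form_def L2.diff_left uL vL res_L2[OF b uL])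
  then have "\<bar>approx_form b u v\<bar> = b * \<bar>l2_inner M u v - l2_inner M u (res b v)\<bar>"
    using b by (simp add: abs_mult)
  also have "\<dots> \<le> b * (2 * (e * (\<integral>x. \<bar>u x\<bar> \<partial>M)))"
    using 1 2 b by (intro mult_left_mono) auto
  finally show ?thesis by (simp add: mult_ac)
qed

end

text \<open>\<open>M\<close> and \<open>D\<close> stand for the measure \<open>\<mu>\<close> and the
  domain \<open>F\<close> of the theorem; \<open>m\<close> is the new reference measure.\<close>

locale energy_dominated_form = regular_dirichlet_form +
  fixes m :: "'a measure"
  assumes admissible_m: "admissible_reference_measure m"
    and dominated: "\<forall>f\<in>C0 \<inter> D. absolutely_continuous m (energy_measure E D f)"
begin

lemma radon_m: "radon_measure m"
  using admissible_m by (simp add: admissible_reference_measure_def)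

lemma core_L2_m: "f \<in> core \<Longrightarrow> f \<in> L2 m"
  using radon_C0_L2[OF radon_m] by blast

text \<open>The energy measure of f n varies with n, so dominated convergence is applied only to
  that of a fixed f N. Replacing f N by f n costs at most twice the energy of f n - f N, since p n
  has values in [0,1].\<close>

lemma unclipped_energy_tendsto_0:
  assumes f: "\<And>n. f n \<in> core" and c: "form_cauchy E f" and ae: "AE x in m. (\<lambda>n. f n x) \<longlonglongrightarrow> 0"
    and e: "e > 0"
  shows "(\<lambda>n. E (\<lambda>x. f n x - clip e (f n x)) (\<lambda>x. f n x - clip e (f n x))) \<longlonglongrightarrow> 0"
proof -
  define p where "p n x = min 1 (\<bar>f n x\<bar> / e)" for n x
  have p: "p n \<in> core" for n unfolding p_def by (rule unclipped_energy_le(1)[OF f e])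
  have p01: "0 \<le> p n x" "p n x \<le> 1" for n x using e by (auto simp: p_def)
  have lim1: "(\<lambda>n. energy_functional (f k) (p n)) \<longlonglongrightarrow> 0" for k
  proof -
    let ?\<nu> = "energy_measure E D (f k)"
    interpret finite_measure ?\<nu> by (rule finite_energy_measure[OF f])
    have r: "radon_measure ?\<nu>" by (rule radon_energy_measure[OF f])
    have "AE x in ?\<nu>. (\<lambda>n. f n x) \<longlonglongrightarrow> 0"
      using dominated f radon_sets[OF r] radon_sets[OF radon_m]
      by (intro absolutely_continuous_AE[OF _ _ ae]) auto
    then have ae0: "AE x in ?\<nu>. (\<lambda>n. p n x) \<longlonglongrightarrow> 0"
    proof eventually_elim
      case (elim x)
      have "(\<lambda>n. min 1 (\<bar>f n x\<bar> / e)) \<longlonglongrightarrow> min 1 (\<bar>0\<bar> / e)"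
        by (intro tendsto_intros elim) (use e in simp)
      then show ?case by (simp add: p_def)
    qed
    have "(\<lambda>n. \<integral>x. p n x \<partial>?\<nu>) \<longlonglongrightarrow> (\<integral>x. 0 \<partial>?\<nu>)"
    proof (rule integral_dominated_convergence[where w = "\<lambda>_. 1"])
      show "p n \<in> borel_measurable ?\<nu>" for n using radon_C0_measurable[OF r] p by blast
      show "AE x in ?\<nu>. norm (p n x) \<le> 1" for n using p01 by simp
    qed (use ae0 in auto)
    then show ?thesis by (simp add: integral_energy_measure[OF f p])
  qed
  have "(\<lambda>n. energy_functional (f n) (p n)) \<longlonglongrightarrow> 0"
  proof (rule LIMSEQ_I)
    fix d :: real assume d: "0 < d"
    obtain N where N: "\<And>i j. i \<ge> N \<Longrightarrow> j \<ge> N \<Longrightarrow> E (\<lambda>x. f i x - f j x) (\<lambda>x. f i x - f j x) < d / 4"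
      using c d unfolding form_cauchy_def by (meson divide_pos_pos zero_less_numeral)
    obtain N' where N': "\<And>n. n \<ge> N' \<Longrightarrow> energy_functional (f N) (p n) < d / 4"
      using order_tendstoD(2)[OF lim1, of "d / 4" N] d by (auto simp: eventually_sequentially)
    show "\<exists>no. \<forall>n\<ge>no. norm (energy_functional (f n) (p n) - 0) < d"
    proof (intro exI allI impI)
      fix n assume n: "n \<ge> max N N'"
      have "energy_functional (f n) (p n) \<le> 2 * energy_functional (f N) (p n)
          + 2 * energy_functional (\<lambda>x. f n x - f N x) (p n)"
        by (intro energy_functional_le_add f p p01)
      moreover have "energy_functional (\<lambda>x. f n x - f N x) (p n) \<le> 1 * E (\<lambda>x. f n x - f N x) (\<lambda>x. f n x - f N x)"
        by (intro energy_functional_le core_diff f p p01) simp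
      moreover have "0 \<le> energy_functional (f n) (p n)" by (intro energy_functional_nonneg f p p01)
      ultimately show "norm (energy_functional (f n) (p n) - 0) < d"
        using N[of n N] N'[of n] n by simp
    qed
  qed
  from tendsto_mult[OF tendsto_const this, of 2]
  have lim2: "(\<lambda>n. 2 * energy_functional (f n) (p n)) \<longlonglongrightarrow> 0" by simp
  show ?thesis
  proof (rule tendsto_sandwich[OF _ _ tendsto_const lim2])
    show "\<forall>\<^sub>F n in sequentially. E (\<lambda>x. f n x - clip e (f n x)) (\<lambda>x. f n x - clip e (f n x)) \<le> 2 * energy_functional (f n) (p n)"
      unfolding p_def by (intro always_eventually allI unclipped_energy_le(2) f e)
    show "\<forall>\<^sub>F n in sequentially. 0 \<le> E (\<lambda>x. f n x - clip e (f n x)) (\<lambda>x. f n x - clip e (f n x))"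
      by (intro always_eventually allI nonneg core_D core_diff core_clip f) (use e in simp)
  qed
qed

text \<open>With q the truncation of f n, T = f n - q and r = b G_b f_N, the energy is E(T, f n) +
  E(q, f n - f N) - E(q, r - f N) + E(q, r). The first three terms are small by Cauchy-Schwarz, the
  last because q is uniformly small.\<close>

lemma energy_tendsto_0_AE:
  assumes f: "\<And>n. f n \<in> core" and c: "form_cauchy E f" and ae: "AE x in m. (\<lambda>n. f n x) \<longlonglongrightarrow> 0"
  shows "(\<lambda>n. E (f n) (f n)) \<longlonglongrightarrow> 0"
proof (rule LIMSEQ_I)
  fix d :: real assume d: "0 < d"
  have fD: "f n \<in> D" for n using f by blast
  obtain K where K: "\<And>n. E (f n) (f n) \<le> K" using form_cauchy_bounded[OF fD c] by blast
  have K0: "0 \<le> K" using K[of 0] nonneg[OF fD, of 0] by linarith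
  define k where "k = sqrt K"
  have k0: "0 \<le> k" using K0 by (simp add: k_def)
  \<comment> \<open>Three Cauchy-Schwarz errors of size h * k and one resolvent error of size h add
    up to (3k + 1) h = d / 2.\<close>
  define h where "h = d / (2 * (3 * k + 1))"
  have h: "h > 0" using d k0 by (simp add: h_def)
  have "3 * k + 1 \<noteq> 0" using k0 by linarith
  moreover have "c * (d / (2 * c)) = d / 2" if "c \<noteq> 0" for c :: real using that by simp
  ultimately have "(3 * k + 1) * h = d / 2" unfolding h_def by blast
  then have hd: "(3 * k + 1) * h < d" using d by simp
  have h2: "h\<^sup>2 > 0" using h by simp
  obtain N where N: "\<And>i j. i \<ge> N \<Longrightarrow> j \<ge> N \<Longrightarrow> E (\<lambda>x. f i x - f j x) (\<lambda>x. f i x - f j x) < h\<^sup>2"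
    using c h2 unfolding form_cauchy_def by meson
  obtain j where j: "E (\<lambda>x. res (real (Suc j)) (f N) x - f N x) (\<lambda>x. res (real (Suc j)) (f N) x - f N x) < h\<^sup>2"
    using order_tendstoD(2)[OF res_tendsto_form[OF fD] h2, of N] by (auto simp: eventually_sequentially)
  define b where "b = real (Suc j)"
  have b: "b > 0" by (simp add: b_def)
  define l where "l = (\<integral>x. \<bar>f N x\<bar> \<partial>M)"
  have l: "0 \<le> l" by (simp add: l_def)
  \<comment> \<open>The truncation level is fixed after N and b, since it must beat the factor 2 b
    l; the summand 1 avoids division by 0 when l vanishes.\<close>
  define e where "e = h / (2 * b * l + 1)"
  have "2 * b * l + 1 > 0" using b l by (intro add_nonneg_pos mult_nonneg_nonneg) auto
  then have e: "e > 0" "2 * b * e * l \<le> h" using h by (auto simp: e_def field_simps)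
  obtain N' where N': "\<And>n. n \<ge> N' \<Longrightarrow> E (\<lambda>x. f n x - clip e (f n x)) (\<lambda>x. f n x - clip e (f n x)) < h\<^sup>2"
    using order_tendstoD(2)[OF unclipped_energy_tendsto_0[OF f c ae e(1)] h2] by (auto simp: eventually_sequentially)
  have sq: "sqrt (E u u) \<le> h" if "E u u < h\<^sup>2" for u
    using real_sqrt_le_mono[OF less_imp_le[OF that]] h by simp
  have sk: "sqrt (E u u) \<le> k" if "E u u \<le> K" for u
    using that by (simp add: k_def)
  show "\<exists>no. \<forall>n\<ge>no. norm (E (f n) (f n) - 0) < d"
  proof (intro exI allI impI)
    fix n assume n: "n \<ge> max N N'"
    define q where "q x = clip e (f n x)" for x
    define T where "T x = f n x - clip e (f n x)" for x
    have q: "q \<in> core" unfolding q_def by (intro core_clip f) (use e in simp)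
    have T: "T \<in> core" using core_diff[OF f q] by (simp add: T_def[abs_def] q_def[abs_def])
    have qD: "q \<in> D" and TD: "T \<in> D" using q T by auto
    have Eq: "E q q \<le> K" using core_clip(2)[OF f, of e n] K[of n] e(1) by (simp add: q_def[abs_def])
    define g where "g x = res b (f N) x - f N x" for x
    have rD: "res b (f N) \<in> D" by (intro res_mem b mem_L2 fD)
    have gD: "g \<in> D" unfolding g_def by (intro mem rD fD)
    define w where "w x = f n x - f N x" for x
    have wD: "w \<in> D" unfolding w_def by (intro mem fD)
    have "E (f n) (f n) = E T (f n) + E q (f n)"
    proof -
      have "E (\<lambda>x. T x + q x) (f n) = E T (f n) + E q (f n)" by (intro add_left TD qD fD)
      moreover have "(\<lambda>x. T x + q x) = f n" by (simp add: T_def q_def)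
      ultimately show ?thesis by simp
    qed
    moreover have "E T (f n) \<le> h * k"
    proof -
      have "E T (f n) \<le> sqrt (E T T) * sqrt (E (f n) (f n))"
        using Cauchy_Schwarz[OF TD fD] by (simp add: abs_le_iff)
      also have "\<dots> \<le> h * k"
        using N'[of n] n K[of n] h k0 by (intro mult_mono sq sk) (auto simp: T_def[abs_def] nonneg fD)
      finally show ?thesis .
    qed
    moreover have "E q (f n) = E q w - E q g + E q (res b (f N))"
      by (simp add: w_def[abs_def] g_def[abs_def] diff_right qD fD rD)
    moreover have "E q w \<le> k * h"
    proof -
      have "E q w \<le> sqrt (E q q) * sqrt (E w w)"
        using Cauchy_Schwarz[OF qD wD] by (simp add: abs_le_iff)
      also have "\<dots> \<le> k * h"
        using N[of n N] n Eq h k0 by (intro mult_mono sq sk) (auto simp: w_def[abs_def] intro!: nonneg diff_mem fD)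
      finally show ?thesis .
    qed
    moreover have "- E q g \<le> k * h"
    proof -
      have "- E q g \<le> sqrt (E q q) * sqrt (E g g)"
        using Cauchy_Schwarz[OF qD gD] by (simp add: abs_le_iff)
      also have "\<dots> \<le> k * h"
        using j[folded b_def] Eq h k0 by (intro mult_mono sq sk) (auto simp: g_def[abs_def] intro!: nonneg diff_mem fD rD)
      finally show ?thesis .
    qed
    moreover have "E q (res b (f N)) \<le> h"
    proof -
      have "E q (res b (f N)) = approx_form b (f N) q"
        using approx_form_eq[OF b mem_L2[OF fD] qD] sym[OF qD rD] by simp
      also have "\<dots> \<le> 2 * b * e * l"
      proof -
        have "\<bar>q x\<bar> \<le> e" for x unfolding q_def using e(1) by (intro clip_abs_le) simp
        then have "\<bar>approx_form b (f N) q\<bar> \<le> 2 * b * e * (\<integral>x. \<bar>f N x\<bar> \<partial>M)"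
          using f[of N] q by (intro approx_form_small b e(1)) auto
        then show ?thesis by (simp add: l_def abs_le_iff)
      qed
      also have "\<dots> \<le> h" by (rule e(2))
      finally show ?thesis .
    qed
    ultimately have "E (f n) (f n) \<le> (3 * k + 1) * h" by (simp add: algebra_simps)
    then show "norm (E (f n) (f n) - 0) < d" using hd nonneg[OF fD, of n] by simp
  qed
qed

text \<open>L2 convergence gives a.e. convergence only along subsequences. A subsequence whose
  energies stay away from 0 would have a further subsequence to which
  \<open>energy_tendsto_0_AE\<close> applies.\<close>

theorem closable_core: "closable m E core"
  unfolding closable_def
proof (intro conjI allI impI)
  show "core \<subseteq> L2 m" using core_L2_m by blast
  fix f assume "(\<forall>n. f n \<in> core) \<and> form_cauchy E f \<and> (\<lambda>n. l2_norm m (f n)) \<longlonglongrightarrow> 0"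
  then have f: "\<And>n. f n \<in> core" and c: "form_cauchy E f" and l: "(\<lambda>n. l2_norm m (f n)) \<longlonglongrightarrow> 0" by auto
  show "(\<lambda>n. E (f n) (f n)) \<longlonglongrightarrow> 0"
  proof (rule ccontr)
    assume "\<not> (\<lambda>n. E (f n) (f n)) \<longlonglongrightarrow> 0"
    then obtain d where d: "d > 0" "\<not> (\<forall>\<^sub>F n in sequentially. dist (E (f n) (f n)) 0 < d)"
      unfolding tendsto_iff by blast
    then have "infinite {n. \<not> dist (E (f n) (f n)) 0 < d}"
      by (simp add: cofinite_eq_sequentially[symmetric] eventually_cofinite)
    then obtain r :: "nat \<Rightarrow> nat" where r: "strict_mono r" "\<And>n. \<not> dist (E (f (r n)) (f (r n))) 0 < d"
      using infinite_enumerate[of "{n. \<not> dist (E (f n) (f n)) 0 < d}"] by auto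
    have "(\<lambda>n. l2_norm m (f (r n))) \<longlonglongrightarrow> 0"
      using LIMSEQ_subseq_LIMSEQ[OF l r(1)] by (simp add: o_def)
    from l2_norm_tendsto_0_AE_subseq[OF core_L2_m[OF f] this]
    obtain s :: "nat \<Rightarrow> nat" where s: "strict_mono s" "AE x in m. (\<lambda>n. f (r (s n)) x) \<longlonglongrightarrow> 0" by blast
    have "(\<lambda>n. E (f (r (s n))) (f (r (s n)))) \<longlonglongrightarrow> 0"
      by (rule energy_tendsto_0_AE[OF f form_cauchy_subseq[OF form_cauchy_subseq[OF c r(1)] s(1)] s(2)])
    from tendstoD[OF this d(1)] obtain n where "dist (E (f (r (s n))) (f (r (s n)))) 0 < d"
      by (auto simp: eventually_sequentially)
    then show False using r(2)[of "s n"] by simp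
  qed
qed

end

section \<open>Completeness of the space of square integrable functions\<close>

text \<open>Riesz-Fischer for representatives: a fast subsequence converges almost everywhere, and
  Fatou's lemma turns the Cauchy estimates into estimates against the pointwise limit.\<close>

lemma L2_complete:
  assumes f: "\<And>n. f n \<in> L2 M" and c: "form_cauchy (l2_inner M) f"
  obtains u where "u \<in> L2 M" "(\<lambda>n. l2_norm M (\<lambda>x. f n x - u x)) \<longlonglongrightarrow> 0"
proof -
  have [measurable]: "f n \<in> borel_measurable M" for n by (rule L2_measurable[OF f])
  have "\<exists>N. \<forall>i\<ge>N. \<forall>j\<ge>N. l2_inner M (\<lambda>x. f i x - f j x) (\<lambda>x. f i x - f j x) < (1/16) ^ k" for k
    using c unfolding form_cauchy_def by simp
  then obtain N where N: "\<And>k i j. i \<ge> N k \<Longrightarrow> j \<ge> N k \<Longrightarrow>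
      l2_inner M (\<lambda>x. f i x - f j x) (\<lambda>x. f i x - f j x) < (1/16) ^ k" by metis
  \<comment> \<open>Adding k and all earlier thresholds makes r strictly increasing while keeping r
    k at least N k.\<close>
  define r where "r k = k + (\<Sum>i\<le>k. N i)" for k
  have rN: "N k \<le> r k" for k
    using member_le_sum[of k "{..k}" N] by (simp add: r_def)
  have rs: "strict_mono r" by (rule strict_mono_Suc_iff[THEN iffD2]) (simp add: r_def)
  have rm: "r k \<le> r (Suc k)" for k by (simp add: r_def)
  \<comment> \<open>Increments with squared norm below 16^(-k), rescaled by 2^k, have squared norm
    at most 4^(-k), which is summable. That g k tends to 0 a.e. then bounds the increments by 2^(-k)
    from some index on.\<close>
  define g where "g k x = 2 ^ k * (f (r (Suc k)) x - f (r k) x)" for k x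
  have gL: "g k \<in> L2 M" for k unfolding g_def by (intro L2.mem f)
  have "l2_inner M (g k) (g k) \<le> (1/4) ^ k" for k
  proof -
    have "l2_inner M (g k) (g k) = 4 ^ k * l2_inner M (\<lambda>x. f (r (Suc k)) x - f (r k) x) (\<lambda>x. f (r (Suc k)) x - f (r k) x)"
      unfolding g_def by (simp only: L2.scale_left L2.scale_right L2.scale_mem L2.diff_mem f mult.assoc[symmetric] power_mult_distrib[symmetric]) simp
    also have "\<dots> \<le> 4 ^ k * (1/16) ^ k"
      using N[of k "r (Suc k)" "r k"] rN[of k] rm[of k] by (intro mult_left_mono) auto
    also have "\<dots> = (1/4) ^ k" by (simp add: power_mult_distrib[symmetric])
    finally show ?thesis .
  qed
  then have "summable (\<lambda>k. l2_inner M (g k) (g k))"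
    by (intro summable_comparison_test'[OF summable_geometric[of "1/4 :: real"]]) (auto simp: l2_inner_self_nonneg)
  then have "AE x in M. (\<lambda>k. g k x) \<longlonglongrightarrow> 0" by (rule l2_summable_AE[OF gL])
  then have conv: "AE x in M. convergent (\<lambda>k. f (r k) x)"
  proof eventually_elim
    case (elim x)
    then obtain K where K: "\<And>k. k \<ge> K \<Longrightarrow> norm (g k x) < 1"
      using LIMSEQ_D[OF elim, of 1] by auto
    have "norm (f (r (Suc k)) x - f (r k) x) \<le> (1/2) ^ k" if "k \<ge> K" for k
    proof -
      have "2 ^ k * \<bar>f (r (Suc k)) x - f (r k) x\<bar> < 1" using K[OF that] by (simp add: g_def abs_mult)
      then show ?thesis by (simp add: field_simps)
    qed
    then have "summable (\<lambda>k. f (r (Suc k)) x - f (r k) x)"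
      by (intro summable_comparison_test'[OF summable_geometric[of "1/2 :: real"], of K]) auto
    then have "convergent (\<lambda>n. f (r n) x - f (r 0) x)"
      unfolding summable_iff_convergent using sum_lessThan_telescope[of "\<lambda>k. f (r k) x"] by simp
    then show ?case by (simp add: convergent_diff_const_right_iff)
  qed
  define u where "u x = lim (\<lambda>k. f (r k) x)" for x
  have um[measurable]: "u \<in> borel_measurable M"
    unfolding u_def by (intro borel_measurable_lim_metric) simp
  have lim: "AE x in M. (\<lambda>k. f (r k) x) \<longlonglongrightarrow> u x"
    using conv by eventually_elim (simp add: u_def convergent_LIMSEQ_iff)
  have est: "(\<lambda>x. f n x - u x) \<in> L2 M \<and> l2_inner M (\<lambda>x. f n x - u x) (\<lambda>x. f n x - u x) \<le> e"
    if e: "e > 0" and n: "n \<ge> N0" and N0: "\<And>i j. i \<ge> N0 \<Longrightarrow> j \<ge> N0 \<Longrightarrow> l2_inner M (\<lambda>x. f i x - f j x) (\<lambda>x. f i x - f j x) < e"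
    for e n N0
  proof -
    have nn: "(\<integral>\<^sup>+x. ennreal ((f n x - f j x)\<^sup>2) \<partial>M) = ennreal (l2_inner M (\<lambda>x. f n x - f j x) (\<lambda>x. f n x - f j x))" for j
      using L2.diff_mem[OF f f, of n j]
      by (subst nn_integral_eq_integral) (auto simp: L2_def l2_inner_def power2_eq_square)
    have "(\<integral>\<^sup>+x. ennreal ((f n x - u x)\<^sup>2) \<partial>M) = (\<integral>\<^sup>+x. liminf (\<lambda>k. ennreal ((f n x - f (r k) x)\<^sup>2)) \<partial>M)"
    proof (rule nn_integral_cong_AE)
      show "AE x in M. ennreal ((f n x - u x)\<^sup>2) = liminf (\<lambda>k. ennreal ((f n x - f (r k) x)\<^sup>2))"
        using lim
      proof eventually_elim
        case (elim x)
        have "(\<lambda>k. ennreal ((f n x - f (r k) x)\<^sup>2)) \<longlonglongrightarrow> ennreal ((f n x - u x)\<^sup>2)"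
          by (intro tendsto_ennrealI tendsto_intros elim)
        from lim_imp_Liminf[OF _ this] show ?case by simp
      qed
    qed
    also have "\<dots> \<le> liminf (\<lambda>k. \<integral>\<^sup>+x. ennreal ((f n x - f (r k) x)\<^sup>2) \<partial>M)"
      by (rule nn_integral_liminf) measurable
    also have "\<dots> \<le> ennreal e"
    proof (rule Liminf_le)
      show "\<forall>\<^sub>F k in sequentially. (\<integral>\<^sup>+x. ennreal ((f n x - f (r k) x)\<^sup>2) \<partial>M) \<le> ennreal e"
        unfolding nn eventually_sequentially
        using N0[OF n] seq_suble[OF rs] by (intro exI[of _ N0] allI impI ennreal_leI less_imp_le) (meson order_trans)
    qed simp
    finally have le: "(\<integral>\<^sup>+x. ennreal ((f n x - u x)\<^sup>2) \<partial>M) \<le> ennreal e" .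
    then have i: "integrable M (\<lambda>x. (f n x - u x)\<^sup>2)"
      by (intro integrableI_nonneg) (auto simp: top_unique less_top[symmetric] intro: le_less_trans)
    then have "(\<integral>\<^sup>+x. ennreal ((f n x - u x)\<^sup>2) \<partial>M) = ennreal (\<integral>x. (f n x - u x)\<^sup>2 \<partial>M)"
      by (intro nn_integral_eq_integral) auto
    with le e have "(\<integral>x. (f n x - u x)\<^sup>2 \<partial>M) \<le> e" by (simp add: ennreal_le_iff)
    with i show ?thesis by (auto simp: L2_def l2_inner_def power2_eq_square)
  qed
  have lim0: "(\<lambda>n. l2_inner M (\<lambda>x. f n x - u x) (\<lambda>x. f n x - u x)) \<longlonglongrightarrow> 0"
  proof (rule LIMSEQ_I)
    fix e :: real assume e: "e > 0"
    then obtain N0 where N0: "\<And>i j. i \<ge> N0 \<Longrightarrow> j \<ge> N0 \<Longrightarrow> l2_inner M (\<lambda>x. f i x - f j x) (\<lambda>x. f i x - f j x) < e / 2"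
      using c half_gt_zero[OF e] unfolding form_cauchy_def by meson
    show "\<exists>no. \<forall>n\<ge>no. norm (l2_inner M (\<lambda>x. f n x - u x) (\<lambda>x. f n x - u x) - 0) < e"
    proof (intro exI allI impI)
      fix n assume "n \<ge> N0"
      then have "l2_inner M (\<lambda>x. f n x - u x) (\<lambda>x. f n x - u x) \<le> e / 2" using est[OF half_gt_zero[OF e] _ N0] by blast
      then show "norm (l2_inner M (\<lambda>x. f n x - u x) (\<lambda>x. f n x - u x) - 0) < e"
        using e l2_inner_self_nonneg[of M "\<lambda>x. f n x - u x"] by simp
    qed
  qed
  have "u \<in> L2 M"
  proof -
    obtain N0 where "\<And>i j. i \<ge> N0 \<Longrightarrow> j \<ge> N0 \<Longrightarrow> l2_inner M (\<lambda>x. f i x - f j x) (\<lambda>x. f i x - f j x) < 1"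
      using c zero_less_one unfolding form_cauchy_def by meson
    then have "(\<lambda>x. f N0 x - u x) \<in> L2 M" using est[of 1 N0 N0] by simp
    from L2.diff_mem[OF f[of N0] this] show ?thesis by simp
  qed
  then show thesis using that lim0 by (simp add: l2_norm_tendsto_0_iff)
qed

section \<open>The closure of a closable form\<close>

lemma symmetric_formD:
  assumes "symmetric_form M E D"
  shows "nonneg_form D E" "nonneg_form D (form1 M E)" "D \<subseteq> L2 M"
proof -
  show n: "nonneg_form D E" using assms unfolding symmetric_form_def by unfold_locales blast+
  interpret nonneg_form D E by (rule n)
  show L: "D \<subseteq> L2 M" using assms by (simp add: symmetric_form_def)
  then have m: "u \<in> L2 M" if "u \<in> D" for u using that by blast
  show "nonneg_form D (form1 M E)"
  proof
    show "form1 M E (\<lambda>x. a * u x + b * v x) w = a * form1 M E u w + b * form1 M E v w"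
      if "u \<in> D" "v \<in> D" "w \<in> D" for u v w a b
      using that by (simp add: form1_def lin_left L2.lin_left m algebra_simps)
    show "form1 M E u v = form1 M E v u" if "u \<in> D" "v \<in> D" for u v
      using that by (simp add: form1_def sym[OF that] L2.sym m)
  qed (auto simp: zero_mem lin_mem form1_def nonneg l2_inner_self_nonneg)
qed

text \<open>Closure of an abstract closable form. \<open>M\<close> is the measure over which the
  closure is taken and will be \<open>m\<close>; density is required here because
  \<open>symmetric_form\<close> includes it.\<close>

locale closable_nonneg_form = nonneg_form C E for C :: "('a \<Rightarrow> real) set" and E +
  fixes M :: "'a measure"
  assumes closable: "closable M E C"
    and dense: "u \<in> L2 M \<Longrightarrow> \<epsilon> > 0 \<Longrightarrow> \<exists>v\<in>C. l2_norm M (\<lambda>x. u x - v x) < \<epsilon>"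
begin

abbreviation "Dbar \<equiv> closure_domain M E C"
abbreviation "Ebar \<equiv> closure_form M E C"

lemma C_L2: "u \<in> C \<Longrightarrow> u \<in> L2 M"
  using closable by (auto simp: closable_def)

lemma approximatesD:
  assumes "approximates M E C f u"
  shows "f n \<in> C" "form_cauchy E f" "(\<lambda>n. l2_norm M (\<lambda>x. f n x - u x)) \<longlonglongrightarrow> 0"
  using assms by (auto simp: approximates_def)

lemma closure_domainE:
  assumes "u \<in> Dbar"
  obtains f where "u \<in> L2 M" "approximates M E C f u"
  using assms by (auto simp: closure_domain_def)

lemma closure_domainI: "u \<in> L2 M \<Longrightarrow> approximates M E C f u \<Longrightarrow> u \<in> Dbar"
  by (auto simp: closure_domain_def)

lemma closure_domain_L2: "u \<in> Dbar \<Longrightarrow> u \<in> L2 M"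
  by (auto simp: closure_domain_def)

lemma approximates_lin:
  assumes f: "approximates M E C f u" and g: "approximates M E C g v" and u: "u \<in> L2 M" and v: "v \<in> L2 M"
  shows "approximates M E C (\<lambda>n x. a * f n x + b * g n x) (\<lambda>x. a * u x + b * v x)"
  unfolding approximates_def
proof (intro conjI allI)
  note fC = approximatesD(1)[OF f] and gC = approximatesD(1)[OF g]
  show "(\<lambda>x. a * f n x + b * g n x) \<in> C" for n by (intro lin_mem fC gC)
  show "form_cauchy E (\<lambda>n x. a * f n x + b * g n x)"
    unfolding form_cauchy_def
  proof (intro allI impI)
    fix e :: real assume e: "e > 0"
    define d where "d = e / (2 * a\<^sup>2 + 2 * b\<^sup>2 + 1)"
    have p: "2 * a\<^sup>2 + 2 * b\<^sup>2 + 1 > 0" by (intro add_nonneg_pos) auto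
    have d: "d > 0" using e p by (simp add: d_def)
    have de: "2 * a\<^sup>2 * d + 2 * b\<^sup>2 * d < e"
    proof -
      have "e = (2 * a\<^sup>2 + 2 * b\<^sup>2 + 1) * d" using p by (simp add: d_def)
      then show ?thesis using d by (simp add: algebra_simps)
    qed
    obtain N1 N2 where N: "\<And>i j. i \<ge> N1 \<Longrightarrow> j \<ge> N1 \<Longrightarrow> E (\<lambda>x. f i x - f j x) (\<lambda>x. f i x - f j x) < d"
      "\<And>i j. i \<ge> N2 \<Longrightarrow> j \<ge> N2 \<Longrightarrow> E (\<lambda>x. g i x - g j x) (\<lambda>x. g i x - g j x) < d"
      using approximatesD(2)[OF f] approximatesD(2)[OF g] d unfolding form_cauchy_def by meson
    show "\<exists>N. \<forall>i\<ge>N. \<forall>j\<ge>N. E (\<lambda>x. a * f i x + b * g i x - (a * f j x + b * g j x)) (\<lambda>x. a * f i x + b * g i x - (a * f j x + b * g j x)) < e"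
    proof (intro exI allI impI)
      fix i j assume ij: "i \<ge> max N1 N2" "j \<ge> max N1 N2"
      let ?p = "\<lambda>x. f i x - f j x" and ?q = "\<lambda>x. g i x - g j x"
      have pq: "?p \<in> C" "?q \<in> C" by (intro diff_mem fC gC)+
      have "(\<lambda>x. a * f i x + b * g i x - (a * f j x + b * g j x)) = (\<lambda>x. a * ?p x + b * ?q x)"
        by (simp add: algebra_simps)
      moreover have "E (\<lambda>x. a * ?p x + b * ?q x) (\<lambda>x. a * ?p x + b * ?q x) \<le> 2 * (a\<^sup>2 * E ?p ?p) + 2 * (b\<^sup>2 * E ?q ?q)"
        using add_le[OF scale_mem[OF pq(1), of a] scale_mem[OF pq(2), of b]]
        by (simp only: scale_left scale_right scale_mem pq power2_eq_square mult.assoc)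
      moreover have "a\<^sup>2 * E ?p ?p \<le> a\<^sup>2 * d" "b\<^sup>2 * E ?q ?q \<le> b\<^sup>2 * d"
        using N(1)[of i j] N(2)[of i j] ij by (auto intro!: mult_left_mono)
      ultimately show "E (\<lambda>x. a * f i x + b * g i x - (a * f j x + b * g j x)) (\<lambda>x. a * f i x + b * g i x - (a * f j x + b * g j x)) < e"
        using de by simp
    qed
  qed
  show "(\<lambda>n. l2_norm M (\<lambda>x. a * f n x + b * g n x - (a * u x + b * v x))) \<longlonglongrightarrow> 0"
  proof (rule tendsto_sandwich[OF _ _ tendsto_const])
    show "(\<lambda>n. \<bar>a\<bar> * l2_norm M (\<lambda>x. f n x - u x) + \<bar>b\<bar> * l2_norm M (\<lambda>x. g n x - v x)) \<longlonglongrightarrow> 0"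
      using tendsto_add[OF tendsto_mult[OF tendsto_const approximatesD(3)[OF f]] tendsto_mult[OF tendsto_const approximatesD(3)[OF g]],
          of "\<bar>a\<bar>" "\<bar>b\<bar>"] by simp
    show "\<forall>\<^sub>F n in sequentially. l2_norm M (\<lambda>x. a * f n x + b * g n x - (a * u x + b * v x))
        \<le> \<bar>a\<bar> * l2_norm M (\<lambda>x. f n x - u x) + \<bar>b\<bar> * l2_norm M (\<lambda>x. g n x - v x)"
    proof (intro always_eventually allI)
      fix n
      have L: "(\<lambda>x. f n x - u x) \<in> L2 M" "(\<lambda>x. g n x - v x) \<in> L2 M"
        by (intro L2.diff_mem C_L2 fC gC u v)+
      have "(\<lambda>x. a * f n x + b * g n x - (a * u x + b * v x)) = (\<lambda>x. a * (f n x - u x) + b * (g n x - v x))"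
        by (simp add: algebra_simps)
      then show "l2_norm M (\<lambda>x. a * f n x + b * g n x - (a * u x + b * v x))
        \<le> \<bar>a\<bar> * l2_norm M (\<lambda>x. f n x - u x) + \<bar>b\<bar> * l2_norm M (\<lambda>x. g n x - v x)"
        using l2_norm_triangle[OF L2.scale_mem[OF L(1), of a] L2.scale_mem[OF L(2), of b]]
        by (simp only: l2_norm_scale L)
    qed
  qed (auto simp: l2_norm_nonneg)
qed

lemma approximates_diff:
  assumes "approximates M E C f u" "approximates M E C g v" "u \<in> L2 M" "v \<in> L2 M"
  shows "approximates M E C (\<lambda>n x. f n x - g n x) (\<lambda>x. u x - v x)"
  using approximates_lin[OF assms, of 1 "-1"] by simp

lemma approximates_const: "u \<in> C \<Longrightarrow> approximates M E C (\<lambda>_. u) u"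
  by (auto simp: approximates_def form_cauchy_def zero_left zero_mem l2_norm_def l2_inner_def)

lemma approximates_zero:
  assumes "approximates M E C f (\<lambda>x. 0)"
  shows "(\<lambda>n. E (f n) (f n)) \<longlonglongrightarrow> 0"
  using assms closable unfolding approximates_def closable_def by simp

lemma approximates_convergent:
  assumes f: "approximates M E C f u" and g: "approximates M E C g v"
  shows "convergent (\<lambda>n. E (f n) (g n))"
proof (rule Cauchy_convergent, rule metric_CauchyI)
  fix e :: real assume e: "e > 0"
  note fC = approximatesD(1)[OF f] and gC = approximatesD(1)[OF g]
  note fc = approximatesD(2)[OF f] and gc = approximatesD(2)[OF g]
  obtain K1 where K1: "\<And>n. E (f n) (f n) \<le> K1" using form_cauchy_bounded[OF fC fc] by blast
  obtain K2 where K2: "\<And>n. E (g n) (g n) \<le> K2" using form_cauchy_bounded[OF gC gc] by blast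
  define k where "k = sqrt K1 + sqrt K2 + 1"
  have K0: "0 \<le> K1" "0 \<le> K2" using K1[of 0] K2[of 0] nonneg[OF fC, of 0] nonneg[OF gC, of 0] by linarith+
  have s0: "0 \<le> sqrt K1" "0 \<le> sqrt K2" using K0 by simp_all
  have s1: "sqrt (E (f n) (f n)) \<le> sqrt K1" "sqrt (E (g n) (g n)) \<le> sqrt K2" for n
    by (intro real_sqrt_le_mono K1 K2)+
  have k0: "k > 0" unfolding k_def using s0 by (intro add_nonneg_pos add_nonneg_nonneg) auto
  have k1: "sqrt (E (f n) (f n)) \<le> k" for n
    by (rule order_trans[OF s1(1)]) (use s0 in \<open>simp add: k_def\<close>)
  have k2: "sqrt (E (g n) (g n)) \<le> k" for n
    by (rule order_trans[OF s1(2)]) (use s0 in \<open>simp add: k_def\<close>)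
  note k = k0 k1 k2
  define d where "d = (e / (4 * k))\<^sup>2"
  have d: "d > 0" using e k by (simp add: d_def)
  have sd: "sqrt y \<le> e / (4 * k)" if "y < d" for y
    using real_sqrt_le_mono[OF less_imp_le[OF that]] e k by (simp add: d_def)
  obtain N1 N2 where N: "\<And>i j. i \<ge> N1 \<Longrightarrow> j \<ge> N1 \<Longrightarrow> E (\<lambda>x. f i x - f j x) (\<lambda>x. f i x - f j x) < d"
      "\<And>i j. i \<ge> N2 \<Longrightarrow> j \<ge> N2 \<Longrightarrow> E (\<lambda>x. g i x - g j x) (\<lambda>x. g i x - g j x) < d"
      using fc gc d unfolding form_cauchy_def by meson
  show "\<exists>N. \<forall>m\<ge>N. \<forall>n\<ge>N. dist (E (f m) (g m)) (E (f n) (g n)) < e"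
  proof (intro exI allI impI)
    fix i j assume ij: "i \<ge> max N1 N2" "j \<ge> max N1 N2"
    let ?p = "\<lambda>x. f i x - f j x" and ?q = "\<lambda>x. g i x - g j x"
    have pq: "?p \<in> C" "?q \<in> C" by (intro diff_mem fC gC)+
    have "E (f i) (g i) - E (f j) (g j) = E ?p (g i) + E (f j) ?q"
      by (simp add: diff_left diff_right fC gC)
    moreover have "\<bar>E ?p (g i)\<bar> \<le> e / (4 * k) * k"
      using order_trans[OF Cauchy_Schwarz[OF pq(1) gC[of i]] mult_mono[OF sd[OF N(1)[of i j]] k(3)[of i]]] ij e k(1)
      by (simp add: nonneg pq gC)
    moreover have "\<bar>E (f j) ?q\<bar> \<le> k * (e / (4 * k))"
      using order_trans[OF Cauchy_Schwarz[OF fC[of j] pq(2)] mult_mono[OF k(2)[of j] sd[OF N(2)[of i j]]]] ij e k(1)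
      by (simp add: nonneg pq fC)
    moreover have "e / (4 * k) * k = e / 4" "k * (e / (4 * k)) = e / 4" using k(1) by simp_all
    ultimately have "E (f i) (g i) - E (f j) (g j) = E ?p (g i) + E (f j) ?q" "\<bar>E ?p (g i)\<bar> \<le> e / 4" "\<bar>E (f j) ?q\<bar> \<le> e / 4"
      by simp_all
    then show "dist (E (f i) (g i)) (E (f j) (g j)) < e"
      using e unfolding dist_real_def by linarith
  qed
qed

text \<open>The place where closability acts: f n - f' n approximates 0, so its energy tends to 0,
  and Cauchy-Schwarz against the bounded energies of g n finishes.\<close>

lemma approximates_form_diff:
  assumes f: "approximates M E C f u" and f': "approximates M E C f' u" and u: "u \<in> L2 M"
    and g: "approximates M E C g v"
  shows "(\<lambda>n. E (f n) (g n) - E (f' n) (g n)) \<longlonglongrightarrow> 0"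
proof -
  note fC = approximatesD(1)[OF f] and gC = approximatesD(1)[OF g] and f'C = approximatesD(1)[OF f']
  let ?p = "\<lambda>n x. f n x - f' n x"
  have pC: "?p n \<in> C" for n by (intro diff_mem fC f'C)
  have "approximates M E C ?p (\<lambda>x. 0)" using approximates_diff[OF f f' u u] by simp
  then have "(\<lambda>n. E (?p n) (?p n)) \<longlonglongrightarrow> 0" by (rule approximates_zero)
  from tendsto_real_sqrt[OF this] have p0: "(\<lambda>n. sqrt (E (?p n) (?p n))) \<longlonglongrightarrow> 0" by simp
  obtain K where K: "\<And>n. E (g n) (g n) \<le> K" using form_cauchy_bounded[OF gC approximatesD(2)[OF g]] by blast
  have "(\<lambda>n. E (?p n) (g n)) \<longlonglongrightarrow> 0"
  proof (rule tendsto_rabs_zero_cancel, rule tendsto_sandwich[OF _ _ tendsto_const])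
    show "(\<lambda>n. sqrt (E (?p n) (?p n)) * sqrt K) \<longlonglongrightarrow> 0"
      using tendsto_mult[OF p0 tendsto_const, of "sqrt K"] by simp
    show "\<forall>\<^sub>F n in sequentially. \<bar>E (?p n) (g n)\<bar> \<le> sqrt (E (?p n) (?p n)) * sqrt K"
    proof (intro always_eventually allI)
      fix n
      show "\<bar>E (?p n) (g n)\<bar> \<le> sqrt (E (?p n) (?p n)) * sqrt K"
        by (rule order_trans[OF Cauchy_Schwarz[OF pC gC]])
          (intro mult_left_mono real_sqrt_le_mono K, simp add: nonneg pC)
    qed
  qed auto
  then show ?thesis by (simp add: diff_left fC f'C gC)
qed

text \<open>The description in \<open>closure_form\<close> ranges over all pairs of approximating
  sequences. Exchanging one sequence at a time shows that every pair has the same limit, and thus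
  that the description denotes it.\<close>

lemma closure_form_tendsto:
  assumes f: "approximates M E C f u" and g: "approximates M E C g v" and u: "u \<in> L2 M" and v: "v \<in> L2 M"
  shows "(\<lambda>n. E (f n) (g n)) \<longlonglongrightarrow> Ebar u v"
proof -
  obtain l where l: "(\<lambda>n. E (f n) (g n)) \<longlonglongrightarrow> l"
    using approximates_convergent[OF f g] by (auto simp: convergent_def)
  have P: "(\<lambda>n. E (f' n) (g' n)) \<longlonglongrightarrow> l" if f': "approximates M E C f' u" and g': "approximates M E C g' v" for f' g'
  proof -
    have 1: "(\<lambda>n. E (f n) (g n) - E (f' n) (g n)) \<longlonglongrightarrow> 0" by (rule approximates_form_diff[OF f f' u g])
    have "(\<lambda>n. E (g n) (f' n) - E (g' n) (f' n)) \<longlonglongrightarrow> 0" by (rule approximates_form_diff[OF g g' v f'])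
    then have 2: "(\<lambda>n. E (f' n) (g n) - E (f' n) (g' n)) \<longlonglongrightarrow> 0"
      by (simp add: sym[OF approximatesD(1)[OF f']] approximatesD(1)[OF g] approximatesD(1)[OF g'])
    show ?thesis using tendsto_diff[OF tendsto_diff[OF l 1] 2] by simp
  qed
  have "Ebar u v = l"
    unfolding closure_form_def
  proof (rule the_equality)
    show "\<forall>f g. approximates M E C f u \<and> approximates M E C g v \<longrightarrow> (\<lambda>n. E (f n) (g n)) \<longlonglongrightarrow> l"
      using P by blast
    fix l' assume "\<forall>f g. approximates M E C f u \<and> approximates M E C g v \<longrightarrow> (\<lambda>n. E (f n) (g n)) \<longlonglongrightarrow> l'"
    then have "(\<lambda>n. E (f n) (g n)) \<longlonglongrightarrow> l'" using f g by blast
    then show "l' = l" using l by (rule LIMSEQ_unique)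
  qed
  with l show ?thesis by simp
qed

lemma core_mem: "u \<in> C \<Longrightarrow> u \<in> Dbar"
  by (rule closure_domainI[OF C_L2 approximates_const])

lemma closure_form_core: "u \<in> C \<Longrightarrow> v \<in> C \<Longrightarrow> Ebar u v = E u v"
  using closure_form_tendsto[OF approximates_const approximates_const C_L2 C_L2, of u v] by (simp add: LIMSEQ_const_iff)

lemma symmetric_form_closure: "symmetric_form M Ebar Dbar"
  unfolding symmetric_form_def
proof (intro conjI ballI allI impI)
  show "Dbar \<subseteq> L2 M" using closure_domain_L2 by blast
  show "(\<lambda>_. 0) \<in> Dbar" by (rule core_mem[OF zero_mem])
  fix u v assume u: "u \<in> Dbar" and v: "v \<in> Dbar"
  obtain f where uL: "u \<in> L2 M" and f: "approximates M E C f u" by (rule closure_domainE[OF u])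
  obtain g where vL: "v \<in> L2 M" and g: "approximates M E C g v" by (rule closure_domainE[OF v])
  fix a b
  show lin: "(\<lambda>x. a * u x + b * v x) \<in> Dbar"
    by (rule closure_domainI[OF L2.lin_mem[OF uL vL] approximates_lin[OF f g uL vL]])
  show "Ebar u v = Ebar v u"
    using closure_form_tendsto[OF f g uL vL] closure_form_tendsto[OF g f vL uL]
    by (simp add: sym[OF approximatesD(1)[OF f] approximatesD(1)[OF g]] LIMSEQ_unique)
  fix w assume w: "w \<in> Dbar"
  obtain h where wL: "w \<in> L2 M" and h: "approximates M E C h w" by (rule closure_domainE[OF w])
  show "Ebar (\<lambda>x. a * u x + b * v x) w = a * Ebar u w + b * Ebar v w"
  proof (rule LIMSEQ_unique)
    show "(\<lambda>n. E (\<lambda>x. a * f n x + b * g n x) (h n)) \<longlonglongrightarrow> Ebar (\<lambda>x. a * u x + b * v x) w"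
      by (rule closure_form_tendsto[OF approximates_lin[OF f g uL vL] h L2.lin_mem[OF uL vL] wL])
    show "(\<lambda>n. E (\<lambda>x. a * f n x + b * g n x) (h n)) \<longlonglongrightarrow> a * Ebar u w + b * Ebar v w"
      using tendsto_add[OF tendsto_mult[OF tendsto_const closure_form_tendsto[OF f h uL wL], of a]
          tendsto_mult[OF tendsto_const closure_form_tendsto[OF g h vL wL], of b]]
      by (simp only: lin_left approximatesD(1)[OF f] approximatesD(1)[OF g] approximatesD(1)[OF h])
  qed
next
  fix u assume u: "u \<in> Dbar"
  obtain f where uL: "u \<in> L2 M" and f: "approximates M E C f u" by (rule closure_domainE[OF u])
  show "0 \<le> Ebar u u"
    by (rule LIMSEQ_le_const[OF closure_form_tendsto[OF f f uL uL]]) (auto intro: nonneg approximatesD(1)[OF f])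
next
  fix u and e :: real assume "u \<in> L2 M" "e > 0"
  then show "\<exists>v\<in>Dbar. l2_norm M (\<lambda>x. u x - v x) < e" using dense core_mem by blast
next
  fix u v assume u: "u \<in> Dbar" and v: "v \<in> borel_measurable M" and ae: "AE x in M. u x = v x"
  have uL: "u \<in> L2 M" by (rule closure_domain_L2[OF u])
  have vL: "v \<in> L2 M" by (rule L2_cong_AE[OF uL v ae])
  \<comment> \<open>The limit function enters \<open>approximates\<close> only through an L2
    distance, so a.e. equal functions have the same approximating sequences. Domain and form are
    both defined through these.\<close>
  have eq: "approximates M E C f u = approximates M E C f v" for f
  proof (cases "\<forall>n. f n \<in> C")
    case True
    have "l2_norm M (\<lambda>x. f n x - u x) = l2_norm M (\<lambda>x. f n x - v x)" for n
    proof -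
      have [measurable]: "f n \<in> borel_measurable M" "u \<in> borel_measurable M" "v \<in> borel_measurable M"
        using True C_L2 L2_measurable uL v by blast+
      have "AE x in M. f n x - u x = f n x - v x" using ae by eventually_elim simp
      then show ?thesis unfolding l2_norm_def by (subst l2_inner_cong_AE) auto
    qed
    then show ?thesis by (simp add: approximates_def)
  qed (auto simp: approximates_def)
  show "v \<in> Dbar" using u vL eq by (simp add: closure_domain_def)
  fix w show "Ebar u w = Ebar v w" by (simp add: closure_form_def eq)
qed

sublocale bar: nonneg_form Dbar Ebar
  by (rule symmetric_formD(1)[OF symmetric_form_closure])

sublocale bar1: nonneg_form Dbar "form1 M Ebar"
  by (rule symmetric_formD(2)[OF symmetric_form_closure])

text \<open>For fixed k the sequence f k - f n approximates f k - u as n grows, so the closed energy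
  of f k - u is the limit of E(f k - f n, f k - f n), which is small by the Cauchy property.\<close>

lemma approximates_closure_tendsto:
  assumes f: "approximates M E C f u" and u: "u \<in> L2 M"
  shows "(\<lambda>k. form1 M Ebar (\<lambda>x. f k x - u x) (\<lambda>x. f k x - u x)) \<longlonglongrightarrow> 0"
proof -
  note fC = approximatesD(1)[OF f]
  have uD: "u \<in> Dbar" by (rule closure_domainI[OF u f])
  have 1: "(\<lambda>k. Ebar (\<lambda>x. f k x - u x) (\<lambda>x. f k x - u x)) \<longlonglongrightarrow> 0"
  proof (rule LIMSEQ_I)
    fix e :: real assume e: "e > 0"
    obtain N where N: "\<And>i j. i \<ge> N \<Longrightarrow> j \<ge> N \<Longrightarrow> E (\<lambda>x. f i x - f j x) (\<lambda>x. f i x - f j x) < e / 2"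
      using approximatesD(2)[OF f] half_gt_zero[OF e] unfolding form_cauchy_def by meson
    show "\<exists>no. \<forall>k\<ge>no. norm (Ebar (\<lambda>x. f k x - u x) (\<lambda>x. f k x - u x) - 0) < e"
    proof (intro exI allI impI)
      fix k assume k: "k \<ge> N"
      have a: "approximates M E C (\<lambda>n x. f k x - f n x) (\<lambda>x. f k x - u x)"
        by (rule approximates_diff[OF approximates_const[OF fC] f C_L2[OF fC] u])
      have L: "(\<lambda>x. f k x - u x) \<in> L2 M" by (intro L2.diff_mem C_L2 fC u)
      have "Ebar (\<lambda>x. f k x - u x) (\<lambda>x. f k x - u x) \<le> e / 2"
        by (rule LIMSEQ_le_const2[OF closure_form_tendsto[OF a a L L]])
          (use N[OF k] in \<open>auto intro!: exI[of _ N] less_imp_le\<close>)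
      moreover have "0 \<le> Ebar (\<lambda>x. f k x - u x) (\<lambda>x. f k x - u x)"
        by (intro bar.nonneg bar.diff_mem core_mem fC uD)
      ultimately show "norm (Ebar (\<lambda>x. f k x - u x) (\<lambda>x. f k x - u x) - 0) < e" using e by simp
    qed
  qed
  show ?thesis
    unfolding form1_def
    using tendsto_add[OF 1 approximatesD(3)[OF f, unfolded l2_norm_tendsto_0_iff]] by simp
qed

lemma core_dense_closure:
  assumes u: "u \<in> Dbar" and e: "e > 0"
  obtains v where "v \<in> C" "form1 M Ebar (\<lambda>x. u x - v x) (\<lambda>x. u x - v x) < e"
proof -
  obtain f where uL: "u \<in> L2 M" and f: "approximates M E C f u" by (rule closure_domainE[OF u])
  obtain k where "form1 M Ebar (\<lambda>x. f k x - u x) (\<lambda>x. f k x - u x) < e"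
    using order_tendstoD(2)[OF approximates_closure_tendsto[OF f uL] e] by (auto simp: eventually_sequentially)
  then show thesis
    using that[OF approximatesD(1)[OF f]] bar1.diff_commute[OF u core_mem[OF approximatesD(1)[OF f]]] by metis
qed

text \<open>Each f n is replaced by a core function h n within 1/(n+1) in the \<open>form1\<close>
  norm. The sequence h is Cauchy for the energy and for L2, so it approximates its own L2 limit, and
  f follows.\<close>

lemma closed_form_closure: "closed_form M Ebar Dbar"
  unfolding closed_form_def
proof (intro allI impI)
  fix f assume "(\<forall>n. f n \<in> Dbar) \<and> form_cauchy (form1 M Ebar) f"
  then have f: "\<And>n. f n \<in> Dbar" and c: "form_cauchy (form1 M Ebar) f" by auto
  have "\<exists>h. h \<in> C \<and> form1 M Ebar (\<lambda>x. f n x - h x) (\<lambda>x. f n x - h x) < inverse (real (Suc n))" for n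
    by (rule core_dense_closure[OF f[of n], of "inverse (real (Suc n))"]) auto
  then obtain h where h: "\<And>n. h n \<in> C"
    and hf: "\<And>n. form1 M Ebar (\<lambda>x. f n x - h n x) (\<lambda>x. f n x - h n x) < inverse (real (Suc n))" by metis
  note hD = core_mem[OF h]
  have fh: "(\<lambda>n. form1 M Ebar (\<lambda>x. f n x - h n x) (\<lambda>x. f n x - h n x)) \<longlonglongrightarrow> 0"
    by (rule tendsto_sandwich[OF _ _ tendsto_const LIMSEQ_inverse_real_of_nat])
      (use hf in \<open>auto intro!: always_eventually less_imp_le bar1.nonneg bar.diff_mem f hD\<close>)
  have c1: "form_cauchy (form1 M Ebar) h"
    unfolding form_cauchy_def
  proof (intro allI impI)
    fix e :: real assume e: "e > 0"
    obtain N1 where N1: "\<And>i j. i \<ge> N1 \<Longrightarrow> j \<ge> N1 \<Longrightarrow> form1 M Ebar (\<lambda>x. f i x - f j x) (\<lambda>x. f i x - f j x) < e / 16"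
      using c e unfolding form_cauchy_def by (meson divide_pos_pos zero_less_numeral)
    obtain N2 where N2: "\<And>n. n \<ge> N2 \<Longrightarrow> form1 M Ebar (\<lambda>x. f n x - h n x) (\<lambda>x. f n x - h n x) < e / 16"
      using order_tendstoD(2)[OF fh, of "e / 16"] e by (auto simp: eventually_sequentially)
    show "\<exists>N. \<forall>i\<ge>N. \<forall>j\<ge>N. form1 M Ebar (\<lambda>x. h i x - h j x) (\<lambda>x. h i x - h j x) < e"
    proof (intro exI allI impI)
      fix i j assume "i \<ge> max N1 N2" "j \<ge> max N1 N2"
      then show "form1 M Ebar (\<lambda>x. h i x - h j x) (\<lambda>x. h i x - h j x) < e"
        using bar1.diff_triangle_le[OF hD[of i] f[of i] hD[of j]] bar1.diff_triangle_le[OF f[of i] f[of j] hD[of j]]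
          bar1.diff_commute[OF f[of i] hD[of i]] N1[of i j] N2[of i] N2[of j] e by simp
    qed
  qed
  have le: "E (\<lambda>x. h i x - h j x) (\<lambda>x. h i x - h j x) \<le> form1 M Ebar (\<lambda>x. h i x - h j x) (\<lambda>x. h i x - h j x)"
    "l2_inner M (\<lambda>x. h i x - h j x) (\<lambda>x. h i x - h j x) \<le> form1 M Ebar (\<lambda>x. h i x - h j x) (\<lambda>x. h i x - h j x)" for i j
    using bar.nonneg[OF bar.diff_mem[OF hD hD], of i j]
    by (simp_all add: form1_def closure_form_core diff_mem h l2_inner_self_nonneg)
  have cE: "form_cauchy E h" and cL: "form_cauchy (l2_inner M) h"
    using c1 le unfolding form_cauchy_def by (meson le_less_trans)+
  obtain u where u: "u \<in> L2 M" "(\<lambda>n. l2_norm M (\<lambda>x. h n x - u x)) \<longlonglongrightarrow> 0"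
    using L2_complete[OF C_L2[OF h] cL] by blast
  have a: "approximates M E C h u" using h cE u(2) by (simp add: approximates_def)
  have uD: "u \<in> Dbar" by (rule closure_domainI[OF u(1) a])
  have "(\<lambda>n. form1 M Ebar (\<lambda>x. f n x - u x) (\<lambda>x. f n x - u x)) \<longlonglongrightarrow> 0"
  proof (rule tendsto_sandwich[OF _ _ tendsto_const])
    show "(\<lambda>n. 2 * form1 M Ebar (\<lambda>x. f n x - h n x) (\<lambda>x. f n x - h n x)
        + 2 * form1 M Ebar (\<lambda>x. h n x - u x) (\<lambda>x. h n x - u x)) \<longlonglongrightarrow> 0"
      using tendsto_add[OF tendsto_mult[OF tendsto_const fh] tendsto_mult[OF tendsto_const approximates_closure_tendsto[OF a u(1)]], of 2 2] by simp
  qed (auto intro!: always_eventually bar1.nonneg bar1.diff_triangle_le bar.diff_mem f hD uD)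
  with uD show "\<exists>u\<in>Dbar. (\<lambda>n. form1 M Ebar (\<lambda>x. f n x - u x) (\<lambda>x. f n x - u x)) \<longlonglongrightarrow> 0" by blast
qed

text \<open>Makes \<open>bounded_energy_limit\<close> available for the closure; contractions and
  locality both pass to the limit through it.\<close>

sublocale closed_bar: closed_symmetric_form M Ebar Dbar
  by unfold_locales (rule symmetric_form_closure closed_form_closure)+

end

section \<open>Supports of classes of functions\<close>

text \<open>The complement of the support is a union of possibly uncountably many open sets on which
  u vanishes a.e.; Lindelof selects countably many, so the exceptional null sets still add up to a
  null set.\<close>

lemma AE_outside_ess_support:
  fixes u :: "'a::second_countable_topology \<Rightarrow> real"
  shows "AE x in M. x \<notin> ess_support M u \<longrightarrow> u x = 0"
proof -
  define F where "F = {U. open U \<and> (AE y in M. y \<in> U \<longrightarrow> u y = 0)}"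
  obtain F' where F': "F' \<subseteq> F" "countable F'" "\<Union>F' = \<Union>F"
    using Lindelof[of F] by (auto simp: F_def)
  have "AE y in M. \<forall>U\<in>F'. y \<in> U \<longrightarrow> u y = 0"
    using F'(1) by (subst AE_ball_countable[OF F'(2)]) (auto simp: F_def)
  then show ?thesis
  proof eventually_elim
    case (elim y)
    have "y \<in> \<Union>F" if "y \<notin> ess_support M u" using that by (auto simp: ess_support_def F_def)
    then show ?case using elim F'(3) by blast
  qed
qed

lemma ess_support_compact:
  fixes u :: "'a::t2_space \<Rightarrow> real"
  assumes "compact S" "\<And>x. u x \<noteq> 0 \<Longrightarrow> x \<in> S"
  shows "ess_support M u \<subseteq> S" "compact (ess_support M u)"
proof -
  have S: "closed S" by (rule compact_imp_closed[OF assms(1)])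
  show sub: "ess_support M u \<subseteq> S"
  proof
    fix x assume x: "x \<in> ess_support M u"
    have "AE y in M. y \<in> - S \<longrightarrow> u y = 0" using assms(2) by auto
    then show "x \<in> S" using x open_Compl[OF S] by (auto simp: ess_support_def)
  qed
  have "- ess_support M u = \<Union>{U. open U \<and> (AE y in M. y \<in> U \<longrightarrow> u y = 0)}"
    by (auto simp: ess_support_def)
  moreover have "open (\<Union>{U. open U \<and> (AE y in M. y \<in> U \<longrightarrow> u y = 0)})" by (rule open_Union) auto
  ultimately have "closed (ess_support M u)" by (simp add: closed_def)
  then have "compact (S \<inter> ess_support M u)" by (rule compact_Int_closed[OF assms(1)])
  then show "compact (ess_support M u)" using sub by (simp add: Int_absorb1)
qed

section \<open>Density of the core\<close>

lemma l2_norm_dominated_convergence: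
  assumes f: "\<And>n. f n \<in> borel_measurable M" and u: "u \<in> borel_measurable M" and w: "w \<in> L2 M"
    and lim: "AE x in M. (\<lambda>n. f n x) \<longlonglongrightarrow> u x" and dom: "\<And>n. AE x in M. \<bar>f n x\<bar> \<le> w x"
  shows "(\<lambda>n. l2_norm M (\<lambda>x. f n x - u x)) \<longlonglongrightarrow> 0"
proof -
  have wm: "w \<in> borel_measurable M" by (rule L2_measurable[OF w])
  have "AE x in M. \<forall>n. \<bar>f n x\<bar> \<le> w x" using dom by (simp add: AE_all_countable)
  with lim have uw: "AE x in M. \<bar>u x\<bar> \<le> w x"
  proof eventually_elim
    case (elim x)
    then show ?case by (intro LIMSEQ_le_const2[OF tendsto_rabs]) auto
  qed
  have "(\<lambda>n. \<integral>x. (f n x - u x)\<^sup>2 \<partial>M) \<longlonglongrightarrow> (\<integral>x. 0 \<partial>M)"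
  proof (rule integral_dominated_convergence[where w = "\<lambda>x. 4 * (w x)\<^sup>2"])
    show "integrable M (\<lambda>x. 4 * (w x)\<^sup>2)" using w by (auto simp: L2_def)
    show "(\<lambda>x. (f n x - u x)\<^sup>2) \<in> borel_measurable M" for n using f u by auto
    show "AE x in M. (\<lambda>n. (f n x - u x)\<^sup>2) \<longlonglongrightarrow> 0"
      using lim
    proof eventually_elim
      case (elim x)
      have "(\<lambda>n. (f n x - u x)\<^sup>2) \<longlonglongrightarrow> (u x - u x)\<^sup>2" by (intro tendsto_intros elim)
      then show ?case by simp
    qed
    show "AE x in M. norm ((f n x - u x)\<^sup>2) \<le> 4 * (w x)\<^sup>2" for n
      using dom[of n] uw
    proof eventually_elim
      case (elim x)
      then have "\<bar>f n x - u x\<bar> \<le> 2 * w x" by linarith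
      then have "\<bar>f n x - u x\<bar>\<^sup>2 \<le> (2 * w x)\<^sup>2" by (intro power_mono) auto
      then show ?case by (simp add: power_mult_distrib)
    qed
  qed simp
  then show ?thesis by (simp add: l2_norm_tendsto_0_iff l2_inner_def power2_eq_square)
qed

lemma indicator_L2: "A \<in> sets M \<Longrightarrow> emeasure M A < \<infinity> \<Longrightarrow> indicator A \<in> L2 M"
  by (auto simp: L2_def power2_eq_square indicator_inter_arith[symmetric] intro!: integrable_real_indicator)

context energy_dominated_form
begin

lemma indicator_compact_approx:
  assumes K: "compact K" and e: "e > 0"
  shows "\<exists>v\<in>core. l2_norm m (\<lambda>x. indicator K x - v x) < e"
proof -
  obtain g where g: "g \<in> C0" "\<And>x. 0 \<le> g x" "\<And>x. x \<in> K \<Longrightarrow> g x = 1"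
    using C0_bump[OF locally_compact K open_UNIV] by (metis subset_UNIV)
  \<comment> \<open>The second condition shrinks V n to K. The first already gives g > 0 for n = 0,
    so every V n stays in the compact support of g, whose indicator is the dominating
    function.\<close>
  define V where "V n = {x. 1 - 1 / real (Suc n) < g x} \<inter> {x. infdist x K < 1 / real (Suc n)}" for n
  show ?thesis
  \<comment> \<open>The distance \<open>infdist\<close> to the empty set is 0 by convention, so the
    neighbourhoods would not shrink in that case.\<close>
  proof (cases "K = {}")
    case True
    then show ?thesis using e by (intro bexI[OF _ core_zero]) (simp add: l2_norm_def l2_inner_def)
  next
    case False
    have oV: "open (V n)" for n unfolding V_def
      by (intro open_Int open_Collect_less continuous_intros C0_continuous g(1))
    have KV: "K \<subseteq> V n" for n using g(3) by (auto simp: V_def)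
    have "\<exists>p. p \<in> core \<and> (\<forall>x. 0 \<le> p x \<and> p x \<le> 1) \<and> (\<forall>x\<in>K. p x = 1) \<and> (\<forall>x. x \<notin> V n \<longrightarrow> p x = 0)" for n
      using core_bump[OF K oV KV, of n] by metis
    then obtain p where p: "\<And>n. p n \<in> core" "\<And>n x. 0 \<le> p n x" "\<And>n x. p n x \<le> 1" "\<And>n x. x \<in> K \<Longrightarrow> p n x = 1"
      "\<And>n x. x \<notin> V n \<Longrightarrow> p n x = 0" by metis
    let ?S = "closure {x. g x \<noteq> 0}"
    have S: "?S \<in> sets m" "emeasure m ?S < \<infinity>" using radon_compact[OF radon_m C0_compact_support[OF g(1)]] by auto
    have "(\<lambda>n. l2_norm m (\<lambda>x. p n x - indicator K x)) \<longlonglongrightarrow> 0"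
    proof (rule l2_norm_dominated_convergence)
      show "p n \<in> borel_measurable m" for n using p(1) radon_C0_measurable[OF radon_m] by blast
      show "indicator K \<in> borel_measurable m" using radon_compact[OF radon_m K] by simp
      show "indicator ?S \<in> L2 m" by (rule indicator_L2[OF S])
      show "AE x in m. \<bar>p n x\<bar> \<le> indicator ?S x" for n
      proof (rule AE_I2)
        fix x
        show "\<bar>p n x\<bar> \<le> indicator ?S x"
        proof (cases "x \<in> ?S")
          case True then show ?thesis using p(2,3)[of n x] by simp
        next
          case False
          then have "g x = 0" by (rule C0_outside_support)
          then have "x \<notin> V n" by (simp add: V_def)
          then show ?thesis using p(5) by simp
        qed
      qed
      show "AE x in m. (\<lambda>n. p n x) \<longlonglongrightarrow> indicator K x"
      proof (rule AE_I2)
        fix x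
        show "(\<lambda>n. p n x) \<longlonglongrightarrow> indicator K x"
        proof (cases "x \<in> K")
          case True then show ?thesis using p(4) by simp
        next
          case nK: False
          have "infdist x K > 0"
            using nK False compact_imp_closed[OF K] in_closed_iff_infdist_zero[of K x] infdist_nonneg[of x K] by (simp add: less_le)
          then obtain N where N: "1 / real (Suc N) < infdist x K" using nat_approx_posE by blast
          have "p n x = 0" if "n \<ge> N" for n
          proof -
            have "1 / real (Suc n) \<le> 1 / real (Suc N)" using that by (simp add: frac_le)
            then have "x \<notin> V n" using N by (simp add: V_def)
            then show ?thesis by (rule p(5))
          qed
          then show ?thesis using nK by (intro tendsto_eventually) (auto simp: eventually_sequentially)
        qed
      qed
    qed
    from order_tendstoD(2)[OF this e] obtain n where "l2_norm m (\<lambda>x. p n x - indicator K x) < e"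
      by (auto simp: eventually_sequentially)
    then show ?thesis using p(1)[of n] l2_norm_diff_commute[of m "p n"] by (metis (no_types))
  qed
qed

text \<open>Regularity gives density only over the original measure, so density over
  \<open>m\<close> is proved afresh. The set H of approximable functions is linear and closed; it
  contains indicators of compact sets, then by inner regularity of finite-measure Borel sets, then
  all of L2.\<close>

lemma core_dense_L2:
  assumes u: "u \<in> L2 m" and e: "e > 0"
  shows "\<exists>v\<in>core. l2_norm m (\<lambda>x. u x - v x) < e"
proof -
  define H where "H = {u \<in> L2 m. \<forall>e>0. \<exists>v\<in>core. l2_norm m (\<lambda>x. u x - v x) < e}"
  have H_L2: "u \<in> L2 m" if "u \<in> H" for u using that by (simp add: H_def)
  have H_lin: "(\<lambda>x. a * u x + b * w x) \<in> H" if u: "u \<in> H" and w: "w \<in> H" for a b u w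
  proof -
    note uL = H_L2[OF u] and wL = H_L2[OF w]
    have "\<exists>v\<in>core. l2_norm m (\<lambda>x. a * u x + b * w x - v x) < e" if e: "e > 0" for e
    proof -
      define d where "d = e / (\<bar>a\<bar> + \<bar>b\<bar> + 1)"
      have p: "\<bar>a\<bar> + \<bar>b\<bar> + 1 > 0" by linarith
      have d: "d > 0" using e p by (simp add: d_def)
      have "e = (\<bar>a\<bar> + \<bar>b\<bar> + 1) * d" using p by (simp add: d_def)
      then have de: "\<bar>a\<bar> * d + \<bar>b\<bar> * d < e" using d by (simp add: algebra_simps)
      obtain f g where f: "f \<in> core" "l2_norm m (\<lambda>x. u x - f x) < d" and g: "g \<in> core" "l2_norm m (\<lambda>x. w x - g x) < d"
        using u w d unfolding H_def by blast
      have L: "(\<lambda>x. u x - f x) \<in> L2 m" "(\<lambda>x. w x - g x) \<in> L2 m"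
        by (intro L2.diff_mem uL wL core_L2_m f g)+
      have "(\<lambda>x. a * u x + b * w x - (a * f x + b * g x)) = (\<lambda>x. a * (u x - f x) + b * (w x - g x))"
        by (simp add: algebra_simps)
      then have "l2_norm m (\<lambda>x. a * u x + b * w x - (a * f x + b * g x))
          \<le> \<bar>a\<bar> * l2_norm m (\<lambda>x. u x - f x) + \<bar>b\<bar> * l2_norm m (\<lambda>x. w x - g x)"
        using l2_norm_triangle[OF L2.scale_mem[OF L(1), of a] L2.scale_mem[OF L(2), of b]] by (simp only: l2_norm_scale L)
      also have "\<dots> \<le> \<bar>a\<bar> * d + \<bar>b\<bar> * d" using less_imp_le[OF f(2)] less_imp_le[OF g(2)] by (intro add_mono mult_left_mono) auto
      finally show ?thesis using de core_lin[OF f(1) g(1), of a b] by (intro bexI[of _ "\<lambda>x. a * f x + b * g x"]) auto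
    qed
    then show ?thesis using L2.lin_mem[OF uL wL] by (simp add: H_def)
  qed
  have H_closed: "u \<in> H" if u: "u \<in> L2 m" and ap: "\<And>e. e > 0 \<Longrightarrow> \<exists>w\<in>H. l2_norm m (\<lambda>x. u x - w x) < e" for u
  proof -
    have "\<exists>v\<in>core. l2_norm m (\<lambda>x. u x - v x) < e" if e: "e > 0" for e
    proof -
      obtain w where w: "w \<in> H" "l2_norm m (\<lambda>x. u x - w x) < e / 2" using ap[OF half_gt_zero[OF e]] by blast
      obtain v where v: "v \<in> core" "l2_norm m (\<lambda>x. w x - v x) < e / 2"
        using w(1) half_gt_zero[OF e] unfolding H_def by blast
      show ?thesis
        using l2_norm_diff_triangle[OF u H_L2[OF w(1)] core_L2_m[OF v(1)]] w(2) v by (intro bexI[of _ v]) auto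
    qed
    then show ?thesis using u by (simp add: H_def)
  qed
  have H_compact: "indicator K \<in> H" if K: "compact K" for K
    using indicator_compact_approx[OF K] indicator_L2[OF radon_compact[OF radon_m K]] by (simp add: H_def)
  have H_ind: "indicator A \<in> H" if A: "A \<in> sets m" and AL: "indicator A \<in> L2 m" for A
  proof (rule H_closed[OF AL])
    fix e :: real assume e: "e > 0"
    have Ab: "A \<in> sets borel" using A radon_sets[OF radon_m] by simp
    have "integrable m (indicator A :: 'a \<Rightarrow> real)"
      using AL by (simp add: L2_def power2_eq_square indicator_inter_arith[symmetric])
    then have fin: "emeasure m A < \<infinity>" using A radon_space[OF radon_m] by (simp add: integrable_indicator_iff)
    have sup: "emeasure m A = (SUP K\<in>{K. compact K \<and> K \<subseteq> A}. emeasure m K)"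
      using radon_m Ab by (simp add: radon_measure_def)
    \<comment> \<open>The L2 norm of the indicator of A - K is the square root of its
      measure.\<close>
    have e2: "e\<^sup>2 > 0" using e by simp
    have "\<exists>K\<in>{K. compact K \<and> K \<subseteq> A}. emeasure m A < emeasure m K + ennreal (e\<^sup>2)"
      by (rule SUP_approx_ennreal[OF _ _ sup]) (use e2 fin in auto)
    then obtain K where K: "compact K" "K \<subseteq> A" "emeasure m A < emeasure m K + ennreal (e\<^sup>2)" by blast
    note Ks = radon_compact[OF radon_m K(1)]
    have dif: "emeasure m (A - K) = emeasure m A - emeasure m K"
      using Ks K(2) A by (intro emeasure_Diff) auto
    have "emeasure m (A - K) < ennreal (e\<^sup>2)"
      unfolding dif using K(3) Ks(2) emeasure_mono[OF K(2) A] fin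
      by (cases "emeasure m A"; cases "emeasure m K") (auto simp: ennreal_minus ennreal_plus[symmetric] ennreal_less_iff simp del: ennreal_plus)
    moreover from this have "emeasure m (A - K) = ennreal (measure m (A - K))"
      by (intro emeasure_eq_ennreal_measure) auto
    ultimately have "measure m (A - K) < e\<^sup>2"
      by (simp add: ennreal_less_iff)
    have "(\<lambda>x. indicator A x - indicator K x) = (indicator (A - K) :: 'a \<Rightarrow> real)"
      using K(2) by (auto simp: indicator_def fun_eq_iff)
    then have "l2_norm m (\<lambda>x. indicator A x - indicator K x) = sqrt (measure m (A - K))"
      using A Ks(1) by (simp add: l2_norm_def l2_inner_def indicator_inter_arith[symmetric] radon_space[OF radon_m])
    also have "\<dots> < e" using \<open>measure m (A - K) < e\<^sup>2\<close> e by (simp add: real_less_lsqrt)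
    finally show "\<exists>w\<in>H. l2_norm m (\<lambda>x. indicator A x - w x) < e" using H_compact[OF K(1)] by blast
  qed
  \<comment> \<open>Square integrability is a premise inside the induction: summands and increasing
    approximants inherit it from the function that dominates them.\<close>
  have nn: "u \<in> L2 m \<longrightarrow> u \<in> H" if "u \<in> borel_measurable m" "\<And>x. 0 \<le> u x" for u
    using that
  proof (induction rule: borel_measurable_induct_real)
    case (set A) then show ?case using H_ind by blast
  next
    case (mult u c)
    show ?case
    proof
      assume L: "(\<lambda>x. c * u x) \<in> L2 m"
      show "(\<lambda>x. c * u x) \<in> H"
      proof (cases "c = 0")
        case True
        have "(\<lambda>x. 0) \<in> H" using H_compact[of "{}"] by (simp add: indicator_def[abs_def])
        then show ?thesis using True by simp
      next
        case False
        then have "u \<in> L2 m" using L2.scale_mem[OF L, of "1 / c"] by simp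
        then have "u \<in> H" using mult by blast
        from H_lin[OF this this, of c 0] show ?thesis by simp
      qed
    qed
  next
    case (add u1 u2)
    show ?case
    proof
      assume L: "(\<lambda>x. u2 x + u1 x) \<in> L2 m"
      have "u1 \<in> L2 m" "u2 \<in> L2 m"
        using add by (auto intro!: l2_norm_mono(1)[OF L] AE_I2)
      then have "u1 \<in> H" "u2 \<in> H" using add by blast+
      from H_lin[OF this(2,1), of 1 1] show "(\<lambda>x. u2 x + u1 x) \<in> H" by simp
    qed
  next
    case (seq U)
    show ?case
    proof
      assume L: "u \<in> L2 m"
      have lim: "(\<lambda>i. U i x) \<longlonglongrightarrow> u x" for x using seq by (auto simp: radon_space[OF radon_m])
      have le: "U i x \<le> u x" for i x
        using incseq_le[OF _ lim, of x i] seq(3) by (auto simp: incseq_def le_fun_def)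
      have UL: "U i \<in> L2 m" for i
        by (rule l2_norm_mono(1)[OF L]) (use seq le in \<open>auto intro!: AE_I2 intro: order_trans[OF _ abs_ge_self]\<close>)
      have UH: "U i \<in> H" for i using UL seq by blast
      have "(\<lambda>i. l2_norm m (\<lambda>x. U i x - u x)) \<longlonglongrightarrow> 0"
        by (rule l2_norm_dominated_convergence[OF _ _ L]) (use seq le lim L2_measurable[OF L] in \<open>auto intro!: AE_I2\<close>)
      then show "u \<in> H"
      proof (intro H_closed L)
        fix e :: real assume "(\<lambda>i. l2_norm m (\<lambda>x. U i x - u x)) \<longlonglongrightarrow> 0" "e > 0"
        from order_tendstoD(2)[OF this] obtain i where "l2_norm m (\<lambda>x. U i x - u x) < e"
          by (auto simp: eventually_sequentially)
        then show "\<exists>w\<in>H. l2_norm m (\<lambda>x. u x - w x) < e"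
          using UH[of i] l2_norm_diff_commute[of m u "U i"] by (intro bexI[of _ "U i"]) simp_all
      qed
    qed
  qed
  have um: "u \<in> borel_measurable m" by (rule L2_measurable[OF u])
  have p: "(\<lambda>x. max (u x) 0) \<in> H"
    by (rule nn[rule_format]) (use um in \<open>auto intro!: l2_norm_mono(1)[OF u] AE_I2\<close>)
  have n: "(\<lambda>x. max (- u x) 0) \<in> H"
    by (rule nn[rule_format]) (use um in \<open>auto intro!: l2_norm_mono(1)[OF u] AE_I2\<close>)
  have "(\<lambda>x. 1 * max (u x) 0 + (-1) * max (- u x) 0) \<in> H" by (rule H_lin[OF p n])
  also have "(\<lambda>x. 1 * max (u x) 0 + (-1) * max (- u x) 0) = u" by (auto simp: fun_eq_iff max_def)
  finally show ?thesis using e by (simp add: H_def)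
qed

sublocale closure: closable_nonneg_form core E m
proof
  show "(\<lambda>_. 0) \<in> core" by (rule core_zero)
  show "\<exists>v\<in>core. l2_norm m (\<lambda>x. u x - v x) < e" if "u \<in> L2 m" "e > 0" for u e
    by (rule core_dense_L2[OF that])
  show "closable m E core" by (rule closable_core)
next
  fix u v w and a b :: real assume u: "u \<in> core"
  show "0 \<le> E u u" using u by (intro nonneg) auto
  assume v: "v \<in> core"
  show "(\<lambda>x. a * u x + b * v x) \<in> core" by (rule core_lin[OF u v])
  show "E u v = E v u" using u v by (intro sym) auto
  assume w: "w \<in> core"
  show "E (\<lambda>x. a * u x + b * v x) w = a * E u w + b * E v w" using u v w by (intro lin_left) auto
qed

section \<open>Contractions, regularity and locality of the closure\<close>

text \<open>The functions G(f n) converge to G(u) in L2 with energies at most E(f n, f n), but they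
  need not be Cauchy in energy. So the definition of the closure does not apply to them directly,
  and \<open>bounded_energy_limit\<close> is used instead.\<close>

lemma closure_contraction:
  assumes u: "u \<in> closure.Dbar" and G: "continuous_on UNIV G" "G 0 = 0"
    and L: "\<And>s t. \<bar>G s - G t\<bar> \<le> 1 * \<bar>s - t\<bar>"
  shows "(\<lambda>x. G (u x)) \<in> closure.Dbar" "closure.Ebar (\<lambda>x. G (u x)) (\<lambda>x. G (u x)) \<le> closure.Ebar u u"
proof -
  obtain f where uL: "u \<in> L2 m" and f: "approximates m E core f u" by (rule closure.closure_domainE[OF u])
  note fC = closure.approximatesD(1)[OF f]
  have GC: "(\<lambda>x. G (f n x)) \<in> core" "E (\<lambda>x. G (f n x)) (\<lambda>x. G (f n x)) \<le> E (f n) (f n)" for n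
    using core_compose[OF fC G L, of n] by simp_all
  have um: "u \<in> borel_measurable m" by (rule L2_measurable[OF uL])
  have Gm: "G \<in> borel_measurable borel" by (rule borel_measurable_continuous_onI[OF G(1)])
  have GL: "(\<lambda>x. G (u x)) \<in> L2 m"
    by (rule l2_norm_mono(1)[OF uL]) (use L[of _ 0] G(2) measurable_compose[OF um Gm] in \<open>auto intro!: AE_I2\<close>)
  have lim: "(\<lambda>n. l2_norm m (\<lambda>x. G (f n x) - G (u x))) \<longlonglongrightarrow> 0"
  proof (rule tendsto_sandwich[OF _ _ tendsto_const closure.approximatesD(3)[OF f]])
    show "\<forall>\<^sub>F n in sequentially. l2_norm m (\<lambda>x. G (f n x) - G (u x)) \<le> l2_norm m (\<lambda>x. f n x - u x)"
    proof (rule always_eventually, rule allI, rule l2_norm_mono(2))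
      fix n
      show "(\<lambda>x. f n x - u x) \<in> L2 m" by (intro L2.diff_mem core_L2_m fC uL)
      show "(\<lambda>x. G (f n x) - G (u x)) \<in> borel_measurable m"
        by (intro L2_measurable L2.diff_mem core_L2_m GC GL)
      show "AE x in m. \<bar>G (f n x) - G (u x)\<bar> \<le> \<bar>f n x - u x\<bar>" using L by simp
    qed
  qed (auto simp: l2_norm_nonneg)
  have Elim: "(\<lambda>n. E (f n) (f n)) \<longlonglongrightarrow> closure.Ebar u u" by (rule closure.closure_form_tendsto[OF f f uL uL])
  have *: "(\<lambda>x. G (u x)) \<in> closure.Dbar \<and> closure.Ebar (\<lambda>x. G (u x)) (\<lambda>x. G (u x)) \<le> closure.Ebar u u + d" if d: "d > 0" for d
  proof -
    obtain N where N: "\<And>n. n \<ge> N \<Longrightarrow> E (f n) (f n) < closure.Ebar u u + d"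
      using order_tendstoD(2)[OF Elim, of "closure.Ebar u u + d"] d by (auto simp: eventually_sequentially)
    \<comment> \<open>Only the tail from N on has energy below the bound, hence the shift of the
      index.\<close>
    have 1: "(\<lambda>x. G (f (n + N) x)) \<in> closure.Dbar" for n by (rule closure.core_mem[OF GC(1)])
    have 2: "closure.Ebar (\<lambda>x. G (f (n + N) x)) (\<lambda>x. G (f (n + N) x)) \<le> closure.Ebar u u + d" for n
      using GC(2)[of "n + N"] N[of "n + N"] unfolding closure.closure_form_core[OF GC(1) GC(1)] by simp
    show ?thesis
      using closure.closed_bar.bounded_energy_limit(1,2)[OF 1 2 GL LIMSEQ_ignore_initial_segment[OF lim]] by blast
  qed
  show "(\<lambda>x. G (u x)) \<in> closure.Dbar" using *[of 1] by simp
  show "closure.Ebar (\<lambda>x. G (u x)) (\<lambda>x. G (u x)) \<le> closure.Ebar u u"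
  proof (rule field_le_epsilon)
    fix d :: real assume "d > 0"
    from *[OF this] show "closure.Ebar (\<lambda>x. G (u x)) (\<lambda>x. G (u x)) \<le> closure.Ebar u u + d" by blast
  qed
qed

lemma closure_dirichlet_form: "symmetric_dirichlet_form m closure.Ebar closure.Dbar"
proof -
  define G where "G t = min (max t 0) (1 :: real)" for t
  have G: "continuous_on UNIV G" "G 0 = 0" "\<bar>G s - G t\<bar> \<le> 1 * \<bar>s - t\<bar>" for s t
    unfolding G_def by (intro continuous_intros) (auto simp: min_def max_def)
  have "unit_contraction_operates closure.Ebar closure.Dbar"
    unfolding unit_contraction_operates_def G_def[symmetric] by (intro ballI conjI closure_contraction[OF _ G])
  then show ?thesis
    unfolding symmetric_dirichlet_form_def
    using closure.symmetric_form_closure closure.closed_form_closure by blast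
qed

lemma closure_regular: "regular_form m closure.Ebar closure.Dbar"
  unfolding regular_form_def
proof (intro conjI ballI allI impI)
  fix u and e :: real assume u: "u \<in> closure.Dbar" and e: "e > 0"
  obtain v where "v \<in> core" "form1 m closure.Ebar (\<lambda>x. u x - v x) (\<lambda>x. u x - v x) < e"
    by (rule closure.core_dense_closure[OF u e])
  then show "\<exists>v\<in>C0 \<inter> closure.Dbar. form1 m closure.Ebar (\<lambda>x. u x - v x) (\<lambda>x. u x - v x) < e"
    using closure.core_mem by blast
next
  fix f :: "'a \<Rightarrow> real" and e :: real assume "f \<in> C0" "e > 0"
  then obtain v where "v \<in> core" "\<forall>x. \<bar>f x - v x\<bar> < e" using regular unfolding regular_form_def by blast
  then show "\<exists>v\<in>C0 \<inter> closure.Dbar. \<forall>x. \<bar>f x - v x\<bar> < e" using closure.core_mem by blast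
qed

text \<open>
  Truncation keeps the energies of the localised approximants \<open>\<phi> clip K (f n)\<close> bounded, so they
  converge to \<open>u\<close> weakly, which suffices to pass to the limit in \<open>E (\<phi> f, \<psi> g) = 0\<close>.
\<close>

lemma localised_approximation:
  assumes u: "u \<in> closure.Dbar" and uK: "\<And>x. \<bar>u x\<bar> \<le> K" and p: "p \<in> core"
    and p1: "\<And>x. x \<in> A \<Longrightarrow> p x = 1" and p01: "\<And>x. 0 \<le> p x" "\<And>x. p x \<le> 1"
    and u0: "AE x in m. x \<notin> A \<longrightarrow> u x = 0"
  obtains h c where "\<And>n. h n \<in> core" "\<And>n. (\<lambda>x. p x * h n x) \<in> core"
    "\<And>n. E (\<lambda>x. p x * h n x) (\<lambda>x. p x * h n x) \<le> c"
    "(\<lambda>n. l2_norm m (\<lambda>x. p x * h n x - u x)) \<longlonglongrightarrow> 0"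
proof -
  have K0: "K \<ge> 0" using uK[of undefined] by linarith
  obtain f where uL: "u \<in> L2 m" and f: "approximates m E core f u" by (rule closure.closure_domainE[OF u])
  note fC = closure.approximatesD(1)[OF f]
  have fD: "f n \<in> D" for n using fC by blast
  obtain B where B: "\<And>n. E (f n) (f n) \<le> B"
    using form_cauchy_bounded[OF fD closure.approximatesD(2)[OF f]] by blast
  define h where "h n x = clip K (f n x)" for n x
  have hC: "h n \<in> core" and hE: "E (h n) (h n) \<le> B" for n
    using core_clip[OF fC K0, of n] B[of n] by (simp_all add: h_def[abs_def])
  have phC: "(\<lambda>x. p x * h n x) \<in> core" for n by (rule core_mult[OF p hC])
  show thesis
  proof (rule that[OF hC phC])
    fix n
    have "E (\<lambda>x. p x * h n x) (\<lambda>x. p x * h n x) \<le> 2 * K\<^sup>2 * E p p + 2 * 1\<^sup>2 * E (h n) (h n)"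
      by (rule core_mult_energy[OF p hC]) (use p01 K0 in \<open>auto simp: h_def clip_abs_le\<close>)
    also have "\<dots> \<le> 2 * K\<^sup>2 * E p p + 2 * B" using hE by simp
    finally show "E (\<lambda>x. p x * h n x) (\<lambda>x. p x * h n x) \<le> 2 * K\<^sup>2 * E p p + 2 * B" .
  next
    show "(\<lambda>n. l2_norm m (\<lambda>x. p x * h n x - u x)) \<longlonglongrightarrow> 0"
    proof (rule tendsto_sandwich[OF _ _ tendsto_const closure.approximatesD(3)[OF f]])
      show "\<forall>\<^sub>F n in sequentially. l2_norm m (\<lambda>x. p x * h n x - u x) \<le> l2_norm m (\<lambda>x. f n x - u x)"
      proof (rule always_eventually, rule allI, rule l2_norm_mono(2))
        fix n
        show "(\<lambda>x. f n x - u x) \<in> L2 m" by (intro L2.diff_mem core_L2_m fC uL)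
        show "(\<lambda>x. p x * h n x - u x) \<in> borel_measurable m"
          by (intro L2_measurable L2.diff_mem core_L2_m phC uL)
        show "AE x in m. \<bar>p x * h n x - u x\<bar> \<le> \<bar>f n x - u x\<bar>"
          using u0
        proof eventually_elim
          case (elim x)
          have "u x = p x * clip K (u x)"
            using elim p1[of x] uK[of x] K0 by (cases "x \<in> A") (auto simp: clip_def)
          then have "\<bar>p x * h n x - u x\<bar> = \<bar>p x\<bar> * \<bar>clip K (f n x) - clip K (u x)\<bar>"
            by (simp add: h_def abs_mult[symmetric] right_diff_distrib)
          also have "\<dots> \<le> 1 * (1 * \<bar>f n x - u x\<bar>)"
            using p01[of x] clip_lipschitz[of K "f n x" "u x"] by (intro mult_mono) auto
          finally show ?case by simp
        qed
      qed
    qed (auto simp: l2_norm_nonneg)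
  qed
qed

text \<open>The orthogonality clause of \<open>bounded_energy_limit\<close>, once per argument:
  first v n goes to u against each fixed w k, then w k goes to z against u. This is why all pairs of
  indices appear in \<open>zero\<close>, not just equal ones.\<close>

lemma closure_form_weak_zero:
  assumes v: "\<And>n. v n \<in> closure.Dbar" "\<And>n. closure.Ebar (v n) (v n) \<le> c"
    "u \<in> L2 m" "(\<lambda>n. l2_norm m (\<lambda>x. v n x - u x)) \<longlonglongrightarrow> 0"
    and w: "\<And>n. w n \<in> closure.Dbar" "\<And>n. closure.Ebar (w n) (w n) \<le> c'"
    "z \<in> L2 m" "(\<lambda>n. l2_norm m (\<lambda>x. w n x - z x)) \<longlonglongrightarrow> 0"
    and zero: "\<And>n k. closure.Ebar (v n) (w k) = 0"
  shows "closure.Ebar u z = 0"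
proof -
  note lv = closure.closed_bar.bounded_energy_limit[OF v] and lw = closure.closed_bar.bounded_energy_limit[OF w]
  have 1: "closure.Ebar u (w k) = 0" for k by (rule lv(3)[OF w(1) zero])
  have "closure.Ebar z u = 0"
    by (rule lw(3)[OF lv(1)]) (simp add: 1 closure.bar.sym[OF w(1) lv(1)])
  then show ?thesis by (simp add: closure.bar.sym[OF lv(1) lw(1)])
qed

text \<open>Both cutoffs come from a single f that is 1 on A and 0 on B: p is carried by {f >= 2/3}
  and q by {f <= 1/3}. The gap between the thresholds keeps even the closed supports
  disjoint.\<close>

lemma separating_bumps:
  assumes A: "compact A" and B: "compact B" and AB: "A \<inter> B = {}"
  obtains p q where "p \<in> core" "q \<in> core" "\<And>x. 0 \<le> p x" "\<And>x. p x \<le> 1" "\<And>x. 0 \<le> q x" "\<And>x. q x \<le> 1"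
    "\<And>x. x \<in> A \<Longrightarrow> p x = 1" "\<And>x. x \<in> B \<Longrightarrow> q x = 1"
    "closure {x. p x \<noteq> 0} \<inter> closure {x. q x \<noteq> 0} = {}"
proof -
  obtain f where f: "f \<in> core" "\<And>x. 0 \<le> f x" "\<And>x. f x \<le> 1" "\<And>x. x \<in> A \<Longrightarrow> f x = 1" "\<And>x. x \<notin> - B \<Longrightarrow> f x = 0"
    by (rule core_bump[OF A, of "- B"]) (use AB compact_imp_closed[OF B] in auto)
  obtain g where g: "g \<in> core" "\<And>x. 0 \<le> g x" "\<And>x. g x \<le> 1" "\<And>x. x \<in> B \<Longrightarrow> g x = 1"
    by (rule core_bump[OF B open_UNIV]) auto
  have fc: "continuous_on UNIV f" using f(1) C0_continuous by blast
  define p where "p x = max (3 * f x - 2) 0" for x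
  define r where "r x = min (3 * f x) 1" for x
  define q where "q x = g x - g x * r x" for x
  have c: "continuous_on UNIV (\<lambda>t. max (3 * t - 2) (0::real))" "continuous_on UNIV (\<lambda>t. min (3 * t) (1::real))"
    by (intro continuous_intros)+
  have "(\<lambda>x. (\<lambda>t. max (3 * t - 2) (0::real)) (f x)) \<in> core"
    by (rule core_compose(1)[OF f(1) c(1), of 3]) (auto simp: max_def abs_if)
  then have p: "p \<in> core" by (simp add: p_def[abs_def])
  have "(\<lambda>x. (\<lambda>t. min (3 * t) (1::real)) (f x)) \<in> core"
    by (rule core_compose(1)[OF f(1) c(2), of 3]) (auto simp: min_def abs_if)
  then have r: "r \<in> core" by (simp add: r_def[abs_def])
  have r01: "0 \<le> r x" "r x \<le> 1" for x using f(2)[of x] by (auto simp: r_def)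
  have q: "q \<in> core" unfolding q_def by (intro core_diff core_mult g(1) r)
  have q01: "0 \<le> q x" "q x \<le> 1" for x
  proof -
    have "q x = g x * (1 - r x)" by (simp add: q_def algebra_simps)
    then show "0 \<le> q x" "q x \<le> 1" using g(2,3)[of x] r01[of x] by (auto intro!: mult_le_one)
  qed
  have "closure {x. p x \<noteq> 0} \<subseteq> {x. 2/3 \<le> f x}"
    by (rule closure_minimal) (auto simp: p_def intro!: closed_Collect_le continuous_intros fc)
  moreover have "closure {x. q x \<noteq> 0} \<subseteq> {x. f x \<le> 1/3}"
    by (rule closure_minimal) (auto simp: q_def r_def min_def intro!: closed_Collect_le continuous_intros fc split: if_splits)
  ultimately have "closure {x. p x \<noteq> 0} \<inter> closure {x. q x \<noteq> 0} = {}" by fastforce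
  moreover have "0 \<le> p x" "p x \<le> 1" for x using f(3)[of x] by (auto simp: p_def)
  moreover have "p x = 1" if "x \<in> A" for x using f(4)[OF that] by (simp add: p_def)
  moreover have "q x = 1" if "x \<in> B" for x using f(5)[of x] g(4)[OF that] that by (simp add: q_def r_def)
  ultimately show thesis using that[OF p q] q01 by blast
qed

text \<open>Supports on the two sides refer to different measures. The bridge is formed by cutoff
  core functions, which vanish pointwise off disjoint compact sets, so that their supports are
  disjoint for \<open>M\<close> as well. Two weak limits follow, the first removing the localised
  approximation and the second the truncation.\<close>

lemma closure_local:
  assumes loc: "local_form M E D"
  shows "local_form m closure.Ebar closure.Dbar"
  unfolding local_form_def
proof (intro ballI impI)
  fix u v assume u: "u \<in> closure.Dbar" and v: "v \<in> closure.Dbar"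
    and S: "compact (ess_support m u) \<and> compact (ess_support m v) \<and> ess_support m u \<inter> ess_support m v = {}"
  let ?A = "ess_support m u" and ?B = "ess_support m v"
  have cA: "compact ?A" and cB: "compact ?B" and AB: "?A \<inter> ?B = {}" using S by simp_all
  obtain p q where pC: "p \<in> core" and qC: "q \<in> core" and p01: "\<And>x. 0 \<le> p x" "\<And>x. p x \<le> 1"
    and q01: "\<And>x. 0 \<le> q x" "\<And>x. q x \<le> 1" and p1: "\<And>x. x \<in> ?A \<Longrightarrow> p x = 1"
    and q1: "\<And>x. x \<in> ?B \<Longrightarrow> q x = 1"
    and pq: "closure {x. p x \<noteq> 0} \<inter> closure {x. q x \<noteq> 0} = {}"
    by (rule separating_bumps[OF cA cB AB]) (rule that; simp)
  have clip: "(\<lambda>x. clip (real n) (w x)) \<in> closure.Dbar"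
     "closure.Ebar (\<lambda>x. clip (real n) (w x)) (\<lambda>x. clip (real n) (w x)) \<le> closure.Ebar w w"
    if "w \<in> closure.Dbar" for n w
    by (rule closure_contraction[OF that continuous_clip clip_0 clip_lipschitz]; simp)+
  have cliplim: "(\<lambda>n. l2_norm m (\<lambda>x. clip (real n) (w x) - w x)) \<longlonglongrightarrow> 0" if w: "w \<in> closure.Dbar" for w
  proof (rule l2_norm_dominated_convergence)
    show "(\<lambda>x. clip (real n) (w x)) \<in> borel_measurable m" for n
      by (intro L2_measurable closure.closure_domain_L2 clip w)
    show "w \<in> borel_measurable m" by (intro L2_measurable closure.closure_domain_L2 w)
    have L: "w \<in> L2 m" by (rule closure.closure_domain_L2[OF w])
    show "(\<lambda>x. \<bar>w x\<bar>) \<in> L2 m"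
      by (rule l2_norm_mono(1)[OF L]) (use L2_measurable[OF L] in auto)
    show "AE x in m. \<bar>clip (real n) (w x)\<bar> \<le> \<bar>w x\<bar>" for n by (auto simp: clip_def)
    show "AE x in m. (\<lambda>n. clip (real n) (w x)) \<longlonglongrightarrow> w x"
    proof (rule AE_I2, rule tendsto_eventually)
      fix x
      obtain N where N: "\<bar>w x\<bar> \<le> real N" using real_arch_simple by blast
      show "\<forall>\<^sub>F n in sequentially. clip (real n) (w x) = w x"
        unfolding eventually_sequentially
      proof (intro exI allI impI)
        fix n assume "N \<le> n"
        then have "\<bar>w x\<bar> \<le> real n" using N by (meson of_nat_mono order_trans)
        then show "clip (real n) (w x) = w x" by (auto simp: clip_def)
      qed
    qed
  qed
  have clip0: "AE x in m. x \<notin> ess_support m w \<longrightarrow> clip (real n) (w x) = 0" for n w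
    using AE_outside_ess_support[of m w] by eventually_elim (simp add: clip_0)
  \<comment> \<open>The truncation levels n and k are independent because the final passage to the
    limit treats the two arguments one after the other.\<close>
  have bounded: "closure.Ebar (\<lambda>x. clip (real n) (u x)) (\<lambda>x. clip (real k) (v x)) = 0" for n k
  proof -
    obtain h c where h: "\<And>i. h i \<in> core" "\<And>i. (\<lambda>x. p x * h i x) \<in> core"
        "\<And>i. E (\<lambda>x. p x * h i x) (\<lambda>x. p x * h i x) \<le> c"
        "(\<lambda>i. l2_norm m (\<lambda>x. p x * h i x - clip (real n) (u x))) \<longlonglongrightarrow> 0"
      by (rule localised_approximation[OF clip(1)[OF u] clip_abs_le pC p1 p01 clip0]) auto
    obtain g c' where g: "\<And>i. g i \<in> core" "\<And>i. (\<lambda>x. q x * g i x) \<in> core"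
        "\<And>i. E (\<lambda>x. q x * g i x) (\<lambda>x. q x * g i x) \<le> c'"
        "(\<lambda>i. l2_norm m (\<lambda>x. q x * g i x - clip (real k) (v x))) \<longlonglongrightarrow> 0"
      by (rule localised_approximation[OF clip(1)[OF v] clip_abs_le qC q1 q01 clip0]) auto
    have "E (\<lambda>x. p x * h i x) (\<lambda>x. q x * g j x) = 0" for i j
    proof -
      have cp: "compact (closure {x. p x \<noteq> 0})" and cq: "compact (closure {x. q x \<noteq> 0})"
        using pC qC C0_compact_support by blast+
      have sp: "x \<in> closure {x. p x \<noteq> 0}" if "p x * h i x \<noteq> 0" for x
        using that C0_outside_support[of x p] by auto
      have sq: "x \<in> closure {x. q x \<noteq> 0}" if "q x * g j x \<noteq> 0" for x
        using that C0_outside_support[of x q] by auto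
      have ep: "ess_support M (\<lambda>x. p x * h i x) \<subseteq> closure {x. p x \<noteq> 0}" "compact (ess_support M (\<lambda>x. p x * h i x))"
        by (rule ess_support_compact[OF cp sp], assumption)+
      have eq: "ess_support M (\<lambda>x. q x * g j x) \<subseteq> closure {x. q x \<noteq> 0}" "compact (ess_support M (\<lambda>x. q x * g j x))"
        by (rule ess_support_compact[OF cq sq], assumption)+
      have "ess_support M (\<lambda>x. p x * h i x) \<inter> ess_support M (\<lambda>x. q x * g j x) = {}"
        using ep(1) eq(1) pq by blast
      then show ?thesis
        using loc core_D[OF h(2)[of i]] core_D[OF g(2)[of j]] ep(2) eq(2) unfolding local_form_def by blast
    qed
    then have zero: "closure.Ebar (\<lambda>x. p x * h i x) (\<lambda>x. q x * g j x) = 0" for i j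
      by (simp only: closure.closure_form_core[OF h(2) g(2)])
    have hE: "closure.Ebar (\<lambda>x. p x * h i x) (\<lambda>x. p x * h i x) \<le> c" for i
      unfolding closure.closure_form_core[OF h(2) h(2)] by (rule h(3))
    have gE: "closure.Ebar (\<lambda>x. q x * g i x) (\<lambda>x. q x * g i x) \<le> c'" for i
      unfolding closure.closure_form_core[OF g(2) g(2)] by (rule g(3))
    show ?thesis
      by (rule closure_form_weak_zero[OF closure.core_mem[OF h(2)] hE closure.closure_domain_L2[OF clip(1)[OF u]] h(4)
          closure.core_mem[OF g(2)] gE closure.closure_domain_L2[OF clip(1)[OF v]] g(4) zero])
  qed
  show "closure.Ebar u v = 0"
    by (rule closure_form_weak_zero[OF clip(1)[OF u] clip(2)[OF u] closure.closure_domain_L2[OF u] cliplim[OF u]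
        clip(1)[OF v] clip(2)[OF v] closure.closure_domain_L2[OF v] cliplim[OF v] bounded])
qed

end

theorem theorem5p1:
  fixes \<mu> m :: "'a::{metric_space, second_countable_topology} measure"
    and E :: "('a \<Rightarrow> real) \<Rightarrow> ('a \<Rightarrow> real) \<Rightarrow> real"
    and F :: "('a \<Rightarrow> real) set"
  assumes "locally_compact_space (euclidean :: 'a topology)"
    and "admissible_reference_measure \<mu>"
    and "symmetric_dirichlet_form \<mu> E F"
    and "regular_form \<mu> E F"
    and "admissible_reference_measure m"
    and "\<forall>f\<in>C0 \<inter> F. absolutely_continuous m (energy_measure E F f)"
    and "irreducible_form \<mu> E F \<or> transient_form \<mu> E F"
  shows "closable m E (C0 \<inter> F) \<and>
    symmetric_dirichlet_form m (closure_form m E (C0 \<inter> F)) (closure_domain m E (C0 \<inter> F)) \<and>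
    regular_form m (closure_form m E (C0 \<inter> F)) (closure_domain m E (C0 \<inter> F)) \<and>
    (local_form \<mu> E F \<longrightarrow>
      local_form m (closure_form m E (C0 \<inter> F)) (closure_domain m E (C0 \<inter> F)))"
proof -
  interpret energy_dominated_form \<mu> E F m
    using assms by unfold_locales (auto simp: symmetric_dirichlet_form_def)
  show ?thesis
    using closable_core closure_dirichlet_form closure_regular closure_local by blast
qed

end
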